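(* Let $\theta_0$ satisfy Assumption (A), with $A_1,\dots,A_{p_0}$, $B_1,\dots,B_{q_0}$ the matrices of $\theta_0$, and let $K_1,K_2$ be score functions satisfying Assumption (C). (i) The null hypothesis $\mathcal{H}^{(n)}(\theta_0)$ is invariant under affine transformations if and only if $\theta_0$ is such that $A_i=a_iI_k$ for all $i=1,\dots,p_0$ and $B_j=b_jI_k$ for all $j=1,\dots,q_0$, for some real numbers $a_i,b_j$. (ii) When the null hypothesis $\mathcal{H}^{(n)}(\theta_0)$ is affine-invariant, then $Q^{(n)}_K(\theta_0)$ also is.
   Context: Primes denote transposes; $U$ is uniform on $(0,1)$. **Model.** Fix $k\ge1$ and integers $0\le p_0\le p_1$, $0\le q_0\le q_1$. The VARMA$(p_1,q_1)$ model is $X_t-\sum_{i=1}^{p_1}A_iX_{t-i}=\varepsilon_t+\sum_{i=1}^{q_1}B_i\varepsilon_{t-i}$ with real $k\times k$ matrices and parameter $\theta=((\mathrm{vec}A_1)',\dots,(\mathrm{vec}A_{p_1})',(\mathrm{vec}B_1)',\dots,(\mathrm{vec}B_{q_1})')'$. The value $\theta_0$ is fixed, with $A_i=0$ for $i>p_0$ and $B_i=0$ for $i>q_0$. Assumption (A): $\det A_{p_0}\ne0\neq\det B_{q_0}$ (void for zero order), all complex roots of $\det(I_k-\sum_{i=1}^{p_0}A_iz^i)$ and of $\det(I_k+\sum_{i=1}^{q_0}B_iz^i)$ lie outside the unit ball, and the greatest common left divisor of these matrix polynomials is $I_k$. A radial density is $f:(0,\infty)\to[0,\infty)$ with $f>0$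 a.e. and $\int_0^\infty r^{k-1}f(r)\,dr<\infty$. $\mathcal{H}^{(n)}(\theta_0,\Sigma,f)$ is the hypothesis under which $X^{(n)}=(X_1,\dots,X_n)$ is generated by the model with parameter $\theta_0$ and i.i.d. innovations with density $c_{k,f}(\det\Sigma)^{-1/2}f((z'\Sigma^{-1}z)^{1/2})$; $\mathcal{H}^{(n)}(\theta_0):=\bigcup_\Sigma\bigcup_f\mathcal{H}^{(n)}(\theta_0,\Sigma,f)$ over all symmetric positive definite $\Sigma$ and all radial densities $f$. Initial values ($X_t,\varepsilon_t$, $t\le0$) are set to zero. "The null hypothesis is invariant under affine transformations" means: for every nonsingular $k\times k$ matrix $M$ and every $n$, the family of distributions $\mathcal{H}^{(n)}(\theta_0)$ is preserved by $(X_1,\dots,X_n)\mapsto(MX_1,\dots,MX_n)$. A statistic $T$ is affine-invariant if $T(MX_1,\dots,MX_n)=T(X_1,\dots,X_n)$ for every nonsingular $M$. **Scores.** Assumption (C): $K_1,K_2:(0,1)\to\mathbb{R}$ are continuous differences of two monotone increasing functions, $\int_0^1K_\ell^2<\infty$ (and nonzero, so that the statistic is defined). **Statistic.** Residuals: $Z_t:=X_t-\sum_{i=1}^{p_0}A_iX_{t-i}-\sum_{i=1}^{q_0}B_iZ_{t-i}$, $t=1,\dots,n$, with $X_t=Z_t=0$ for $t\le0$. For $n>k(k-1)$, $C^{(n)}_{\rm Tyl}$ is the unique upper triangular matrix with positive diagonal and upper left entry $1$ such that $\frac1n\sum_{t=1}^n\frac{C^{(n)}_{\rm Tyl}Z_t(C^{(n)}_{\rm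 Tyl}Z_t)'}{\|C^{(n)}_{\rm Tyl}Z_t\|^2}=\frac1kI_k$; $\hat\Sigma^{(n)}:=(C^{(n)\prime}_{\rm Tyl}C^{(n)}_{\rm Tyl})^{-1}$; $W_t:=C^{(n)}_{\rm Tyl}Z_t/\|C^{(n)}_{\rm Tyl}Z_t\|$; $\hat R_t$ is the rank of $\|C^{(n)}_{\rm Tyl}Z_t\|$ among the $\|C^{(n)}_{\rm Tyl}Z_s\|$, $s=1,\dots,n$. $\tilde\Gamma^{(n)}_{i;K}(\theta_0):=C^{(n)\prime}_{\rm Tyl}\big(\frac1{n-i}\sum_{t=i+1}^nK_1(\frac{\hat R_t}{n+1})K_2(\frac{\hat R_{t-i}}{n+1})W_tW_{t-i}'\big)(C^{(n)\prime}_{\rm Tyl})^{-1}$; $\tilde S^{(n)}_K(\theta_0)$ stacks $(n-i)^{1/2}\mathrm{vec}\,\tilde\Gamma^{(n)}_{i;K}(\theta_0)$, $i=1,\dots,n-1$. Put $B_0=I_k$; $\sum_{u\ge0}G_uz^u=(I_k-\sum_{i=1}^{p_0}A_iz^i)^{-1}$, $\sum_{u\ge0}H_uz^u=(I_k+\sum_{i=1}^{q_0}B_iz^i)^{-1}$, $G_u=H_u=0$ for $u<0$; $\pi:=\max(p_1-p_0,q_1-q_0)$, $\pi_0:=\pi+p_0+q_0$. The $k\times k$ matrices $D_1,\dots,D_{p_0+q_0}$ solve $G_t+\sum_{i=1}^{p_0+q_0}G_{t-i}D_i'=0$ ($t=q_0+1,\dots,q_0+p_0$) and $H_t+\sum_{i=1}^{p_0+q_0}H_{t-i}D_i'=0$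 ($t=p_0+1,\dots,p_0+q_0$). $\{\Psi^{(1)}_t,\dots,\Psi^{(p_0+q_0)}_t\}$ are $k\times k$ matrix sequences forming a fundamental system of solutions of $\Psi_t+\sum_{i=1}^{p_0+q_0}D_i\Psi_{t-i}=0$ (the statistic below does not depend on its choice). $\bar\Psi_m:=(\Psi^{(j)}_{\pi+i})_{1\le i\le m-\pi,1\le j\le p_0+q_0}\otimes I_k$ and $Q^{(n)}_{\theta_0}:=H^{(r)}_{n-1}B'^{(l)}_{n-1}\mathrm{diag}(I_{k^2\pi},\bar\Psi_{n-1})$, where $H^{(r)}_m,B'^{(l)}_m$ are lower block triangular $k^2m\times k^2m$ with $(i,j)$ blocks ($i\ge j$) $I_k\otimes H_{i-j}$ and $B_{i-j}'\otimes I_k$. Finally $n^{1/2}\tilde T^{(n)}_K(\theta_0):=Q^{(n)\prime}_{\theta_0}\tilde S^{(n)}_K(\theta_0)$, $J^{(n)}_{\theta_0,\hat\Sigma}:=Q^{(n)\prime}_{\theta_0}[I_{n-1}\otimes(\hat\Sigma^{(n)}\otimes(\hat\Sigma^{(n)})^{-1})]Q^{(n)}_{\theta_0}$ and $$Q^{(n)}_K(\theta_0):=\frac{k^2n}{\mathrm E[K_1^2(U)]\mathrm E[K_2^2(U)]}\tilde T^{(n)\prime}_K(\theta_0)(J^{(n)}_{\theta_0,\hat\Sigma})^{-1}\tilde T^{(n)}_K(\theta_0)$$ (for $n$ large enough that it is defined). *)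

theory Defs
  imports
    "HOL-Probability.Probability"
    "HOL-Computational_Algebra.Computational_Algebra"
    "Jordan_Normal_Form.Determinant"
    "Jordan_Normal_Form.Gauss_Jordan_Elimination"
begin

text \<open>
  Vectors in $R^k$ and $k \times k$ matrices are \<open>real^'k\<close> and \<open>real^'k^'k\<close> with \<open>k = CARD('k)\<close>.
  The order on \<open>'k\<close> is needed for ``upper triangular'' and for stacking; on a finite type the
  class \<open>wellorder\<close> says no more than \<open>linorder\<close>, and it is the class under which the library
  states the linear change of variables for Lebesgue measure. The stacked matrices, whose sizes
  depend on the series length, are matrices of type \<open>real mat\<close>.
\<close>

hide_const (open) Matrix.mat Matrix.vec Matrix.row Matrix.col Determinant.det
no_notation vec_index (infixl "$" 100)
no_notation scalar_prod (infix "\<bullet>" 70)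

text \<open>A parameter value is given by the two coefficient sequences \<open>A\<close>, \<open>B\<close> (indices from 1).
  Observed and innovation series are functions on time, used at times \<open>1..n\<close> only.\<close>

text \<open>$x_{t-i}$, with zero initial values.\<close>
definition lag :: "(nat \<Rightarrow> real^'k) \<Rightarrow> nat \<Rightarrow> nat \<Rightarrow> real^'k" where
  "lag x t i = (if i < t then x (t - i) else 0)"

definition varma_eq ::
  "(nat \<Rightarrow> real^'k^'k) \<Rightarrow> (nat \<Rightarrow> real^'k^'k) \<Rightarrow> nat \<Rightarrow> nat \<Rightarrow> nat \<Rightarrow>
   (nat \<Rightarrow> real^'k) \<Rightarrow> (nat \<Rightarrow> real^'k) \<Rightarrow> bool" where
  "varma_eq A B p q n x e \<longleftrightarrow>
     (\<forall>t\<in>{1..n}. x t - (\<Sum>i=1..p. A i *v lag x t i) = e t + (\<Sum>i=1..q. B i *v lag e t i))"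

text \<open>Polynomial matrices; \<open>ar_poly\<close> is $I - \sum_i A_i z^i$ and \<open>ma_poly\<close> is $I + \sum_i B_i z^i$.\<close>

definition monom_mat :: "real^'k^'k \<Rightarrow> nat \<Rightarrow> real poly^'k^'k" where
  "monom_mat C i = (\<chi> r c. monom (C $ r $ c) i)"

definition ar_poly :: "(nat \<Rightarrow> real^'k^'k) \<Rightarrow> nat \<Rightarrow> real poly^'k^'k" where
  "ar_poly A p = mat 1 - (\<Sum>i=1..p. monom_mat (A i) i)"

definition ma_poly :: "(nat \<Rightarrow> real^'k^'k) \<Rightarrow> nat \<Rightarrow> real poly^'k^'k" where
  "ma_poly B q = mat 1 + (\<Sum>i=1..q. monom_mat (B i) i)"

definition left_divides :: "real poly^'k^'k \<Rightarrow> real poly^'k^'k \<Rightarrow> bool" where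
  "left_divides L P \<longleftrightarrow> (\<exists>R. P = L ** R)"

definition is_gcld :: "real poly^'k^'k \<Rightarrow> real poly^'k^'k \<Rightarrow> real poly^'k^'k \<Rightarrow> bool" where
  "is_gcld G P Q \<longleftrightarrow> left_divides G P \<and> left_divides G Q \<and>
     (\<forall>L. left_divides L P \<and> left_divides L Q \<longrightarrow> left_divides L G)"

definition roots_outside :: "real poly \<Rightarrow> bool" where
  "roots_outside P \<longleftrightarrow> (\<forall>z::complex. poly (map_poly complex_of_real P) z = 0 \<longrightarrow> cmod z > 1)"

definition assumption_A ::
  "(nat \<Rightarrow> real^'k^'k) \<Rightarrow> (nat \<Rightarrow> real^'k^'k) \<Rightarrow> nat \<Rightarrow> nat \<Rightarrow> bool" where
  "assumption_A A B p0 q0 \<longleftrightarrow>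
     (p0 > 0 \<longrightarrow> det (A p0) \<noteq> 0) \<and> (q0 > 0 \<longrightarrow> det (B q0) \<noteq> 0) \<and>
     roots_outside (det (ar_poly A p0)) \<and> roots_outside (det (ma_poly B q0)) \<and>
     is_gcld (mat 1) (ar_poly A p0) (ma_poly B q0)"

text \<open>Measurability of \<open>f\<close> on the positive half-line is implied by the integrability condition;
  values of \<open>f\<close> outside it are irrelevant below.\<close>
definition radial_density :: "nat \<Rightarrow> (real \<Rightarrow> real) \<Rightarrow> bool" where
  "radial_density k f \<longleftrightarrow>
     (\<forall>r>0. f r \<ge> 0) \<and> (AE r in lborel. r > 0 \<longrightarrow> f r > 0) \<and>
     set_integrable lborel {0<..} (\<lambda>r. r ^ (k - 1) * f r)"

definition pos_def :: "real^'k^'k \<Rightarrow> bool" where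
  "pos_def S \<longleftrightarrow> transpose S = S \<and> (\<forall>v. v \<noteq> 0 \<longrightarrow> v \<bullet> (S *v v) > 0)"

text \<open>The factor in front is the normalizing constant $c_{k,f}$.\<close>
definition elliptical_density :: "real^'k^'k \<Rightarrow> (real \<Rightarrow> real) \<Rightarrow> real^'k \<Rightarrow> real" where
  "elliptical_density S f z =
     1 / (LINT y|(lborel :: (real^'k) measure). f (norm y))
       * (1 / sqrt (det S)) * f (sqrt (z \<bullet> (matrix_inv S *v z)))"

definition innovation_law :: "nat \<Rightarrow> real^'k^'k \<Rightarrow> (real \<Rightarrow> real) \<Rightarrow> (nat \<Rightarrow> real^'k) measure" where
  "innovation_law n S f = PiM {1..n} (\<lambda>_. density lborel (\<lambda>z. ennreal (elliptical_density S f z)))"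

text \<open>The laws of $(X_1,\dots,X_n)$ under the null hypothesis with given shape and radial density
  (a single law, since with zero initial values the innovations determine the series).\<close>
definition null_hyp_at ::
  "(nat \<Rightarrow> real^'k^'k) \<Rightarrow> (nat \<Rightarrow> real^'k^'k) \<Rightarrow> nat \<Rightarrow> nat \<Rightarrow> nat \<Rightarrow>
   real^'k^'k \<Rightarrow> (real \<Rightarrow> real) \<Rightarrow> (nat \<Rightarrow> real^'k) measure set" where
  "null_hyp_at A B p q n S f =
     {distr (innovation_law n S f) (PiM {1..n} (\<lambda>_. borel)) X | X.
        X \<in> innovation_law n S f \<rightarrow>\<^sub>M PiM {1..n} (\<lambda>_. borel) \<and>
        (\<forall>e\<in>space (innovation_law n S f). varma_eq A B p q n (X e) e)}"

definition null_hyp ::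
  "(nat \<Rightarrow> real^'k^'k) \<Rightarrow> (nat \<Rightarrow> real^'k^'k) \<Rightarrow> nat \<Rightarrow> nat \<Rightarrow> nat \<Rightarrow>
   (nat \<Rightarrow> real^'k) measure set" where
  "null_hyp A B p q n =
     (\<Union>S\<in>{S. pos_def S}. \<Union>f\<in>{f. radial_density CARD('k) f}. null_hyp_at A B p q n S f)"

definition null_hyp_affine_invariant ::
  "(nat \<Rightarrow> real^'k^'k) \<Rightarrow> (nat \<Rightarrow> real^'k^'k) \<Rightarrow> nat \<Rightarrow> nat \<Rightarrow> bool" where
  "null_hyp_affine_invariant A B p q \<longleftrightarrow>
     (\<forall>(M::real^'k^'k) n. invertible M \<longrightarrow>
        (\<lambda>P. distr P (PiM {1..n} (\<lambda>_. borel)) (\<lambda>x. \<lambda>t\<in>{1..n}. M *v x t)) ` null_hyp A B p q n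
        = null_hyp A B p q n)"

definition score_function :: "(real \<Rightarrow> real) \<Rightarrow> bool" where
  "score_function K \<longleftrightarrow>
     continuous_on {0<..<1} K \<and>
     (\<exists>g h. mono_on {0<..<1} g \<and> mono_on {0<..<1} h \<and> (\<forall>u\<in>{0<..<1}. K u = g u - h u)) \<and>
     set_integrable lborel {0<..<1} (\<lambda>u. (K u)\<^sup>2) \<and>
     (\<exists>u\<in>{0<..<1}. K u \<noteq> 0)"

definition second_moment :: "(real \<Rightarrow> real) \<Rightarrow> real" where
  "second_moment K = (LINT u|uniform_measure lborel {0<..<1}. (K u)\<^sup>2)"

fun residual ::
  "(nat \<Rightarrow> real^'k^'k) \<Rightarrow> (nat \<Rightarrow> real^'k^'k) \<Rightarrow> nat \<Rightarrow> nat \<Rightarrow> (nat \<Rightarrow> real^'k) \<Rightarrow> nat \<Rightarrow> real^'k" where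
  "residual A B p q x t =
     x t - (\<Sum>i=1..p. A i *v lag x t i)
         - (\<Sum>i=1..q. B i *v (if 0 < i \<and> i < t then residual A B p q x (t - i) else 0))"

declare residual.simps [simp del]

definition outer_prod :: "real^'k \<Rightarrow> real^'k \<Rightarrow> real^'k^'k" where
  "outer_prod u v = (\<chi> i j. u $ i * v $ j)"

definition is_tyler :: "nat \<Rightarrow> (nat \<Rightarrow> real^'k::_) \<Rightarrow> real^'k::{finite,wellorder}^'k::_ \<Rightarrow> bool" where
  "is_tyler n z C \<longleftrightarrow>
     (\<forall>i j. j < i \<longrightarrow> C $ i $ j = 0) \<and> (\<forall>i. C $ i $ i > 0) \<and>
     C $ Min UNIV $ Min UNIV = 1 \<and>
     (1 / real n) *\<^sub>R (\<Sum>t=1..n. (1 / (norm (C *v z t))\<^sup>2) *\<^sub>R outer_prod (C *v z t) (C *v z t))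
       = (1 / real CARD('k)) *\<^sub>R mat 1"

definition tyler :: "nat \<Rightarrow> (nat \<Rightarrow> real^'k::_) \<Rightarrow> real^'k::{finite,wellorder}^'k::_" where
  "tyler n z = (THE C. is_tyler n z C)"

definition shape_est :: "nat \<Rightarrow> (nat \<Rightarrow> real^'k::_) \<Rightarrow> real^'k::{finite,wellorder}^'k::_" where
  "shape_est n z = matrix_inv (transpose (tyler n z) ** tyler n z)"

definition std_direction :: "nat \<Rightarrow> (nat \<Rightarrow> real^'k::{finite,wellorder}) \<Rightarrow> nat \<Rightarrow> real^'k::_" where
  "std_direction n z t = (1 / norm (tyler n z *v z t)) *\<^sub>R (tyler n z *v z t)"

definition pseudo_rank :: "nat \<Rightarrow> (nat \<Rightarrow> real^'k::{finite,wellorder}) \<Rightarrow> nat \<Rightarrow> nat" where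
  "pseudo_rank n z t = card {s\<in>{1..n}. norm (tyler n z *v z s) \<le> norm (tyler n z *v z t)}"

definition rank_autocov ::
  "(real \<Rightarrow> real) \<Rightarrow> (real \<Rightarrow> real) \<Rightarrow> nat \<Rightarrow> (nat \<Rightarrow> real^'k::_) \<Rightarrow> nat \<Rightarrow>
   real^'k::{finite,wellorder}^'k::_" where
  "rank_autocov K1 K2 n z i =
     transpose (tyler n z)
       ** ((1 / real (n - i)) *\<^sub>R
           (\<Sum>t=i+1..n.
              (K1 (real (pseudo_rank n z t) / real (n + 1)) *
               K2 (real (pseudo_rank n z (t - i)) / real (n + 1))) *\<^sub>R
              outer_prod (std_direction n z t) (std_direction n z (t - i))))
       ** matrix_inv (transpose (tyler n z))"

definition to_mat :: "real^'k::{finite,wellorder}^'k::_ \<Rightarrow> real mat" where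
  "to_mat C = (let e = (\<lambda>i. sorted_list_of_set (UNIV :: 'k set) ! i) in
     Matrix.mat CARD('k) CARD('k) (\<lambda>(i, j). C $ e i $ e j))"

text \<open>Column stacking.\<close>
definition vec_of :: "'a mat \<Rightarrow> 'a Matrix.vec" where
  "vec_of C = Matrix.vec (dim_row C * dim_col C) (\<lambda>a. C $$ (a mod dim_row C, a div dim_row C))"

definition kron :: "real mat \<Rightarrow> real mat \<Rightarrow> real mat" where
  "kron P Q = Matrix.mat (dim_row P * dim_row Q) (dim_col P * dim_col Q)
     (\<lambda>(a, b). P $$ (a div dim_row Q, b div dim_col Q) * Q $$ (a mod dim_row Q, b mod dim_col Q))"

text \<open>Matrix with \<open>m \<times> l\<close> blocks of size \<open>d \<times> d\<close>; blocks are numbered from 1.\<close>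
definition block_mat :: "nat \<Rightarrow> nat \<Rightarrow> nat \<Rightarrow> (nat \<Rightarrow> nat \<Rightarrow> real mat) \<Rightarrow> real mat" where
  "block_mat d m l F = Matrix.mat (m * d) (l * d)
     (\<lambda>(a, b). F (a div d + 1) (b div d + 1) $$ (a mod d, b mod d))"

definition block_vec :: "nat \<Rightarrow> nat \<Rightarrow> (nat \<Rightarrow> real Matrix.vec) \<Rightarrow> real Matrix.vec" where
  "block_vec d m v = Matrix.vec (m * d) (\<lambda>a. vec_index (v (a div d + 1)) (a mod d))"

definition stacked_autocov ::
  "(real \<Rightarrow> real) \<Rightarrow> (real \<Rightarrow> real) \<Rightarrow> nat \<Rightarrow> (nat \<Rightarrow> real^'k::{finite,wellorder}) \<Rightarrow>
   real Matrix.vec" where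
  "stacked_autocov K1 K2 n z = block_vec (CARD('k)\<^sup>2) (n - 1)
     (\<lambda>i. sqrt (real (n - i)) \<cdot>\<^sub>v vec_of (to_mat (rank_autocov K1 K2 n z i)))"

text \<open>Coefficient of $z^u$ in the inverse of a polynomial matrix over the formal power series,
  and zero for negative \<open>u\<close>.\<close>
definition green :: "real poly^'k^'k \<Rightarrow> int \<Rightarrow> real^'k^'k" where
  "green P u = (if u < 0 then 0 else
     (\<chi> r c. fps_nth (matrix_inv (\<chi> r c. fps_of_poly (P $ r $ c)) $ r $ c) (nat u)))"

definition is_D_system ::
  "(nat \<Rightarrow> real^'k^'k) \<Rightarrow> (nat \<Rightarrow> real^'k^'k) \<Rightarrow> nat \<Rightarrow> nat \<Rightarrow> (nat \<Rightarrow> real^'k^'k) \<Rightarrow> bool" where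
  "is_D_system A B p0 q0 D \<longleftrightarrow>
     (let G = green (ar_poly A p0); H = green (ma_poly B q0) in
       (\<forall>t\<in>{q0+1..q0+p0}. G (int t) + (\<Sum>i=1..p0+q0. G (int t - int i) ** transpose (D i)) = 0) \<and>
       (\<forall>t\<in>{p0+1..p0+q0}. H (int t) + (\<Sum>i=1..p0+q0. H (int t - int i) ** transpose (D i)) = 0))"

definition solves_diff_eq :: "(nat \<Rightarrow> real^'k^'k) \<Rightarrow> nat \<Rightarrow> (int \<Rightarrow> real^'k^'k) \<Rightarrow> bool" where
  "solves_diff_eq D m X \<longleftrightarrow> (\<forall>t. X t + (\<Sum>i=1..m. D i ** X (t - int i)) = 0)"

text \<open>The matrix-valued solutions form a right module over the \<open>k \<times> k\<close> matrices; a fundamental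
  system is a basis of it.\<close>
definition fundamental_system ::
  "(nat \<Rightarrow> real^'k^'k) \<Rightarrow> nat \<Rightarrow> (nat \<Rightarrow> int \<Rightarrow> real^'k^'k) \<Rightarrow> bool" where
  "fundamental_system D m Y \<longleftrightarrow>
     (\<forall>j\<in>{1..m}. solves_diff_eq D m (Y j)) \<and>
     (\<forall>X. solves_diff_eq D m X \<longrightarrow>
        (\<exists>!C. (\<forall>j. j \<notin> {1..m} \<longrightarrow> C j = 0) \<and> (\<forall>t. X t = (\<Sum>j=1..m. Y j t ** C j))))"

definition excess_order :: "nat \<Rightarrow> nat \<Rightarrow> nat \<Rightarrow> nat \<Rightarrow> nat" where
  "excess_order p0 p1 q0 q1 = max (p1 - p0) (q1 - q0)"

text \<open>\<open>psi_bar m\<close>, with \<open>m\<close> the number of lags, \<open>r\<close> the excess order, \<open>l\<close> the number of sequences.\<close>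
definition psi_bar ::
  "(nat \<Rightarrow> int \<Rightarrow> real^'k::{finite,wellorder}^'k::_) \<Rightarrow> nat \<Rightarrow> nat \<Rightarrow> nat \<Rightarrow> real mat" where
  "psi_bar Y r l m =
     kron (block_mat CARD('k) (m - r) l (\<lambda>i j. to_mat (Y j (int (r + i))))) (1\<^sub>m CARD('k))"

definition lower_H :: "(nat \<Rightarrow> real^'k::{finite,wellorder}^'k::_) \<Rightarrow> nat \<Rightarrow> nat \<Rightarrow> real mat" where
  "lower_H B q0 m = block_mat (CARD('k)\<^sup>2) m m
     (\<lambda>i j. if j \<le> i then kron (1\<^sub>m CARD('k)) (to_mat (green (ma_poly B q0) (int (i - j))))
            else 0\<^sub>m (CARD('k)\<^sup>2) (CARD('k)\<^sup>2))"

definition ma_coeff :: "(nat \<Rightarrow> real^'k^'k) \<Rightarrow> nat \<Rightarrow> nat \<Rightarrow> real^'k^'k" where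
  "ma_coeff B q0 i = (if i = 0 then mat 1 else if i \<le> q0 then B i else 0)"

definition lower_B :: "(nat \<Rightarrow> real^'k::{finite,wellorder}^'k::_) \<Rightarrow> nat \<Rightarrow> nat \<Rightarrow> real mat" where
  "lower_B B q0 m = block_mat (CARD('k)\<^sup>2) m m
     (\<lambda>i j. if j \<le> i then kron (to_mat (transpose (ma_coeff B q0 (i - j)))) (1\<^sub>m CARD('k))
            else 0\<^sub>m (CARD('k)\<^sup>2) (CARD('k)\<^sup>2))"

definition Q_matrix ::
  "(nat \<Rightarrow> real^'k::{finite,wellorder}^'k::_) \<Rightarrow> nat \<Rightarrow> nat \<Rightarrow> nat \<Rightarrow> nat \<Rightarrow>
   (nat \<Rightarrow> int \<Rightarrow> real^'k::_^'k::_) \<Rightarrow> nat \<Rightarrow> real mat" where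
  "Q_matrix B p0 p1 q0 q1 Y n =
     (let r = excess_order p0 p1 q0 q1 in
      lower_H B q0 (n - 1) * lower_B B q0 (n - 1) *
      diag_block_mat [1\<^sub>m (CARD('k)\<^sup>2 * r), psi_bar Y r (p0 + q0) (n - 1)])"

text \<open>In the next three definitions \<open>Q\<close> is the matrix above and \<open>z\<close> the residual series.\<close>

definition T_vector ::
  "real mat \<Rightarrow> (real \<Rightarrow> real) \<Rightarrow> (real \<Rightarrow> real) \<Rightarrow> nat \<Rightarrow> (nat \<Rightarrow> real^'k::{finite,wellorder}) \<Rightarrow>
   real Matrix.vec" where
  "T_vector Q K1 K2 n z =
     (1 / sqrt (real n)) \<cdot>\<^sub>v (transpose_mat Q *\<^sub>v stacked_autocov K1 K2 n z)"

definition J_matrix ::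
  "real mat \<Rightarrow> nat \<Rightarrow> (nat \<Rightarrow> real^'k::{finite,wellorder}) \<Rightarrow> real mat" where
  "J_matrix Q n z =
     transpose_mat Q *
     kron (1\<^sub>m (n - 1)) (kron (to_mat (shape_est n z)) (to_mat (matrix_inv (shape_est n z)))) * Q"

definition quadratic_stat ::
  "real mat \<Rightarrow> (real \<Rightarrow> real) \<Rightarrow> (real \<Rightarrow> real) \<Rightarrow> nat \<Rightarrow> (nat \<Rightarrow> real^'k::{finite,wellorder}) \<Rightarrow> real"
  where
  "quadratic_stat Q K1 K2 n z =
     ((real CARD('k))\<^sup>2 * real n / (second_moment K1 * second_moment K2)) *
     scalar_prod (T_vector Q K1 K2 n z)
       (the (mat_inverse (J_matrix Q n z)) *\<^sub>v T_vector Q K1 K2 n z)"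

definition Q_stat ::
  "(nat \<Rightarrow> real^'k::_^'k::_) \<Rightarrow> (nat \<Rightarrow> real^'k::{finite,wellorder}^'k::_) \<Rightarrow>
   nat \<Rightarrow> nat \<Rightarrow> nat \<Rightarrow> nat \<Rightarrow> (nat \<Rightarrow> int \<Rightarrow> real^'k::_^'k::_) \<Rightarrow>
   (real \<Rightarrow> real) \<Rightarrow> (real \<Rightarrow> real) \<Rightarrow> nat \<Rightarrow> (nat \<Rightarrow> real^'k::_) \<Rightarrow> real" where
  "Q_stat A B p0 p1 q0 q1 Y K1 K2 n x =
     quadratic_stat (Q_matrix B p0 p1 q0 q1 Y n) K1 K2 n (residual A B p0 q0 x)"

text \<open>The samples at which the statistic is defined. A matrix satisfying \<open>is_tyler\<close> can exist only
  if no residual vanishes (take traces), so no division by zero occurs on this set.\<close>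
definition Q_stat_domain ::
  "(nat \<Rightarrow> real^'k::_^'k::_) \<Rightarrow> (nat \<Rightarrow> real^'k::{finite,wellorder}^'k::_) \<Rightarrow>
   nat \<Rightarrow> nat \<Rightarrow> nat \<Rightarrow> nat \<Rightarrow> (nat \<Rightarrow> int \<Rightarrow> real^'k::_^'k::_) \<Rightarrow> nat \<Rightarrow> (nat \<Rightarrow> real^'k::_) set" where
  "Q_stat_domain A B p0 p1 q0 q1 Y n =
     {x. n > CARD('k) * (CARD('k) - 1) \<and>
         n > excess_order p0 p1 q0 q1 + p0 + q0 \<and>
         (\<exists>!C. is_tyler n (residual A B p0 q0 x) C) \<and>
         invertible_mat (J_matrix (Q_matrix B p0 p1 q0 q1 Y n) n (residual A B p0 q0 x))}"

text \<open>Affine invariance of a partially defined statistic: the domain is invariant as well.\<close>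
definition affine_invariant_on ::
  "(nat \<Rightarrow> real^'k) set \<Rightarrow> ((nat \<Rightarrow> real^'k) \<Rightarrow> real) \<Rightarrow> bool" where
  "affine_invariant_on S T \<longleftrightarrow>
     (\<forall>M::real^'k^'k. invertible M \<longrightarrow>
        (\<forall>x\<in>S. (\<lambda>t. M *v x t) \<in> S \<and> T (\<lambda>t. M *v x t) = T x))"

end

theory Submission
  imports Defs "HOL-Computational_Algebra.Field_as_Ring"
begin

text \<open>
  Both parts rest on one question: which linear maps commute with the model.

  If the coefficients are scalar, a linear map $M$ commutes with both sides of the model equation,
  so $(MX_t)$ is driven by the innovations $(M\varepsilon_t)$, and these are again elliptical, with shape
  $M \Sigma M'$ and the same radial density (\<open>scalar_imp_null_hyp_affine_invariant\<close>).

  Conversely, let $X_t = \sum_{u<t} \Psi_u \varepsilon_{t-u}$, where $\sum_u \Psi_u z^u = A(z)^{-1} B(z)$,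
  with standard Gaussian innovations. If $\Psi_u$ commutes with $M$ for $u < m$, the residuals of $(MX_t)$
  are $M\varepsilon_t$ for $1 \le t \le m$ and $M\varepsilon_{m+1} + (M\Psi_m - \Psi_m M)\varepsilon_1$ at time $m+1$. Under the
  null hypothesis the residuals are identically distributed, and comparing second moments forces
  $M\Psi_m = \Psi_m M$ (\<open>affine_invariant_imp_psi_weights_commute\<close>). As this holds for all invertible $M$,
  every $\Psi_u$ is scalar, so $A(z)^{-1} B(z)$ is a scalar rational function $b(z)/a(z)$ in lowest
  terms. Then $A = a T$ and $B = b T$ for a polynomial matrix $T$, a common left divisor, hence
  unimodular; as the leading coefficient of $A$ is nonsingular, $T$ is constant, and $A(0) = I$ makes it a multiple
  of $I$ (\<open>scalar_psi_weights_imp_scalar_coefficients\<close>).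

  For the statistic, let the coefficients be scalar, so that the residuals $Z_t$ become $MZ_t$. By
  uniqueness of the Tyler matrix and a QR decomposition, $C$ becomes $c\,O C M^{-1}$ with $c > 0$ and $O$ orthogonal.
  Hence the ranks are unchanged, the directions are rotated by $O$, and every rank autocovariance $\Gamma$
  becomes $M'^{-1} \Gamma M'$ (\<open>rank_statistics_affine\<close>). With $N = M \otimes M'^{-1}$ the stacked vector $S$ becomes
  $(I \otimes N) S$ and the weight $V = I \otimes (\Sigma \otimes \Sigma^{-1})$ becomes $(I \otimes N) V (I \otimes N')$. The quadratic form
  is unchanged as soon as the column space of $Q$ is invariant under $I \otimes N'$, that is $(I \otimes N') Q = Q R$
  for some $R$ (\<open>quadratic_form_reparam\<close>).

  This last identity is where the matrices $D_i$ and $\Psi^{(j)}$ enter. The left factors of $Q$ have scalar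
  blocks and commute with $I \otimes N'$. The commutators of a matrix with the $D_i$ solve the homogeneous
  version of the system that defines the $D_i$; the scalar polynomials of the model being coprime, they
  vanish, so every $D_i$ commutes with every matrix (\<open>D_system_commutes\<close>). Therefore $M' \Psi^{(j)}$ solves the same difference equation as
  $\Psi^{(j)}$, and the fundamental system expresses it as $\sum_s \Psi^{(s)} C_{sj}$, which yields $R$
  (\<open>Q_matrix_commute\<close>).
\<close>

no_notation fps_nth (infixl "$" 75)

(* Entries of products are expanded as explicit sums (mult_mat_index below), not as scalar
   products of rows and columns. *)
declare index_mult_mat(1) [simp del]

section \<open>Square matrices over the index type\<close>

lemma matrix_inv_eqI:
  fixes A B :: "'a::semiring_1^'n^'n"
  assumes "A ** B = mat 1" and "B ** A = mat 1"
  shows "matrix_inv A = B"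
proof -
  have "A ** matrix_inv A = mat 1 \<and> matrix_inv A ** A = mat 1"
    unfolding matrix_inv_def by (rule someI[of _ B]) (use assms in simp)
  then have "B = B ** (A ** matrix_inv A)" by simp
  also have "\<dots> = matrix_inv A" by (simp add: matrix_mul_assoc assms)
  finally show ?thesis by simp
qed

lemma matrix_inv_both:
  fixes A :: "'a::semiring_1^'n^'n"
  assumes "invertible A"
  shows "A ** matrix_inv A = mat 1" and "matrix_inv A ** A = mat 1"
proof -
  have "A ** matrix_inv A = mat 1 \<and> matrix_inv A ** A = mat 1"
    using assms unfolding invertible_def matrix_inv_def by (rule someI_ex)
  then show "A ** matrix_inv A = mat 1" "matrix_inv A ** A = mat 1" by auto
qed

lemma matrix_inv_cancel_left:
  fixes A X :: "'a::semiring_1^'n^'n"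
  assumes "invertible A"
  shows "A ** (matrix_inv A ** X) = X" and "matrix_inv A ** (A ** X) = X"
  by (simp_all add: matrix_mul_assoc matrix_inv_both[OF assms])

lemma matrix_inv_cancel_vec:
  fixes A :: "'a::semiring_1^'n^'n"
  assumes "invertible A"
  shows "A *v (matrix_inv A *v x) = x" and "matrix_inv A *v (A *v x) = x"
  by (simp_all add: matrix_vector_mul_assoc matrix_inv_both[OF assms])

lemma invertible_matrix_inv:
  fixes A :: "'a::semiring_1^'n^'n"
  assumes "invertible A"
  shows "invertible (matrix_inv A)"
  using matrix_inv_both[OF assms] unfolding invertible_def by blast

lemma matrix_inv_mult:
  fixes A B :: "'a::semiring_1^'n^'n"
  assumes "invertible A" "invertible B"
  shows "matrix_inv (A ** B) = matrix_inv B ** matrix_inv A"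
  by (rule matrix_inv_eqI)
    (simp_all add: matrix_mul_assoc[symmetric] matrix_inv_both matrix_inv_cancel_left assms)

lemma invertible_transpose:
  fixes A :: "real^'n^'n"
  assumes "invertible A"
  shows "invertible (transpose A)"
  using assms by (simp add: invertible_det_nz)

lemma matrix_inv_transpose:
  fixes A :: "real^'n^'n"
  assumes "invertible A"
  shows "matrix_inv (transpose A) = transpose (matrix_inv A)"
  by (rule matrix_inv_eqI)
    (simp_all add: matrix_transpose_mul[symmetric] matrix_inv_both[OF assms])

lemma matrix_mult_scaleR:
  fixes A B :: "real^'n^'n"
  shows "(c *\<^sub>R A) ** B = c *\<^sub>R (A ** B)" and "A ** (c *\<^sub>R B) = c *\<^sub>R (A ** B)"
  by (simp_all add: matrix_scalar_ac scalar_matrix_assoc)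

lemma transpose_scaleR:
  fixes A :: "real^'n^'n"
  shows "transpose (c *\<^sub>R A) = c *\<^sub>R transpose A"
  by (simp add: transpose_def Finite_Cartesian_Product.vec_eq_iff)

lemma matrix_inv_scaleR:
  fixes A :: "real^'n^'n"
  assumes "invertible A" "c \<noteq> 0"
  shows "matrix_inv (c *\<^sub>R A) = inverse c *\<^sub>R matrix_inv A"
  by (rule matrix_inv_eqI) (simp_all add: matrix_mult_scaleR matrix_inv_both assms)

lemma invertible_scaleR:
  fixes A :: "real^'n^'n"
  assumes "invertible A" "c \<noteq> 0"
  shows "invertible (c *\<^sub>R A)"
  unfolding invertible_right_inverse
  by (rule exI[of _ "inverse c *\<^sub>R matrix_inv A"])
    (simp add: matrix_mult_scaleR matrix_inv_both assms)

lemma matrix_mult_add_right: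
  fixes A B C :: "'a::semiring_1^'n^'n"
  shows "(A + B) ** C = A ** C + B ** C"
  by (simp add: Finite_Cartesian_Product.vec_eq_iff matrix_matrix_mult_def distrib_right sum.distrib)

lemma matrix_mult_diff_left:
  fixes A B C :: "'a::ring_1^'n^'n"
  shows "A ** (B - C) = A ** B - A ** C"
  by (simp add: Finite_Cartesian_Product.vec_eq_iff matrix_matrix_mult_def right_diff_distrib sum_subtractf)

lemma matrix_mult_sum:
  fixes A :: "real^'n^'n"
  shows "A ** (\<Sum>i\<in>S. f i) = (\<Sum>i\<in>S. A ** f i)" and "(\<Sum>i\<in>S. f i) ** A = (\<Sum>i\<in>S. f i ** A)"
  by (induction S rule: infinite_finite_induct)
    (auto simp: matrix_add_ldistrib matrix_mult_add_right)

lemma outer_prod_mult: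
  fixes C D :: "real^'n^'n"
  shows "outer_prod (C *v u) (D *v v) = C ** outer_prod u v ** transpose D"
proof -
  have "(\<Sum>k\<in>UNIV. C $ i $ k * u $ k) * (\<Sum>l\<in>UNIV. D $ j $ l * v $ l)
      = (\<Sum>l\<in>UNIV. (\<Sum>k\<in>UNIV. C $ i $ k * (u $ k * v $ l)) * D $ j $ l)" for i j
  proof -
    have "(\<Sum>k\<in>UNIV. C $ i $ k * u $ k) * (\<Sum>l\<in>UNIV. D $ j $ l * v $ l)
        = (\<Sum>l\<in>UNIV. \<Sum>k\<in>UNIV. (C $ i $ k * u $ k) * (D $ j $ l * v $ l))"
      unfolding sum_product by (rule sum.swap)
    also have "\<dots> = (\<Sum>l\<in>UNIV. (\<Sum>k\<in>UNIV. C $ i $ k * (u $ k * v $ l)) * D $ j $ l)"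
      by (simp add: sum_distrib_right sum_distrib_left mult_ac)
    finally show ?thesis .
  qed
  then show ?thesis
    by (simp add: Finite_Cartesian_Product.vec_eq_iff outer_prod_def matrix_matrix_mult_def matrix_vector_mult_def transpose_def)
qed

lemma outer_prod_scaleR: "outer_prod (a *\<^sub>R u) (b *\<^sub>R v) = (a * b) *\<^sub>R outer_prod u v"
  by (simp add: outer_prod_def Finite_Cartesian_Product.vec_eq_iff)

text \<open>The invertible matrices $I + E_{ij}$ with $i \ne j$ suffice: commuting with $E_{ij}$ kills the
  off-diagonal entries and makes the diagonal entries $i$ and $j$ equal.\<close>
lemma commutes_with_all_imp_scalar:
  fixes P :: "real^'n^'n"
  assumes "\<And>M. invertible M \<Longrightarrow> M ** P = P ** M"
  shows "\<exists>c. P = c *\<^sub>R mat 1"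
proof -
  let ?E = "\<lambda>i j. (\<chi> r c. if r = i \<and> c = j then 1 else 0) :: real^'n^'n"
  \<comment> \<open>$E_{ij}$ is nilpotent, so $I + E_{ij}$ is invertible with inverse $I - E_{ij}$.\<close>
  have EP: "?E i j ** P = P ** ?E i j" if "i \<noteq> j" for i j
  proof -
    have "?E i j ** ?E i j = 0" using that
      by (auto simp: Finite_Cartesian_Product.vec_eq_iff matrix_matrix_mult_def intro!: sum.neutral)
    then have "(mat 1 + ?E i j) ** (mat 1 - ?E i j) = mat 1"
      by (simp add: matrix_mult_add_right matrix_mul_rid matrix_mul_lid matrix_mult_diff_left)
    then have "invertible (mat 1 + ?E i j)" using invertible_right_inverse by blast
    from assms[OF this] show ?thesis by (simp add: matrix_mult_add_right matrix_add_ldistrib)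
  qed
  have ent1: "(?E i j ** P) $ a $ b = (if a = i then P $ j $ b else 0)" for i j a b
    by (simp add: matrix_matrix_mult_def if_distrib if_distribR cong: if_cong)
  have ent2: "(P ** ?E i j) $ a $ b = (if b = j then P $ a $ i else 0)" for i j a b
    by (simp add: matrix_matrix_mult_def if_distrib if_distribR cong: if_cong)
  have diag: "P $ j $ j = P $ i $ i" for i j
    using EP[of i j] ent1[of i j i j] ent2[of i j i j] by (cases "i = j") auto
  have off: "P $ j $ b = 0" if "j \<noteq> b" for j b
    using EP[of b j] ent1[of b j b b] ent2[of b j b b] that by auto
  have "P = (P $ undefined $ undefined) *\<^sub>R mat 1"
    using diag[of _ undefined] off by (auto simp: Finite_Cartesian_Product.vec_eq_iff Finite_Cartesian_Product.mat_def)
  then show ?thesis ..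
qed

lemma scalar_matrix_commutes:
  fixes M :: "real^'n^'n"
  shows "M ** (c *\<^sub>R mat 1) = (c *\<^sub>R mat 1) ** M" and "(c *\<^sub>R mat 1) *v (M *v x) = M *v ((c *\<^sub>R mat 1) *v x)"
  by (simp_all add: matrix_mult_scaleR scaleR_matrix_vector_assoc[symmetric] matrix_vector_mult_scaleR)


section \<open>QR decomposition\<close>

text \<open>The reflection in the hyperplane orthogonal to $a - b$ exchanges the two vectors because their
  norms agree.\<close>
lemma exists_reflection:
  fixes a b :: "'a::euclidean_space"
  assumes "norm a = norm b"
  shows "\<exists>f. orthogonal_transformation f \<and> f a = b \<and> (\<forall>x. x \<bullet> (a - b) = 0 \<longrightarrow> f x = x)"
proof (cases "a = b")
  case True
  then show ?thesis by (intro exI[of _ id]) (auto simp: orthogonal_transformation_id[unfolded id_def] id_def)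
next
  case False
  define u where "u = a - b"
  define f where "f x = x - (2 * (u \<bullet> x) / (u \<bullet> u)) *\<^sub>R u" for x
  have u: "u \<bullet> u \<noteq> 0" using False by (simp add: u_def)
  have "linear f" unfolding f_def
    by (rule linearI) (simp_all add: algebra_simps inner_add_right add_divide_distrib)
  moreover have "f v \<bullet> f w = v \<bullet> w" for v w
    using u by (simp add: f_def inner_diff_left inner_diff_right inner_commute field_simps)
  ultimately have o: "orthogonal_transformation f" by (simp add: orthogonal_transformation_def)
  have "a \<bullet> a = b \<bullet> b" using assms by (simp add: norm_eq)
  then have "2 * (u \<bullet> a) = u \<bullet> u" by (simp add: u_def algebra_simps inner_commute)
  then have "f a = b" using u by (simp add: f_def u_def)
  with o show ?thesis
    by (intro exI[of _ f]) (auto simp: f_def u_def[symmetric] inner_commute)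
qed

lemma matrix_mult_column: "(A ** B) $ i $ j = (A *v column j B) $ i"
  by (simp add: matrix_matrix_mult_def matrix_vector_mult_def column_def)

text \<open>Householder's method, one column at a time in increasing order. Positivity of the diagonal comes
  last: the entries are norms, hence nonnegative, and their product is a nonzero determinant.\<close>
lemma exists_QR:
  fixes G :: "real^'n::{finite,wellorder}^'n::_"
  assumes "invertible G"
  shows "\<exists>Q. orthogonal_matrix Q \<and> (\<forall>i j. j < i \<longrightarrow> (Q ** G) $ i $ j = 0) \<and> (\<forall>i. (Q ** G) $ i $ i > 0)"
proof -
  have "\<exists>Q. orthogonal_matrix Q \<and> (\<forall>j\<in>J. (\<forall>i>j. (Q ** G) $ i $ j = 0) \<and> (Q ** G) $ j $ j \<ge> 0)"
    if "finite J" for J :: "'n set"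
    using that
  proof (induction J rule: finite_linorder_max_induct)
    case empty
    then show ?case by (intro exI[of _ "mat 1"]) (simp add: orthogonal_matrix_id)
  next
    case (insert b J)
    then obtain Q where Q: "orthogonal_matrix Q"
      and tri: "\<And>i j. j \<in> J \<Longrightarrow> j < i \<Longrightarrow> (Q ** G) $ i $ j = 0"
      and pos: "\<And>j. j \<in> J \<Longrightarrow> (Q ** G) $ j $ j \<ge> 0" by blast
    \<comment> \<open>The part of column \<open>b\<close> on and below the diagonal is reflected onto the diagonal entry. The
      reflection fixes vectors supported above row \<open>b\<close>, such as the columns already triangular.\<close>
    define w :: "real^'n::_" where "w = (\<chi> i. if b \<le> i then (Q ** G) $ i $ b else 0)"
    define v :: "real^'n::_" where "v = norm w *\<^sub>R axis b 1"
    have vi: "v $ i = (if i = b then norm w else 0)" for i by (simp add: v_def axis_def)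
    have "norm w = norm v" by (simp add: v_def)
    from exists_reflection[OF this] obtain f where
      f: "orthogonal_transformation f" "f w = v" "\<And>x. x \<bullet> (w - v) = 0 \<Longrightarrow> f x = x" by blast
    have fixed: "f x = x" if "\<And>i. b \<le> i \<Longrightarrow> x $ i = 0" for x
    proof (rule f(3))
      have "x $ i * (w - v) $ i = 0" for i
        using that[of i] by (cases "b \<le> i") (auto simp: w_def vi)
      then show "x \<bullet> (w - v) = 0" by (simp add: inner_vec_def sum.neutral)
    qed
    have lin: "linear f" and fo: "orthogonal_matrix (matrix f)"
      using f(1) by (auto simp: orthogonal_transformation_matrix)
    have ent: "(matrix f ** Q ** G) $ i $ j = f (column j (Q ** G)) $ i" for i j
      using matrix_mult_column[of "matrix f" "Q ** G"] matrix_works[OF lin[folded linear_matrix_vector_mul_eq]] lin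
      by (simp add: matrix_mul_assoc matrix_works)
    have old: "f (column j (Q ** G)) = column j (Q ** G)" if "j \<in> J" for j
      using tri[OF that] insert(2) that by (intro fixed) (auto simp: column_def)
    have "f (column b (Q ** G) - w) = column b (Q ** G) - w"
      by (intro fixed) (simp add: column_def w_def)
    then have new: "f (column b (Q ** G)) = column b (Q ** G) - w + v"
      using linear_diff[OF lin, of "column b (Q ** G)" w] f(2) by (simp add: algebra_simps)
    show ?case
    proof (intro exI[of _ "matrix f ** Q"] conjI ballI)
      show "orthogonal_matrix (matrix f ** Q)" using fo Q by (rule orthogonal_matrix_mul)
      fix j assume j: "j \<in> insert b J"
      show "\<forall>i>j. (matrix f ** Q ** G) $ i $ j = 0"
        using j tri by (auto simp: ent old new vi) (auto simp: column_def w_def)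
      show "(matrix f ** Q ** G) $ j $ j \<ge> 0"
        using j pos by (auto simp: ent old new vi) (auto simp: column_def w_def)
    qed
  qed
  from this[of UNIV] obtain Q where Q: "orthogonal_matrix Q"
      and tri: "\<And>i j. j < i \<Longrightarrow> (Q ** G) $ i $ j = 0"
      and nn: "\<And>j. (Q ** G) $ j $ j \<ge> 0" by auto
  have "det (Q ** G) \<noteq> 0"
    using assms Q by (auto simp: det_mul invertible_det_nz dest: det_orthogonal_matrix)
  then have "(\<Prod>i\<in>UNIV. (Q ** G) $ i $ i) \<noteq> 0" using det_upperdiagonal[OF tri] by simp
  then have "(Q ** G) $ i $ i \<noteq> 0" for i by simp
  then show ?thesis using Q tri nn by (intro exI[of _ Q]) (simp add: less_le)
qed

text \<open>The uniqueness half of the QR decomposition, up to a scale factor. The columns of $cQ$ are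
  determined in increasing order: triangularity annihilates the entries below the diagonal,
  orthogonality to the earlier columns those above it, and positivity fixes the sign of the entry left.\<close>
lemma triangular_orthogonal_scalar:
  fixes C1 C2 :: "real^'n::{finite,wellorder}^'n::_"
  assumes "orthogonal_matrix Q" and c: "c > 0" and eq: "C1 = c *\<^sub>R (Q ** C2)"
    and t1: "\<And>i j. j < i \<Longrightarrow> C1 $ i $ j = 0" and p1: "\<And>i. C1 $ i $ i > 0"
    and t2: "\<And>i j. j < i \<Longrightarrow> C2 $ i $ j = 0" and p2: "\<And>i. C2 $ i $ i > 0"
  shows "C1 = c *\<^sub>R C2"
proof -
  define P where "P = c *\<^sub>R Q"
  have C1: "C1 $ i $ j = (\<Sum>l\<in>UNIV. P $ i $ l * C2 $ l $ j)" for i j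
    by (simp add: eq P_def matrix_matrix_mult_def sum_distrib_left mult.assoc)
  have "transpose P ** P = c\<^sup>2 *\<^sub>R mat 1"
    using assms(1) by (simp add: P_def orthogonal_matrix matrix_mult_scaleR transpose_scaleR power2_eq_square)
  then have orth: "(\<Sum>r\<in>UNIV. P $ r $ i * P $ r $ j) = (if i = j then c\<^sup>2 else 0)" for i j
    by (simp add: Finite_Cartesian_Product.vec_eq_iff matrix_matrix_mult_def transpose_def Finite_Cartesian_Product.mat_def)
  have "\<forall>i. P $ i $ j = (if i = j then c else 0)" for j
  proof (induction j rule: less_induct)
    case (less j)
    have split: "C1 $ i $ j = P $ i $ j * C2 $ j $ j" if "j \<le> i" for i
    proof -
      have "P $ i $ l * C2 $ l $ j = 0" if "l \<noteq> j" for l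
        using less[of l] t2[of j l] that \<open>j \<le> i\<close> by (cases "l < j") auto
      then have "C1 $ i $ j = (\<Sum>l\<in>{j}. P $ i $ l * C2 $ l $ j)"
        unfolding C1 by (intro sum.mono_neutral_right) auto
      then show ?thesis by simp
    qed
    have below: "P $ i $ j = 0" if "j < i" for i
      using split[of i] that t1[OF that] p2[of j] by auto
    have above: "P $ i $ j = 0" if "i < j" for i
    proof -
      have "(\<Sum>r\<in>UNIV. P $ r $ i * P $ r $ j) = (\<Sum>r\<in>UNIV. if r = i then c * P $ r $ j else 0)"
        using less[OF that] by (intro sum.cong) auto
      then show ?thesis using orth[of i j] that c by (simp add: less_imp_neq)
    qed
    have "(\<Sum>r\<in>UNIV. P $ r $ j * P $ r $ j) = (\<Sum>r\<in>UNIV. if r = j then P $ r $ j * P $ r $ j else 0)"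
    proof (intro sum.cong refl)
      fix r show "P $ r $ j * P $ r $ j = (if r = j then P $ r $ j * P $ r $ j else 0)"
        using below[of r] above[of r] by (cases r j rule: linorder_cases) auto
    qed
    then have "(P $ j $ j)\<^sup>2 = c\<^sup>2" using orth[of j j] by (simp add: power2_eq_square)
    moreover have "P $ j $ j > 0"
      using split[of j] p1[of j] p2[of j] by (simp add: zero_less_mult_iff)
    ultimately have "P $ j $ j = c" using c by (simp add: power2_eq_iff)
    then have "P $ i $ j = (if i = j then c else 0)" for i
      using below[of i] above[of i] by (cases i j rule: linorder_cases) auto
    then show ?case by simp
  qed
  then have "P = c *\<^sub>R mat 1" by (simp add: Finite_Cartesian_Product.vec_eq_iff Finite_Cartesian_Product.mat_def)
  then have "P ** C2 = c *\<^sub>R C2" by (simp add: matrix_mult_scaleR)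
  then show ?thesis by (simp add: eq P_def matrix_mult_scaleR)
qed

section \<open>Equivariance of the Tyler matrix and of the rank statistics\<close>

lemma norm_orthogonal_matrix:
  fixes Q :: "real^'n^'n"
  assumes "orthogonal_matrix Q"
  shows "norm (Q *v x) = norm x"
  using assms by (metis orthogonal_transformation_matrix orthogonal_transformation_norm
      matrix_of_matrix_vector_mul matrix_vector_mul_linear)

lemma orthogonal_matrix_inverse:
  assumes "orthogonal_matrix (Q :: real^'n^'n)"
  shows "Q ** transpose Q = mat 1" "transpose Q ** Q = mat 1"
  using assms by (auto simp: orthogonal_matrix_def)

lemma is_tyler_invertible:
  assumes "is_tyler n z C"
  shows "invertible C"
proof -
  have "det C = (\<Prod>i\<in>UNIV. C $ i $ i)"
    using assms by (intro det_upperdiagonal) (auto simp: is_tyler_def)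
  also have "\<dots> > 0" using assms by (intro prod_pos) (auto simp: is_tyler_def)
  finally show ?thesis by (simp add: invertible_det_nz)
qed

text \<open>The normalized outer products do not see a scale factor and are conjugated by an orthogonal matrix,
  which fixes the right-hand side $I/k$. So $C M^{-1}$ only has to be made triangular, by QR, and then rescaled.\<close>
lemma is_tyler_affine:
  fixes M :: "real^'k::{finite,wellorder}^'k::_"
  assumes M: "invertible M" and C: "is_tyler n z C"
  shows "\<exists>Q c. orthogonal_matrix Q \<and> c > 0 \<and>
           is_tyler n (\<lambda>t. M *v z t) (c *\<^sub>R (Q ** C ** matrix_inv M))"
proof -
  have "invertible (C ** matrix_inv M)"
    by (intro invertible_mult is_tyler_invertible[OF C] invertible_matrix_inv M)
  from exists_QR[OF this] obtain Q where Q: "orthogonal_matrix Q"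
    and tri: "\<And>i j. j < i \<Longrightarrow> (Q ** (C ** matrix_inv M)) $ i $ j = 0"
    and pos: "\<And>i. (Q ** (C ** matrix_inv M)) $ i $ i > 0" by blast
  define G where "G = Q ** (C ** matrix_inv M)"
  define c where "c = 1 / G $ Min UNIV $ Min UNIV"
  have g: "G $ Min UNIV $ Min UNIV > 0" using pos by (simp add: G_def)
  then have c: "c > 0" by (simp add: c_def)
  define E where "E = c *\<^sub>R G"
  have Ev: "E *v (M *v x) = c *\<^sub>R (Q *v (C *v x))" for x
    by (simp add: E_def G_def scaleR_matrix_vector_assoc[symmetric] matrix_vector_mul_assoc[symmetric]
        matrix_inv_cancel_vec[OF M])
  have summand: "(1 / (norm (E *v (M *v x)))\<^sup>2) *\<^sub>R outer_prod (E *v (M *v x)) (E *v (M *v x))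
      = Q ** ((1 / (norm (C *v x))\<^sup>2) *\<^sub>R outer_prod (C *v x) (C *v x)) ** transpose Q" for x
    using c
    by (simp add: Ev norm_orthogonal_matrix[OF Q] outer_prod_scaleR outer_prod_mult[of Q _ Q] matrix_mult_scaleR
        power2_eq_square)
  have "(1 / real n) *\<^sub>R (\<Sum>t=1..n. (1 / (norm (E *v (M *v z t)))\<^sup>2) *\<^sub>R outer_prod (E *v (M *v z t)) (E *v (M *v z t)))
     = Q ** ((1 / real n) *\<^sub>R (\<Sum>t=1..n. (1 / (norm (C *v z t))\<^sup>2) *\<^sub>R outer_prod (C *v z t) (C *v z t))) ** transpose Q"
    unfolding summand by (simp add: matrix_mult_sum matrix_mult_scaleR)
  also have "\<dots> = (1 / real CARD('k)) *\<^sub>R mat 1"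
    using C by (simp add: is_tyler_def matrix_mult_scaleR orthogonal_matrix_inverse[OF Q])
  finally have avg: "(1 / real n) *\<^sub>R (\<Sum>t=1..n. (1 / (norm (E *v (M *v z t)))\<^sup>2) *\<^sub>R outer_prod (E *v (M *v z t)) (E *v (M *v z t)))
     = (1 / real CARD('k)) *\<^sub>R mat 1" .
  have "is_tyler n (\<lambda>t. M *v z t) E"
    unfolding is_tyler_def
  proof (intro conjI avg allI impI)
    show "E $ i $ j = 0" if "j < i" for i j using tri[OF that] by (simp add: E_def G_def)
    show "E $ i $ i > 0" for i using pos[of i] c by (simp add: E_def G_def)
    show "E $ Min UNIV $ Min UNIV = 1" using g by (simp add: E_def c_def)
  qed
  then show ?thesis using Q c unfolding E_def G_def matrix_mul_assoc by blast
qed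

lemma tyler_affine:
  fixes M :: "real^'k::{finite,wellorder}^'k::_"
  assumes M: "invertible M" and ex1: "\<exists>!C. is_tyler n z C"
  shows "\<exists>!C. is_tyler n (\<lambda>t. M *v z t) C"
    and "\<exists>Q c. orthogonal_matrix Q \<and> c > 0 \<and>
           tyler n (\<lambda>t. M *v z t) = c *\<^sub>R (Q ** tyler n z ** matrix_inv M)"
proof -
  let ?C = "tyler n z"
  have C: "is_tyler n z ?C" unfolding tyler_def using ex1 by (rule theI')
  from is_tyler_affine[OF M C] obtain Q c where Q: "orthogonal_matrix Q" "c > 0"
     "is_tyler n (\<lambda>t. M *v z t) (c *\<^sub>R (Q ** ?C ** matrix_inv M))" by blast
  have uniq: "E = F" if E: "is_tyler n (\<lambda>t. M *v z t) E" and F: "is_tyler n (\<lambda>t. M *v z t) F" for E F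
  proof -
    \<comment> \<open>A solution for the transformed sample is carried by $M^{-1}$ to the unique solution for the
      original sample.\<close>
    have pullback: "\<exists>Q c. orthogonal_matrix Q \<and> c > 0 \<and> ?C = c *\<^sub>R (Q ** E ** M)"
      if E: "is_tyler n (\<lambda>t. M *v z t) E" for E
    proof -
      have inv: "matrix_inv (matrix_inv M) = M"
        by (rule matrix_inv_eqI) (simp_all add: matrix_inv_both[OF M])
      from is_tyler_affine[OF invertible_matrix_inv[OF M] E] obtain Q c where
        "orthogonal_matrix Q" "c > 0" "is_tyler n z (c *\<^sub>R (Q ** E ** M))"
        unfolding inv matrix_inv_cancel_vec[OF M] by blast
      then show ?thesis using C ex1 by blast
    qed
    from pullback[OF E] obtain Q1 c1 where 1: "orthogonal_matrix Q1" "c1 > 0" "?C = c1 *\<^sub>R (Q1 ** E ** M)" by blast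
    from pullback[OF F] obtain Q2 c2 where 2: "orthogonal_matrix Q2" "c2 > 0" "?C = c2 *\<^sub>R (Q2 ** F ** M)" by blast
    have "c1 *\<^sub>R (Q1 ** E) ** M = c2 *\<^sub>R (Q2 ** F) ** M"
      using 1(3) 2(3) by (simp add: matrix_mult_scaleR)
    then have "c1 *\<^sub>R (Q1 ** E) ** M ** matrix_inv M = c2 *\<^sub>R (Q2 ** F) ** M ** matrix_inv M" by simp
    then have "c1 *\<^sub>R (Q1 ** E) = c2 *\<^sub>R (Q2 ** F)"
      by (simp add: matrix_mul_assoc[symmetric] matrix_inv_both[OF M])
    then have "transpose Q1 ** (c1 *\<^sub>R (Q1 ** E)) = transpose Q1 ** (c2 *\<^sub>R (Q2 ** F))" by simp
    then have "c1 *\<^sub>R E = c2 *\<^sub>R (transpose Q1 ** Q2 ** F)"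
      by (simp add: matrix_mult_scaleR matrix_mul_assoc orthogonal_matrix_inverse[OF 1(1)])
    then have "E = (c2 / c1) *\<^sub>R (transpose Q1 ** Q2 ** F)"
      using 1(2) by (metis divide_inverse_commute less_numeral_extra(3) scaleR_left_imp_eq scaleR_scaleR right_inverse scaleR_one)
    from triangular_orthogonal_scalar[OF _ _ this]
    have "E = (c2 / c1) *\<^sub>R F"
      using 1 2 E F by (auto simp: is_tyler_def orthogonal_matrix_mul orthogonal_matrix_transpose)
    moreover from this have "E $ Min UNIV $ Min UNIV = (c2 / c1) * F $ Min UNIV $ Min UNIV" by simp
    then have "c2 / c1 = 1" using E F by (simp add: is_tyler_def)
    ultimately show ?thesis by simp
  qed
  show ex: "\<exists>!C. is_tyler n (\<lambda>t. M *v z t) C" using Q(3) uniq by blast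
  have "tyler n (\<lambda>t. M *v z t) = c *\<^sub>R (Q ** ?C ** matrix_inv M)"
    unfolding tyler_def[of n "\<lambda>t. M *v z t"] using ex Q(3) by (rule the1_equality)
  with Q show "\<exists>Q c. orthogonal_matrix Q \<and> c > 0 \<and>
           tyler n (\<lambda>t. M *v z t) = c *\<^sub>R (Q ** tyler n z ** matrix_inv M)" by blast
qed

text \<open>Norms of standardized residuals are all multiplied by the same $c > 0$, so the ranks agree; the
  orthogonal factor cancels between the directions and the outer factors of the autocovariance. The unknown
  factor $s$ is $c^{-2}$; it cancels in $\Sigma \otimes \Sigma^{-1}$.\<close>
lemma rank_statistics_affine:
  fixes M :: "real^'k::{finite,wellorder}^'k::_"
  assumes M: "invertible M" and ex1: "\<exists>!C. is_tyler n z C"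
  shows "rank_autocov K1 K2 n (\<lambda>t. M *v z t) i
           = transpose (matrix_inv M) ** rank_autocov K1 K2 n z i ** transpose M"
    and "\<exists>s. s \<noteq> 0 \<and> shape_est n (\<lambda>t. M *v z t) = s *\<^sub>R (M ** shape_est n z ** transpose M) \<and>
           matrix_inv (shape_est n (\<lambda>t. M *v z t))
             = inverse s *\<^sub>R (transpose (matrix_inv M) ** matrix_inv (shape_est n z) ** matrix_inv M)"
proof -
  let ?C = "tyler n z" and ?C' = "tyler n (\<lambda>t. M *v z t)" and ?Mi = "matrix_inv M"
  have "is_tyler n z ?C" unfolding tyler_def using ex1 by (rule theI')
  note iC = is_tyler_invertible[OF this]
  from tyler_affine(2)[OF M ex1] obtain Q c where Q: "orthogonal_matrix Q" and c: "c > 0"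
    and C': "?C' = c *\<^sub>R (Q ** ?C ** ?Mi)" by blast
  have iQ: "invertible Q" and iQt: "matrix_inv Q = transpose Q"
    using orthogonal_matrix_inverse[OF Q] by (auto simp: invertible_def intro: matrix_inv_eqI)
  note inv = iC iQ M invertible_matrix_inv[OF M] invertible_mult invertible_transpose
  have v: "?C' *v (M *v x) = c *\<^sub>R (Q *v (?C *v x))" for x
    by (simp add: C' scaleR_matrix_vector_assoc[symmetric] matrix_vector_mul_assoc[symmetric]
        matrix_inv_cancel_vec[OF M])
  have dir: "std_direction n (\<lambda>t. M *v z t) t = Q *v std_direction n z t" for t
    using c by (simp add: std_direction_def v norm_orthogonal_matrix[OF Q] matrix_vector_mult_scaleR)
  have rank: "pseudo_rank n (\<lambda>t. M *v z t) t = pseudo_rank n z t" for t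
    using c by (simp add: pseudo_rank_def v norm_orthogonal_matrix[OF Q])
  have t: "transpose ?C' = c *\<^sub>R (transpose ?Mi ** (transpose ?C ** transpose Q))"
    by (simp add: C' transpose_scaleR matrix_transpose_mul matrix_mul_assoc)
  have inv_inv: "matrix_inv (transpose ?Mi) = transpose M"
    by (rule matrix_inv_eqI) (simp_all add: matrix_transpose_mul[symmetric] matrix_inv_both[OF M])
  have ti: "matrix_inv (transpose ?C') = inverse c *\<^sub>R (Q ** matrix_inv (transpose ?C) ** transpose M)"
  proof -
    have "matrix_inv (transpose Q) = Q"
      by (rule matrix_inv_eqI) (simp_all add: orthogonal_matrix_inverse[OF Q])
    then show ?thesis
      using c by (simp add: t matrix_inv_scaleR matrix_inv_mult inv inv_inv matrix_mul_assoc)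
  qed
  have S: "(\<Sum>t=i+1..n.
              (K1 (real (pseudo_rank n (\<lambda>t. M *v z t) t) / real (n + 1)) *
               K2 (real (pseudo_rank n (\<lambda>t. M *v z t) (t - i)) / real (n + 1))) *\<^sub>R
              outer_prod (std_direction n (\<lambda>t. M *v z t) t) (std_direction n (\<lambda>t. M *v z t) (t - i)))
     = Q ** (\<Sum>t=i+1..n.
              (K1 (real (pseudo_rank n z t) / real (n + 1)) *
               K2 (real (pseudo_rank n z (t - i)) / real (n + 1))) *\<^sub>R
              outer_prod (std_direction n z t) (std_direction n z (t - i))) ** transpose Q"
    by (simp only: dir rank outer_prod_mult matrix_mult_sum matrix_mult_scaleR)
  have QtX: "transpose Q ** (Q ** X) = X" for X
    by (simp add: matrix_mul_assoc orthogonal_matrix_inverse[OF Q])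
  show "rank_autocov K1 K2 n (\<lambda>t. M *v z t) i
           = transpose ?Mi ** rank_autocov K1 K2 n z i ** transpose M"
    unfolding rank_autocov_def S ti unfolding t using c
    by (simp add: matrix_mult_scaleR matrix_mul_assoc[symmetric] QtX)
  have CC: "transpose ?C' ** ?C' = c\<^sup>2 *\<^sub>R (transpose ?Mi ** (transpose ?C ** ?C) ** ?Mi)"
    unfolding t unfolding C' by (simp add: matrix_mult_scaleR matrix_mul_assoc[symmetric] QtX power2_eq_square)
  have iMi: "matrix_inv ?Mi = M" by (rule matrix_inv_eqI) (simp_all add: matrix_inv_both[OF M])
  have E: "shape_est n (\<lambda>t. M *v z t) = inverse (c\<^sup>2) *\<^sub>R (M ** shape_est n z ** transpose M)"
    unfolding shape_est_def CC using c
    by (simp add: matrix_inv_scaleR matrix_inv_mult inv inv_inv iMi matrix_mul_assoc)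
  have "invertible (shape_est n z)" unfolding shape_est_def by (intro inv invertible_matrix_inv)
  moreover have "matrix_inv (transpose M) = transpose ?Mi" by (rule matrix_inv_transpose[OF M])
  ultimately have "matrix_inv (shape_est n (\<lambda>t. M *v z t))
      = inverse (inverse (c\<^sup>2)) *\<^sub>R (transpose ?Mi ** matrix_inv (shape_est n z) ** ?Mi)"
    unfolding E using c by (simp add: matrix_inv_scaleR matrix_inv_mult inv matrix_mul_assoc)
  with E c show "\<exists>s. s \<noteq> 0 \<and> shape_est n (\<lambda>t. M *v z t) = s *\<^sub>R (M ** shape_est n z ** transpose M) \<and>
           matrix_inv (shape_est n (\<lambda>t. M *v z t))
             = inverse s *\<^sub>R (transpose ?Mi ** matrix_inv (shape_est n z) ** ?Mi)"
    by (intro exI[of _ "inverse (c\<^sup>2)"]) simp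
qed


section \<open>Kronecker products and block matrices\<close>

text \<open>Turns sums over a flat index of a Kronecker or block matrix into double sums; all product
  formulas below are reduced to it.\<close>
lemma sum_div_mod:
  fixes f :: "nat \<Rightarrow> nat \<Rightarrow> 'a::comm_monoid_add"
  shows "(\<Sum>a<m * n. f (a div n) (a mod n)) = (\<Sum>i<m. \<Sum>j<n. f i j)"
proof -
  have "(\<Sum>a\<in>{i * n..<i * n + n}. f (a div n) (a mod n)) = (\<Sum>j<n. f i j)" for i
  proof (rule sum.reindex_bij_witness[of _ "\<lambda>j. i * n + j" "\<lambda>a. a - i * n"])
    fix a assume "a \<in> {i * n..<i * n + n}"
    then have "a = i * n + (a - i * n)" "a - i * n < n" by auto
    then obtain j where "a = i * n + j" "j < n" by blast
    then show "f i (a - i * n) = f (a div n) (a mod n)" by simp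
  qed auto
  then show ?thesis unfolding sum.nat_group[symmetric] by simp
qed

lemma kron_dim[simp]: "dim_row (kron P Q) = dim_row P * dim_row Q" "dim_col (kron P Q) = dim_col P * dim_col Q"
  by (simp_all add: kron_def)

lemma kron_carrier: "P \<in> carrier_mat a b \<Longrightarrow> Q \<in> carrier_mat c d \<Longrightarrow> kron P Q \<in> carrier_mat (a * c) (b * d)"
  by (rule carrier_matI) simp_all

lemma block_index:
  fixes a d m :: nat
  assumes "a < m * d"
  shows "a div d < m" "a mod d < d"
proof -
  have "d > 0" using assms by (cases d) auto
  then show "a div d < m" "a mod d < d" using assms by (simp_all add: less_mult_imp_div_less)
qed

lemma kron_index: "a < dim_row P * dim_row Q \<Longrightarrow> b < dim_col P * dim_col Q \<Longrightarrow>
    kron P Q $$ (a, b) = P $$ (a div dim_row Q, b div dim_col Q) * Q $$ (a mod dim_row Q, b mod dim_col Q)"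
  by (simp add: kron_def)

lemma mult_mat_index: "a < dim_row A \<Longrightarrow> b < dim_col B \<Longrightarrow> dim_col A = dim_row B \<Longrightarrow>
   (A * B) $$ (a, b) = (\<Sum>c<dim_row B. A $$ (a, c) * B $$ (c, b))"
  by (simp add: index_mult_mat(1) scalar_prod_def lessThan_atLeast0)

lemma kron_mult:
  assumes "dim_col P = dim_row P'" "dim_col Q = dim_row Q'"
  shows "kron P Q * kron P' Q' = kron (P * P') (Q * Q')"
proof (rule eq_matI)
  fix a b assume "a < dim_row (kron (P * P') (Q * Q'))" "b < dim_col (kron (P * P') (Q * Q'))"
  then have a: "a < dim_row P * dim_row Q" and b: "b < dim_col P' * dim_col Q'" by simp_all
  let ?g = "\<lambda>i j. (P $$ (a div dim_row Q, i) * P' $$ (i, b div dim_col Q'))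
             * (Q $$ (a mod dim_row Q, j) * Q' $$ (j, b mod dim_col Q'))"
  have "(kron P Q * kron P' Q') $$ (a, b)
      = (\<Sum>c<dim_row P' * dim_row Q'. ?g (c div dim_row Q') (c mod dim_row Q'))"
    using a b assms by (simp add: mult_mat_index kron_index mult.assoc mult.left_commute)
  also have "\<dots> = (\<Sum>i<dim_row P'. \<Sum>j<dim_row Q'. ?g i j)" by (rule sum_div_mod)
  also have "\<dots> = kron (P * P') (Q * Q') $$ (a, b)"
    using a b assms block_index[OF a] block_index[OF b]
    by (simp add: kron_index mult_mat_index sum_product)
  finally show "(kron P Q * kron P' Q') $$ (a, b) = kron (P * P') (Q * Q') $$ (a, b)" .
qed (use assms in auto)

lemma kron_assoc: "kron (kron P Q) R = kron P (kron Q R)"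
proof (rule eq_matI)
  fix a b assume "a < dim_row (kron P (kron Q R))" "b < dim_col (kron P (kron Q R))"
  then have ab: "a < dim_row P * dim_row Q * dim_row R" "b < dim_col P * dim_col Q * dim_col R"
    by (simp_all add: mult.assoc)
  have ab': "a < dim_row P * (dim_row Q * dim_row R)" "b < dim_col P * (dim_col Q * dim_col R)"
    using ab by (simp_all add: mult.assoc)
  have e1: "x div (q * r) = x div r div q" "x mod (q * r) div r = x div r mod q" "x mod (q * r) mod r = x mod r" for x q r :: nat
    by (simp_all add: mult.commute[of q] div_mult2_eq mod_mult2_eq, cases "r = 0", simp_all)
  show "kron (kron P Q) R $$ (a, b) = kron P (kron Q R) $$ (a, b)"
    using block_index[OF ab(1)] block_index[OF ab(2)] block_index[OF ab'(1)] block_index[OF ab'(2)] ab ab'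
    by (simp add: kron_index e1)
qed (simp_all add: mult.assoc)

lemma transpose_kron: "transpose_mat (kron P Q) = kron (transpose_mat P) (transpose_mat Q)"
  by (rule eq_matI) (auto simp: kron_index block_index)

lemma kron_one: "kron (1\<^sub>m a) (1\<^sub>m b) = 1\<^sub>m (a * b)"
proof (rule eq_matI)
  fix i j assume "i < dim_row (1\<^sub>m (a * b) :: real mat)" "j < dim_col (1\<^sub>m (a * b) :: real mat)"
  then have ij: "i < a * b" "j < a * b" by simp_all
  have "i = j" if "i div b = j div b" "i mod b = j mod b"
  proof -
    have "i = i div b * b + i mod b" by simp
    also have "\<dots> = j div b * b + j mod b" by (simp only: that)
    finally show ?thesis by simp
  qed
  then show "kron (1\<^sub>m a) (1\<^sub>m b) $$ (i, j) = 1\<^sub>m (a * b) $$ (i, j)"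
    using block_index[OF ij(1)] block_index[OF ij(2)] ij by (auto simp: kron_index)
qed simp_all

text \<open>In this form the commutation with $I \otimes N$ is an instance of the mixed product rule \<open>kron_mult\<close>.\<close>
lemma block_mat_scalar:
  assumes "\<And>i j. F i j = s i j \<cdot>\<^sub>m 1\<^sub>m d"
  shows "block_mat d m l F = kron (Matrix.mat m l (\<lambda>(i, j). s (i + 1) (j + 1))) (1\<^sub>m d)"
  by (rule eq_matI) (auto simp: block_mat_def kron_index assms block_index)

lemma vec_of_dim[simp]: "dim_vec (vec_of C) = dim_row C * dim_col C" by (simp add: vec_of_def)

text \<open>The classical identity $\mathrm{vec}(AXB) = (B' \otimes A)\,\mathrm{vec}\,X$.\<close>
lemma vec_of_sandwich:
  assumes "A \<in> carrier_mat k k" "X \<in> carrier_mat k k" "B \<in> carrier_mat k k"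
  shows "vec_of (A * X * B) = kron (transpose_mat B) A *\<^sub>v vec_of X"
proof (rule eq_vecI)
  fix a assume "a < dim_vec (kron (transpose_mat B) A *\<^sub>v vec_of X)"
  then have a: "a < k * k" using assms by simp
  note d = block_index[OF a]
  have "vec_index (kron (transpose_mat B) A *\<^sub>v vec_of X) a
      = (\<Sum>c<k * k. B $$ (c div k, a div k) * A $$ (a mod k, c mod k) * X $$ (c mod k, c div k))"
    using assms a d by (simp add: scalar_prod_def lessThan_atLeast0 kron_index block_index vec_of_def)
  also have "\<dots> = (\<Sum>i<k. \<Sum>j<k. B $$ (i, a div k) * A $$ (a mod k, j) * X $$ (j, i))"
    by (rule sum_div_mod)
  also have "\<dots> = (\<Sum>i<k. (\<Sum>j<k. A $$ (a mod k, j) * X $$ (j, i)) * B $$ (i, a div k))"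
    by (simp add: sum_distrib_right sum_distrib_left mult_ac)
  also have "\<dots> = vec_index (vec_of (A * X * B)) a"
  proof -
    have "(A * X) $$ (a mod k, i) = (\<Sum>j<k. A $$ (a mod k, j) * X $$ (j, i))" if "i < k" for i
      using assms d that by (subst mult_mat_index) auto
    moreover have "(A * X * B) $$ (a mod k, a div k) = (\<Sum>i<k. (A * X) $$ (a mod k, i) * B $$ (i, a div k))"
      using assms d by (subst mult_mat_index) auto
    moreover have "vec_index (vec_of (A * X * B)) a = (A * X * B) $$ (a mod k, a div k)"
      using assms a by (simp add: vec_of_def)
    ultimately show ?thesis by simp
  qed
  finally show "vec_index (vec_of (A * X * B)) a = vec_index (kron (transpose_mat B) A *\<^sub>v vec_of X) a" ..
qed (use assms in auto)

lemma block_vec_kron: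
  assumes "N \<in> carrier_mat d d" and "\<And>i. dim_vec (v i) = d"
  shows "block_vec d m (\<lambda>i. N *\<^sub>v v i) = kron (1\<^sub>m m) N *\<^sub>v block_vec d m v"
proof (rule eq_vecI)
  fix a assume "a < dim_vec (kron (1\<^sub>m m) N *\<^sub>v block_vec d m v)"
  then have a: "a < m * d" using assms by simp
  note b = block_index[OF a]
  have "vec_index (kron (1\<^sub>m m) N *\<^sub>v block_vec d m v) a
     = (\<Sum>c<m * d. (if a div d = c div d then 1 else 0) * N $$ (a mod d, c mod d) * vec_index (v (c div d + 1)) (c mod d))"
    using assms a b by (simp add: scalar_prod_def lessThan_atLeast0 kron_index block_index block_vec_def)
  also have "\<dots> = (\<Sum>i<m. \<Sum>j<d. (if a div d = i then 1 else 0) * N $$ (a mod d, j) * vec_index (v (i + 1)) j)"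
    by (rule sum_div_mod)
  also have "\<dots> = (\<Sum>i<m. if a div d = i then (\<Sum>j<d. N $$ (a mod d, j) * vec_index (v (i + 1)) j) else 0)"
    by (intro sum.cong) auto
  also have "\<dots> = (\<Sum>j<d. N $$ (a mod d, j) * vec_index (v (a div d + 1)) j)"
    using b by simp
  also have "\<dots> = vec_index (block_vec d m (\<lambda>i. N *\<^sub>v v i)) a"
    using assms a b by (simp add: block_vec_def scalar_prod_def lessThan_atLeast0)
  finally show "vec_index (block_vec d m (\<lambda>i. N *\<^sub>v v i)) a = vec_index (kron (1\<^sub>m m) N *\<^sub>v block_vec d m v) a" ..
qed (use assms in \<open>auto simp: block_vec_def\<close>)

abbreviation enum_index :: "nat \<Rightarrow> 'k::{finite,wellorder}" where
  "enum_index i \<equiv> sorted_list_of_set (UNIV :: 'k set) ! i"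

lemma bij_enum_index: "bij_betw (enum_index :: nat \<Rightarrow> 'k::{finite,wellorder}) {..<CARD('k)} UNIV"
  by (rule bij_betw_nth) auto

lemma sum_enum_index: "(\<Sum>i<CARD('k). f (enum_index i)) = (\<Sum>x\<in>(UNIV::'k::{finite,wellorder} set). f x)"
  by (rule sum.reindex_bij_betw[OF bij_enum_index])

lemma to_mat_carrier[simp]: "to_mat (C :: real^'k::{finite,wellorder}^'k::_) \<in> carrier_mat CARD('k) CARD('k)"
  by (simp add: to_mat_def Let_def)

lemma to_mat_dim[simp]: "dim_row (to_mat (C :: real^'k::{finite,wellorder}^'k::_)) = CARD('k)" 
   "dim_col (to_mat (C :: real^'k::{finite,wellorder}^'k::_)) = CARD('k)"
  by (simp_all add: to_mat_def Let_def)

lemma to_mat_index[simp]: "i < CARD('k) \<Longrightarrow> j < CARD('k) \<Longrightarrow>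
   to_mat (C :: real^'k::{finite,wellorder}^'k::_) $$ (i, j) = C $ enum_index i $ enum_index j"
  by (simp add: to_mat_def Let_def)

lemma to_mat_mult: "to_mat (A ** B) = to_mat A * to_mat B"
  by (rule eq_matI)
     (auto simp: mult_mat_index matrix_matrix_mult_def sum_enum_index[symmetric])

lemma to_mat_one: "to_mat (mat 1 :: real^'k::{finite,wellorder}^'k::_) = 1\<^sub>m CARD('k)"
  using bij_enum_index[where 'k='k]
  by (intro eq_matI) (auto simp: Finite_Cartesian_Product.mat_def bij_betw_def inj_on_def)

lemma to_mat_transpose: "to_mat (transpose A) = transpose_mat (to_mat A)"
  by (rule eq_matI) (auto simp: transpose_def)

lemma to_mat_scaleR: "to_mat (c *\<^sub>R A) = c \<cdot>\<^sub>m to_mat A"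
  by (rule eq_matI) auto

lemma kron_smult: "kron (c \<cdot>\<^sub>m P) Q = c \<cdot>\<^sub>m kron P Q" "kron P (c \<cdot>\<^sub>m Q) = c \<cdot>\<^sub>m kron P Q"
  by (rule eq_matI; auto simp: kron_index block_index)+

lemma block_mat_dim[simp]: "dim_row (block_mat d m l F) = m * d" "dim_col (block_mat d m l F) = l * d"
  by (simp_all add: block_mat_def)

text \<open>A blockwise linear relation, valid for every row of blocks with the same coefficients $C$, written
  as a single matrix identity.\<close>
lemma block_mat_mult:
  assumes "\<And>i j. i < m \<Longrightarrow> j < l \<Longrightarrow> to_mat (M ** F (i + 1) (j + 1)) = to_mat (\<Sum>s=1..l. F (i + 1) s ** C s (j + 1))"
  shows "kron (1\<^sub>m m) (to_mat M) * block_mat CARD('k) m l (\<lambda>i j. to_mat (F i j))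
     = block_mat CARD('k) m l (\<lambda>i j. to_mat (F i j :: real^'k::{finite,wellorder}^'k::_)) * block_mat CARD('k) l l (\<lambda>i j. to_mat (C i j))"
proof (rule eq_matI)
  let ?k = "CARD('k)"
  fix a b assume "a < dim_row (block_mat ?k m l (\<lambda>i j. to_mat (F i j)) * block_mat ?k l l (\<lambda>i j. to_mat (C i j)))"
    "b < dim_col (block_mat ?k m l (\<lambda>i j. to_mat (F i j)) * block_mat ?k l l (\<lambda>i j. to_mat (C i j)))"
  then have a: "a < m * ?k" and b: "b < l * ?k" by simp_all
  note ia = block_index[OF a] and ib = block_index[OF b]
  have "(kron (1\<^sub>m m) (to_mat M) * block_mat ?k m l (\<lambda>i j. to_mat (F i j))) $$ (a, b)
    = (\<Sum>c<m * ?k. (if a div ?k = c div ?k then 1 else 0) * to_mat M $$ (a mod ?k, c mod ?k) * to_mat (F (c div ?k + 1) (b div ?k + 1)) $$ (c mod ?k, b mod ?k))"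
    using a b ia ib by (subst mult_mat_index) (auto simp: kron_index block_index block_mat_def intro!: sum.cong)
  also have "\<dots> = (\<Sum>i<m. \<Sum>j<?k. (if a div ?k = i then 1 else 0) * to_mat M $$ (a mod ?k, j) * to_mat (F (i + 1) (b div ?k + 1)) $$ (j, b mod ?k))"
    by (rule sum_div_mod)
  also have "\<dots> = (\<Sum>i<m. if a div ?k = i then (\<Sum>j<?k. to_mat M $$ (a mod ?k, j) * to_mat (F (i + 1) (b div ?k + 1)) $$ (j, b mod ?k)) else 0)"
    by (intro sum.cong) auto
  also have "\<dots> = to_mat (M ** F (a div ?k + 1) (b div ?k + 1)) $$ (a mod ?k, b mod ?k)"
    using ia ib by (simp add: to_mat_mult mult_mat_index del: to_mat_index)
  also have "\<dots> = to_mat (\<Sum>s=1..l. F (a div ?k + 1) s ** C s (b div ?k + 1)) $$ (a mod ?k, b mod ?k)"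
    using assms[OF ia(1) ib(1)] by simp
  also have "\<dots> = (\<Sum>s=1..l. to_mat (F (a div ?k + 1) s ** C s (b div ?k + 1)) $$ (a mod ?k, b mod ?k))"
    using ia ib by simp
  also have "\<dots> = (\<Sum>s<l. to_mat (F (a div ?k + 1) (s + 1) ** C (s + 1) (b div ?k + 1)) $$ (a mod ?k, b mod ?k))"
    by (rule sum.reindex_bij_witness[of _ Suc "\<lambda>s. s - 1"]) auto
  also have "\<dots> = (\<Sum>s<l. \<Sum>j<?k. to_mat (F (a div ?k + 1) (s + 1)) $$ (a mod ?k, j) * to_mat (C (s + 1) (b div ?k + 1)) $$ (j, b mod ?k))"
    using ia ib by (simp add: to_mat_mult mult_mat_index del: to_mat_index)
  also have "\<dots> = (\<Sum>c<l * ?k. to_mat (F (a div ?k + 1) (c div ?k + 1)) $$ (a mod ?k, c mod ?k) * to_mat (C (c div ?k + 1) (b div ?k + 1)) $$ (c mod ?k, b mod ?k))"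
    by (rule sum_div_mod[symmetric])
  also have "\<dots> = (block_mat ?k m l (\<lambda>i j. to_mat (F i j)) * block_mat ?k l l (\<lambda>i j. to_mat (C i j))) $$ (a, b)"
    using a b ia ib by (subst mult_mat_index) (auto simp: block_index block_mat_def intro!: sum.cong)
  finally show "(kron (1\<^sub>m m) (to_mat M) * block_mat ?k m l (\<lambda>i j. to_mat (F i j))) $$ (a, b)
    = (block_mat ?k m l (\<lambda>i j. to_mat (F i j)) * block_mat ?k l l (\<lambda>i j. to_mat (C i j))) $$ (a, b)" .
qed simp_all

lemma diag_block_mat_two: "diag_block_mat [A, B] =
   four_block_mat A (0\<^sub>m (dim_row A) (dim_col B)) (0\<^sub>m (dim_row B) (dim_col A)) B"
  unfolding diag_block_mat.simps(2)[of A "[B]"] Let_def diag_block_mat_singleton ..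

lemma kron_one_split:
  assumes N: "N \<in> carrier_mat d d"
  shows "kron (1\<^sub>m (a + b)) N = diag_block_mat [kron (1\<^sub>m a) N, kron (1\<^sub>m b) N]"
proof (rule eq_matI)
  fix i j assume "i < dim_row (diag_block_mat [kron (1\<^sub>m a) N, kron (1\<^sub>m b) N])"
    "j < dim_col (diag_block_mat [kron (1\<^sub>m a) N, kron (1\<^sub>m b) N])"
  then have i: "i < a * d + b * d" and j: "j < a * d + b * d" using N by (simp_all add: dim_diag_block_mat)
  then have i': "i < (a + b) * d" and j': "j < (a + b) * d" by (simp_all add: algebra_simps)
  note bi = block_index[OF i'] block_index[OF j']
  \<comment> \<open>Flat indices beyond the first $a$ blocks, renumbered from the start of the second diagonal block.\<close>
  have sh: "(x - a * d) div d = x div d - a" "(x - a * d) mod d = x mod d" if "\<not> x < a * d" for x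
  proof -
    obtain y where "x = a * d + y" using \<open>\<not> x < a * d\<close> by (metis le_Suc_ex not_less)
    moreover have "d > 0" using i' by (cases d) auto
    ultimately show "(x - a * d) div d = x div d - a" "(x - a * d) mod d = x mod d" by simp_all
  qed
  have lt: "x < a * d \<longleftrightarrow> x div d < a" for x
    using bi by (simp add: div_less_iff_less_mult)
  have sub: "x - a * d < b * d" if "\<not> x div d < a" "x < a * d + b * d" for x
    using that by (simp add: lt[symmetric] not_less)
  show "kron (1\<^sub>m (a + b)) N $$ (i, j) = diag_block_mat [kron (1\<^sub>m a) N, kron (1\<^sub>m b) N] $$ (i, j)"
    unfolding diag_block_mat_two
    using i j i' j' bi N sub[of i] sub[of j]
    by (cases "i div d < a"; cases "j div d < a") (auto simp: kron_index sh lt)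
qed (use N in \<open>auto simp: dim_diag_block_mat algebra_simps\<close>)

lemma diag_block_mat_mult:
  assumes A: "A \<in> carrier_mat a b" and B: "B \<in> carrier_mat c d"
    and A': "A' \<in> carrier_mat b e" and B': "B' \<in> carrier_mat d f"
  shows "diag_block_mat [A, B] * diag_block_mat [A', B'] = diag_block_mat [A * A', B * B']"
proof -
  have "diag_block_mat [A, B] * diag_block_mat [A', B']
    = four_block_mat A (0\<^sub>m a d) (0\<^sub>m c b) B * four_block_mat A' (0\<^sub>m b f) (0\<^sub>m d e) B'"
    unfolding diag_block_mat_two using assms by simp
  also have "\<dots> = four_block_mat (A * A' + 0\<^sub>m a d * 0\<^sub>m d e) (A * 0\<^sub>m b f + 0\<^sub>m a d * B')
     (0\<^sub>m c b * A' + B * 0\<^sub>m d e) (0\<^sub>m c b * 0\<^sub>m b f + B * B')"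
    by (rule mult_four_block_mat[OF A zero_carrier_mat zero_carrier_mat B A' zero_carrier_mat zero_carrier_mat B'])
  also have "\<dots> = four_block_mat (A * A') (0\<^sub>m a f) (0\<^sub>m c e) (B * B')"
    using mult_carrier_mat[OF A A'] mult_carrier_mat[OF B B']
    by (simp add: left_mult_zero_mat[OF A'] left_mult_zero_mat[OF B'] left_mult_zero_mat[OF zero_carrier_mat]
        right_mult_zero_mat[OF A] right_mult_zero_mat[OF B])
  also have "\<dots> = diag_block_mat [A * A', B * B']"
    unfolding diag_block_mat_two using assms by simp
  finally show ?thesis .
qed

section \<open>Quadratic forms under a change of parametrization\<close>

lemma mat_inverse_eqI:
  fixes A :: "'a::field mat"
  assumes A: "A \<in> carrier_mat n n" and B: "B \<in> carrier_mat n n" and AB: "A * B = 1\<^sub>m n" "B * A = 1\<^sub>m n"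
  shows "mat_inverse A = Some B"
proof (cases "mat_inverse A")
  case None
  have "A \<in> Units (ring_mat TYPE('a) n ())"
    unfolding Units_def ring_mat_def using A B AB by auto
  with mat_inverse(1)[OF A None, where b = "()"] show ?thesis by blast
next
  case (Some B')
  note B' = mat_inverse(2)[OF A Some]
  have "B' = B' * (A * B)" using B' AB right_mult_one_mat[of B' n n] by simp
  also have "\<dots> = B' * A * B" using A B B' by (intro assoc_mult_mat[symmetric]) auto
  also have "\<dots> = B" using B B' by simp
  finally show ?thesis using Some by simp
qed

text \<open>Transforming data by $W$ and weight by $W V W'$ amounts to the change of parameter $R$ in the
  quadratic form, because $Q'W = R'Q'$: then $T' = R'T$ and $J' = R'JR$. The matrix $R_2$ is a right inverse
  of $R$ modulo the kernel of $Q$; invertibility of $J$ says that this kernel is trivial, so $R$ is invertible.\<close>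
lemma quadratic_form_reparam:
  fixes Q V W R R2 :: "real mat" and c :: real
  assumes Q: "Q \<in> carrier_mat d e" and V: "V \<in> carrier_mat d d" and W: "W \<in> carrier_mat d d"
    and R: "R \<in> carrier_mat e e" and R2: "R2 \<in> carrier_mat e e" and s: "s \<in> carrier_vec d"
    and WQ: "transpose_mat W * Q = Q * R" and QRR: "Q * (R * R2) = Q"
    and inv: "invertible_mat (transpose_mat Q * V * Q)"
  defines "J \<equiv> transpose_mat Q * V * Q" and "J' \<equiv> transpose_mat Q * (W * V * transpose_mat W) * Q"
    and "T \<equiv> c \<cdot>\<^sub>v (transpose_mat Q *\<^sub>v s)" and "T' \<equiv> c \<cdot>\<^sub>v (transpose_mat Q *\<^sub>v (W *\<^sub>v s))"
  shows "invertible_mat J'"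
    and "scalar_prod T' (the (mat_inverse J') *\<^sub>v T') = scalar_prod T (the (mat_inverse J) *\<^sub>v T)"
proof -
  note [simp] = mult_carrier_mat[of _ d d] 
  let ?t = transpose_mat
  have J: "J \<in> carrier_mat e e" using Q V unfolding J_def by auto
  obtain Ji where Ji: "Ji \<in> carrier_mat e e" "J * Ji = 1\<^sub>m e" "Ji * J = 1\<^sub>m e"
  proof -
    obtain B where B: "inverts_mat J B" "inverts_mat B J"
      using inv unfolding invertible_mat_def J_def by blast
    have "dim_col B = e" "dim_row B = e"
      using B J unfolding inverts_mat_def by (metis carrier_matD index_mult_mat(2,3) index_one_mat(2,3))+
    with B J that[of B] show ?thesis unfolding inverts_mat_def by (metis carrier_matD(1) carrier_matI)
  qed
  have QW: "?t Q * W = ?t R * ?t Q"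
  proof -
    have "?t (?t W * Q) = ?t (Q * R)" by (simp add: WQ)
    then show ?thesis using transpose_mult[of "?t W" d d Q e] transpose_mult[OF Q R] W Q by simp
  qed
  have J': "J' = ?t R * J * R"
  proof -
    have "J' = (?t Q * W) * (V * (?t W * Q))"
      unfolding J'_def using Q V W by (simp add: assoc_mult_mat[of _ e d _ d _ e] assoc_mult_mat[of _ e d _ d _ d] assoc_mult_mat[of _ d d _ d _ e])
    also have "\<dots> = ?t R * J * R"
      unfolding QW WQ J_def using Q V R 
      by (simp add: assoc_mult_mat[of _ e d _ d _ e] assoc_mult_mat[of _ e e _ d _ e] assoc_mult_mat[of _ e e _ e _ e] assoc_mult_mat[of _ d d _ e _ e] assoc_mult_mat[of _ e d _ e _ e])
    finally show ?thesis .
  qed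
  have RR: "R * R2 = 1\<^sub>m e"
  proof -
    have "J * (R * R2) = ?t Q * V * (Q * (R * R2))"
      unfolding J_def using Q V R R2 by (intro assoc_mult_mat[of _ e d _ e _ e]) auto
    also have "\<dots> = J" unfolding QRR J_def ..
    finally have "Ji * (J * (R * R2)) = Ji * J" by simp
    then show ?thesis using Ji J R R2 assoc_mult_mat[of Ji e e J e "R * R2" e] by simp
  qed
  have RR': "R2 * R = 1\<^sub>m e" by (rule mat_mult_left_right_inverse[OF R R2 RR])
  have tRR: "?t R * ?t R2 = 1\<^sub>m e" "?t R2 * ?t R = 1\<^sub>m e"
    unfolding transpose_mult[OF R2 R, symmetric] transpose_mult[OF R R2, symmetric] RR RR' by simp_all
  define X where "X = R2 * Ji * ?t R2"
  have X: "X \<in> carrier_mat e e" using R2 Ji by (simp add: X_def)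
  have J'c: "J' \<in> carrier_mat e e" using J R by (simp add: J')
  have "J' * X = ?t R * (J * (R * R2) * Ji) * ?t R2"
    unfolding J' X_def using R R2 J Ji by (simp add: assoc_mult_mat[of _ e e _ e _ e])
  also have "\<dots> = 1\<^sub>m e" using RR Ji J tRR R by simp
  finally have J'X: "J' * X = 1\<^sub>m e" .
  have XJ': "X * J' = 1\<^sub>m e" by (rule mat_mult_left_right_inverse[OF J'c X J'X])
  show "invertible_mat J'"
    unfolding invertible_mat_def inverts_mat_def using J'c X J'X XJ' by (intro conjI exI[of _ X]) auto
  have Tc: "T \<in> carrier_vec e" unfolding T_def using Q s by simp
  have T': "T' = ?t R *\<^sub>v T"
  proof -
    have "?t Q *\<^sub>v (W *\<^sub>v s) = ?t R *\<^sub>v (?t Q *\<^sub>v s)"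
      using Q W R s QW assoc_mult_mat_vec[of "?t Q" e d W d s] assoc_mult_mat_vec[of "?t R" e e "?t Q" d s] by simp
    then show ?thesis unfolding T_def T'_def using Q R s by (simp add: mult_mat_vec[of _ e e])
  qed
  have "the (mat_inverse J') *\<^sub>v T' = R2 *\<^sub>v (Ji *\<^sub>v T)"
  proof -
    have "the (mat_inverse J') *\<^sub>v T' = X *\<^sub>v (?t R *\<^sub>v T)"
      using mat_inverse_eqI[OF J'c X J'X XJ'] T' by simp
    also have "\<dots> = (R2 * Ji * (?t R2 * ?t R)) *\<^sub>v T"
      unfolding X_def using R R2 Ji Tc
      by (simp add: assoc_mult_mat_vec[of _ e e _ e, symmetric] assoc_mult_mat[of _ e e _ e _ e] del: transpose_mult)
    also have "\<dots> = R2 *\<^sub>v (Ji *\<^sub>v T)"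
      using tRR R2 Ji Tc by (simp add: assoc_mult_mat_vec[of _ e e _ e])
    finally show ?thesis .
  qed
  then have "scalar_prod T' (the (mat_inverse J') *\<^sub>v T') = scalar_prod (?t R *\<^sub>v T) (R2 *\<^sub>v (Ji *\<^sub>v T))"
    by (simp add: T')
  also have "\<dots> = scalar_prod T (R *\<^sub>v (R2 *\<^sub>v (Ji *\<^sub>v T)))"
    using R R2 Ji Tc by (intro transpose_vec_mult_scalar) auto
  also have "R *\<^sub>v (R2 *\<^sub>v (Ji *\<^sub>v T)) = Ji *\<^sub>v T"
  proof -
    have "R *\<^sub>v (R2 *\<^sub>v (Ji *\<^sub>v T)) = (R * R2) *\<^sub>v (Ji *\<^sub>v T)"
      using R R2 Ji Tc by (intro assoc_mult_mat_vec[symmetric]) auto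
    then show ?thesis using RR Ji Tc by simp
  qed
  finally show "scalar_prod T' (the (mat_inverse J') *\<^sub>v T') = scalar_prod T (the (mat_inverse J) *\<^sub>v T)"
    using mat_inverse_eqI[OF J Ji] by simp
qed

section \<open>Scalar polynomial matrices and the system for the matrices $D_i$\<close>

lemma mat_mult_entry: "((mat a :: 'a::semiring_1^'n^'n) ** X) $ r $ c = a * X $ r $ c"
proof -
  have "((mat a :: 'a^'n^'n) ** X) $ r $ c = (\<Sum>k\<in>UNIV. (if r = k then a else 0) * X $ k $ c)"
    by (simp add: matrix_matrix_mult_def Finite_Cartesian_Product.mat_def)
  also have "\<dots> = (\<Sum>k\<in>UNIV. if k = r then a * X $ k $ c else 0)" by (intro sum.cong) auto
  finally show ?thesis by simp
qed

lemma mult_mat_entry: "(X ** (mat a :: 'a::comm_semiring_1^'n^'n)) $ r $ c = a * X $ r $ c"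
proof -
  have "(X ** (mat a :: 'a^'n^'n)) $ r $ c = (\<Sum>k\<in>UNIV. X $ r $ k * (if k = c then a else 0))"
    by (simp add: matrix_matrix_mult_def Finite_Cartesian_Product.mat_def)
  also have "\<dots> = (\<Sum>k\<in>UNIV. if k = c then a * X $ r $ k else 0)"
    by (intro sum.cong) (auto simp: mult.commute)
  finally show ?thesis by simp
qed

lemma mat_mult_mat: "(mat a :: 'a::semiring_1^'n^'n) ** mat b = mat (a * b)"
  by (simp add: Finite_Cartesian_Product.vec_eq_iff mat_mult_entry) (simp add: Finite_Cartesian_Product.mat_def)

lemma sum_nth2: "(\<Sum>i\<in>S. f i) $ r $ c = (\<Sum>i\<in>S. f i $ r $ c)"
  by (induction S rule: infinite_finite_induct) auto

lemma coeff_ar_poly: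
  "coeff (ar_poly A p $ r $ c) u
     = (if u = 0 then of_bool (r = c) else if u \<le> p then - A u $ r $ c else 0)"
proof -
  have "coeff (ar_poly A p $ r $ c) u = of_bool (u = 0 \<and> r = c) - (\<Sum>i=1..p. if i = u then A i $ r $ c else 0)"
    by (simp add: ar_poly_def sum_nth2 monom_mat_def coeff_sum Finite_Cartesian_Product.mat_def)
  then show ?thesis by auto
qed

lemma coeff_ma_poly:
  "coeff (ma_poly B q $ r $ c) u
     = (if u = 0 then of_bool (r = c) else if u \<le> q then B u $ r $ c else 0)"
proof -
  have "coeff (ma_poly B q $ r $ c) u = of_bool (u = 0 \<and> r = c) + (\<Sum>i=1..q. if i = u then B i $ r $ c else 0)"
    by (simp add: ma_poly_def sum_nth2 monom_mat_def coeff_sum Finite_Cartesian_Product.mat_def)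
  then show ?thesis by auto
qed

text \<open>The scalar counterpart of \<open>ar_poly\<close> (with negated coefficients) and of \<open>ma_poly\<close>.\<close>
definition lag_poly :: "(nat \<Rightarrow> real) \<Rightarrow> nat \<Rightarrow> real poly" where
  "lag_poly c p = 1 + (\<Sum>i=1..p. monom (c i) i)"

lemma coeff_lag_poly: "coeff (lag_poly c p) u = (if u = 0 then 1 else if u \<le> p then c u else 0)"
proof -
  have "coeff (lag_poly c p) u = of_bool (u = 0) + (\<Sum>i=1..p. if i = u then c i else 0)"
    by (simp add: lag_poly_def coeff_sum)
  then show ?thesis by auto
qed

lemma degree_lag_poly: "p > 0 \<Longrightarrow> c p \<noteq> 0 \<Longrightarrow> degree (lag_poly c p) = p" "degree (lag_poly c 0) = 0"
  by (auto intro!: antisym degree_le le_degree simp: coeff_lag_poly)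

lemma ar_poly_scalar:
  assumes "\<And>i. i \<in> {1..p} \<Longrightarrow> A i = a i *\<^sub>R mat 1"
  shows "ar_poly A p = mat (lag_poly (\<lambda>i. - a i) p)"
  using assms
  by (simp add: Finite_Cartesian_Product.vec_eq_iff poly_eq_iff coeff_ar_poly coeff_lag_poly
      Finite_Cartesian_Product.mat_def)

lemma ma_poly_scalar:
  assumes "\<And>i. i \<in> {1..q} \<Longrightarrow> B i = b i *\<^sub>R mat 1"
  shows "ma_poly B q = mat (lag_poly b q)"
  using assms
  by (simp add: Finite_Cartesian_Product.vec_eq_iff poly_eq_iff coeff_ma_poly coeff_lag_poly
      Finite_Cartesian_Product.mat_def)

lemma green_scalar:
  assumes "coeff P 0 \<noteq> 0"
  shows "green (mat P :: real poly^'k^'k) (int u) = fps_nth (inverse (fps_of_poly P)) u *\<^sub>R mat 1"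
proof -
  have "(\<chi> r c. fps_of_poly ((mat P :: real poly^'k^'k) $ r $ c)) = mat (fps_of_poly P)"
    by (simp add: Finite_Cartesian_Product.vec_eq_iff Finite_Cartesian_Product.mat_def)
  moreover have "matrix_inv (mat (fps_of_poly P) :: real fps^'k^'k) = mat (inverse (fps_of_poly P))"
    using assms by (intro matrix_inv_eqI) (simp_all add: mat_mult_mat inverse_mult_eq_1 inverse_mult_eq_1')
  ultimately show ?thesis
    by (simp add: green_def Finite_Cartesian_Product.vec_eq_iff Finite_Cartesian_Product.mat_def)
qed

text \<open>A common factor $d$ of $a$ and $b$ gives the common left divisor $d I$, which must divide $I$.\<close>
lemma scalar_coprime:
  assumes "is_gcld (mat 1) (mat a :: real poly^'k^'k) (mat b)"
  shows "coprime a b"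
proof (rule coprimeI)
  fix d assume "d dvd a" "d dvd b"
  then have "left_divides (mat d) (mat a :: real poly^'k^'k)" "left_divides (mat d) (mat b :: real poly^'k^'k)"
    unfolding left_divides_def by (metis dvdE mat_mult_mat)+
  then have "left_divides (mat d) (mat 1 :: real poly^'k^'k)" using assms by (simp add: is_gcld_def)
  then obtain R :: "real poly^'k^'k" where R: "mat 1 = mat d ** R" unfolding left_divides_def by blast
  have "(mat 1 :: real poly^'k^'k) $ i $ i = d * R $ i $ i" for i unfolding R by (rule mat_mult_entry)
  then show "d dvd 1" by (simp add: Finite_Cartesian_Product.mat_def) (metis dvd_triv_left)
qed

text \<open>The recursion $a y = x$ for the power series $y = x/a$ has order $p$ and is homogeneous from degree
  $p + q$ on. The $p$ coefficients before that degree vanish, hence so do all later ones, and $y$ is a polynomial.\<close>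
lemma poly_quotient_truncates:
  fixes a x :: "real poly"
  assumes a: "coeff a 0 = 1" "degree a = p" and x: "\<And>s. s \<ge> p + q \<Longrightarrow> coeff x s = 0"
    and y: "\<And>s. q \<le> s \<Longrightarrow> s < p + q \<Longrightarrow> fps_nth (inverse (fps_of_poly a) * fps_of_poly x) s = 0"
  shows "\<exists>w. x = a * w \<and> (\<forall>s\<ge>q. coeff w s = 0)"
proof -
  define y where "y = inverse (fps_of_poly a) * fps_of_poly x"
  have ay: "fps_of_poly a * y = fps_of_poly x"
    using a(1) by (simp add: y_def mult.assoc[symmetric] inverse_mult_eq_1')
  \<comment> \<open>For $s \ge p + q$ the recursion expresses coefficient $s$ by the $p$ preceding ones, all of index at
    least $q$.\<close>
  have y0: "fps_nth y s = 0" if "q \<le> s" for s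
    using that
  proof (induction s rule: less_induct)
    case (less s)
    show ?case
    proof (cases "s < p + q")
      case True
      then show ?thesis using assms(4)[of s] less.prems by (simp add: y_def)
    next
      case False
      have "0 = fps_nth (fps_of_poly a * y) s" using x[of s] False by (simp add: ay)
      also have "\<dots> = (\<Sum>i=0..s. coeff a i * fps_nth y (s - i))" by (simp add: fps_mult_nth)
      also have "\<dots> = (\<Sum>i\<in>{0}. coeff a i * fps_nth y (s - i))"
      proof (intro sum.mono_neutral_right ballI)
        fix i assume i: "i \<in> {0..s} - {0}"
        show "coeff a i * fps_nth y (s - i) = 0"
        proof (cases "i \<le> p")
          case True
          then show ?thesis using less.IH[of "s - i"] i False by auto
        qed (use a(2) in \<open>simp add: coeff_eq_0\<close>)
      qed auto
      finally show ?thesis using a(1) by simp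
    qed
  qed
  define w where "w = (\<Sum>s<q. monom (fps_nth y s) s)"
  have w: "coeff w s = fps_nth y s" for s
    using y0[of s] by (simp add: w_def coeff_sum)
  then have "fps_of_poly w = y" by (simp add: fps_eq_iff)
  then have "fps_of_poly (a * w) = fps_of_poly x" using ay by (simp add: fps_of_poly_mult)
  then show ?thesis using w y0 by (metis fps_of_poly_eq_iff)
qed

text \<open>The polynomial $b$ divides $x = a w$ and is coprime to $a$, so it divides $w$, all of whose coefficients from
  degree $q$ on vanish.\<close>
lemma coprime_quotients_zero:
  fixes a b x :: "real poly"
  assumes a: "coeff a 0 = 1" "degree a = p" and b: "coeff b 0 = 1" "degree b = q" and "coprime a b"
    and x: "\<And>s. s \<ge> p + q \<Longrightarrow> coeff x s = 0"
    and ya: "\<And>s. q \<le> s \<Longrightarrow> s < p + q \<Longrightarrow> fps_nth (inverse (fps_of_poly a) * fps_of_poly x) s = 0"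
    and yb: "\<And>s. p \<le> s \<Longrightarrow> s < p + q \<Longrightarrow> fps_nth (inverse (fps_of_poly b) * fps_of_poly x) s = 0"
  shows "x = 0"
proof -
  obtain w where w: "x = a * w" "\<And>s. s \<ge> q \<Longrightarrow> coeff w s = 0"
    using poly_quotient_truncates[OF a x ya] by auto
  obtain v where v: "x = b * v"
    using poly_quotient_truncates[OF b, of p x] x yb by (auto simp: add.commute)
  have "b dvd a * w" using w v by (metis dvd_triv_left)
  then have "b dvd w" using \<open>coprime a b\<close> by (metis coprime_dvd_mult_right_iff coprime_commute)
  have "w = 0"
  proof (rule ccontr)
    assume nz: "w \<noteq> 0"
    then have "q \<le> degree w" using \<open>b dvd w\<close> b(2) dvd_imp_degree_le by blast
    then have "lead_coeff w = 0" using w(2) by blast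
    then show False using nz by simp
  qed
  then show ?thesis using w by simp
qed

text \<open>The homogeneous form of the system for the $D_i$, read as a statement on the polynomial
  $\sum_i x_i z^{i-1}$: certain coefficients of its quotients by $a$ and by $b$ vanish.\<close>
lemma D_system_unique_combination:
  fixes x :: "nat \<Rightarrow> real" and a b :: "real poly"
  assumes a: "coeff a 0 = 1" "degree a = p" and b: "coeff b 0 = 1" "degree b = q" and "coprime a b"
    and ga: "\<And>t. t \<in> {q+1..q+p} \<Longrightarrow> (\<Sum>i=1..p+q. (if i \<le> t then fps_nth (inverse (fps_of_poly a)) (t - i) else 0) * x i) = 0"
    and gb: "\<And>t. t \<in> {p+1..p+q} \<Longrightarrow> (\<Sum>i=1..p+q. (if i \<le> t then fps_nth (inverse (fps_of_poly b)) (t - i) else 0) * x i) = 0"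
    and i: "i \<in> {1..p+q}"
  shows "x i = 0"
proof -
  \<comment> \<open>The index shift makes $X$ a polynomial of degree less than $p + q$.\<close>
  define X where "X = (\<Sum>i<p+q. monom (x (Suc i)) i)"
  have X: "coeff X s = (if s < p + q then x (Suc s) else 0)" for s
    by (simp add: X_def coeff_sum)
  have conv: "fps_nth (g * fps_of_poly X) s = (\<Sum>i=1..p+q. (if i \<le> Suc s then fps_nth g (Suc s - i) else 0) * x i)"
    if "s < p + q" for g :: "real fps" and s
  proof -
    have "fps_nth (g * fps_of_poly X) s = (\<Sum>j=0..s. coeff X j * fps_nth g (s - j))"
      by (subst mult.commute) (simp add: fps_mult_nth)
    also have "\<dots> = (\<Sum>i\<in>{1..Suc s}. fps_nth g (Suc s - i) * x i)"
      using that by (intro sum.reindex_bij_witness[of _ "\<lambda>i. i - 1" Suc]) (auto simp: X)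
    also have "\<dots> = (\<Sum>i=1..p+q. (if i \<le> Suc s then fps_nth g (Suc s - i) else 0) * x i)"
      using that by (intro sum.mono_neutral_cong_left) auto
    finally show ?thesis .
  qed
  have "X = 0"
  proof (rule coprime_quotients_zero[OF a b \<open>coprime a b\<close>])
    show "fps_nth (inverse (fps_of_poly a) * fps_of_poly X) s = 0" if "q \<le> s" "s < p + q" for s
      unfolding conv[OF that(2)] using ga[of "Suc s"] that by simp
    show "fps_nth (inverse (fps_of_poly b) * fps_of_poly X) s = 0" if "p \<le> s" "s < p + q" for s
      unfolding conv[OF that(2)] using gb[of "Suc s"] that by simp
  qed (simp add: X)
  then have "x (Suc (i - 1)) = 0" using X[of "i - 1"] i by (auto split: if_splits)
  then show ?thesis using i by simp
qed

lemma scalar_coeff_nonzero: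
  fixes c :: real
  assumes "det (c *\<^sub>R mat 1 :: real^'k^'k) \<noteq> 0"
  shows "c \<noteq> 0"
proof
  assume "c = 0"
  then have "invertible (0 :: real^'k^'k)" using assms by (simp add: invertible_det_nz)
  then have "(mat 1 :: real^'k^'k) $ undefined $ undefined = 0"
    unfolding invertible_def by (auto simp: matrix_matrix_mult_def Finite_Cartesian_Product.vec_eq_iff)
  then show False by (simp add: Finite_Cartesian_Product.mat_def)
qed

text \<open>With scalar Green matrices, the commutators of $L$ with the $D_i$ solve, entry by entry, the
  homogeneous system, whose only solution is zero.\<close>
lemma D_system_commutes:
  fixes A B D :: "nat \<Rightarrow> real^'k^'k"
  assumes A: "\<And>i. i \<in> {1..p0} \<Longrightarrow> A i = a i *\<^sub>R mat 1" and B: "\<And>j. j \<in> {1..q0} \<Longrightarrow> B j = b j *\<^sub>R mat 1"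
    and asm: "assumption_A A B p0 q0" and D: "is_D_system A B p0 q0 D" and i: "i \<in> {1..p0+q0}"
  shows "L ** D i = D i ** L"
proof -
  define \<alpha> where "\<alpha> = lag_poly (\<lambda>i. - a i) p0"
  define \<beta> where "\<beta> = lag_poly b q0"
  have ar: "ar_poly A p0 = mat \<alpha>" unfolding \<alpha>_def by (rule ar_poly_scalar[OF A])
  have ma: "ma_poly B q0 = mat \<beta>" unfolding \<beta>_def by (rule ma_poly_scalar[OF B])
  have "is_gcld (mat 1) (mat \<alpha> :: real poly^'k^'k) (mat \<beta>)"
    using asm by (simp add: assumption_A_def ar ma)
  then have cop: "coprime \<alpha> \<beta>" by (rule scalar_coprime)
  have "a p0 \<noteq> 0" if "p0 > 0"
    using asm that A[of p0] scalar_coeff_nonzero[of "a p0", where 'k = 'k] by (simp add: assumption_A_def)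
  then have da: "degree \<alpha> = p0" by (cases "p0 = 0") (simp_all add: \<alpha>_def degree_lag_poly)
  have "b q0 \<noteq> 0" if "q0 > 0"
    using asm that B[of q0] scalar_coeff_nonzero[of "b q0", where 'k = 'k] by (simp add: assumption_A_def)
  then have db: "degree \<beta> = q0" by (cases "q0 = 0") (simp_all add: \<beta>_def degree_lag_poly)
  have a0: "coeff \<alpha> 0 = 1" and b0: "coeff \<beta> 0 = 1" by (simp_all add: \<alpha>_def \<beta>_def coeff_lag_poly)
  have gr: "green (mat P :: real poly^'k^'k) (int t - int i)
      = (if i \<le> t then fps_nth (inverse (fps_of_poly P)) (t - i) else 0) *\<^sub>R mat 1"
    if "coeff P 0 = 1" for P i t
    using green_scalar[of P "t - i", where 'k = 'k] that by (cases "i \<le> t") (auto simp: green_def simp del: of_nat_diff simp flip: of_nat_diff)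
  have key: "(\<Sum>i=1..p0+q0. (if i \<le> t then fps_nth (inverse (fps_of_poly P)) (t - i) else 0) * (L ** D i - D i ** L) $ r $ c) = 0"
    if P: "coeff P 0 = 1" and eq: "green (mat P :: real poly^'k^'k) (int t) + (\<Sum>i=1..p0+q0. green (mat P) (int t - int i) ** transpose (D i)) = 0"
    for P t r c
  proof -
    let ?g = "\<lambda>i. if i \<le> t then fps_nth (inverse (fps_of_poly P)) (t - i) else 0"
    have "?g 0 *\<^sub>R mat 1 + (\<Sum>i=1..p0+q0. ?g i *\<^sub>R transpose (D i)) = 0"
      using eq gr[OF P, of t 0] by (simp add: gr[OF P] matrix_mult_scaleR)
    then have "transpose (?g 0 *\<^sub>R mat 1 + (\<Sum>i=1..p0+q0. ?g i *\<^sub>R transpose (D i))) = transpose 0" by simp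
    moreover have "transpose (X + Y) = transpose X + transpose Y" for X Y :: "real^'k^'k"
      by (simp add: transpose_def Finite_Cartesian_Product.vec_eq_iff)
    moreover have "transpose (\<Sum>i\<in>S. ?g i *\<^sub>R transpose (D i)) = (\<Sum>i\<in>S. ?g i *\<^sub>R D i)" for S
      by (simp add: transpose_def Finite_Cartesian_Product.vec_eq_iff sum_nth2)
    ultimately have sum0: "?g 0 *\<^sub>R mat 1 + (\<Sum>i=1..p0+q0. ?g i *\<^sub>R D i) = 0"
      by (simp add: transpose_scaleR) (simp add: transpose_def Finite_Cartesian_Product.vec_eq_iff)
    have "(\<Sum>i=1..p0+q0. ?g i *\<^sub>R (L ** D i - D i ** L))
       = L ** (?g 0 *\<^sub>R mat 1 + (\<Sum>i=1..p0+q0. ?g i *\<^sub>R D i)) - (?g 0 *\<^sub>R mat 1 + (\<Sum>i=1..p0+q0. ?g i *\<^sub>R D i)) ** L"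
      by (simp add: matrix_add_ldistrib matrix_mult_add_right matrix_mult_sum matrix_mult_scaleR
          scaleR_diff_right sum_subtractf)
    then have "(\<Sum>i=1..p0+q0. ?g i *\<^sub>R (L ** D i - D i ** L)) = 0" unfolding sum0 by simp
    then have "(\<Sum>i=1..p0+q0. ?g i *\<^sub>R (L ** D i - D i ** L)) $ r $ c = 0" by simp
    then show ?thesis by (simp add: sum_nth2)
  qed
  have "(L ** D i - D i ** L) $ r $ c = 0" for r c
  proof (rule D_system_unique_combination[OF a0 da b0 db cop _ _ i])
    show "(\<Sum>i=1..p0+q0. (if i \<le> t then fps_nth (inverse (fps_of_poly \<alpha>)) (t - i) else 0) * (L ** D i - D i ** L) $ r $ c) = 0"
      if "t \<in> {q0+1..q0+p0}" for t
      using D that by (intro key[OF a0]) (simp add: is_D_system_def ar Let_def)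
    show "(\<Sum>i=1..p0+q0. (if i \<le> t then fps_nth (inverse (fps_of_poly \<beta>)) (t - i) else 0) * (L ** D i - D i ** L) $ r $ c) = 0"
      if "t \<in> {p0+1..p0+q0}" for t
      using D that by (intro key[OF b0]) (simp add: is_D_system_def ma Let_def)
  qed
  then show ?thesis by (simp add: Finite_Cartesian_Product.vec_eq_iff)
qed


section \<open>Invariance of the quadratic statistic\<close>

text \<open>Left multiplication by a matrix that commutes with the coefficients maps solutions of the
  difference equation to solutions.\<close>
lemma fundamental_system_left_mult:
  fixes L :: "real^'k::{finite,wellorder}^'k::_"
  assumes Y: "fundamental_system D m Y" and comm: "\<And>i. i \<in> {1..m} \<Longrightarrow> L ** D i = D i ** L"
  shows "\<exists>C. \<forall>j\<in>{1..m}. \<forall>t. L ** Y j t = (\<Sum>s=1..m. Y s t ** C s j)"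
proof -
  have "\<exists>C. \<forall>t. L ** Y j t = (\<Sum>s=1..m. Y s t ** C s)" if j: "j \<in> {1..m}" for j
  proof -
    have "L ** Y j t + (\<Sum>i=1..m. D i ** (L ** Y j (t - int i))) = 0" for t
    proof -
      have "(\<Sum>i=1..m. D i ** (L ** Y j (t - int i))) = (\<Sum>i=1..m. L ** (D i ** Y j (t - int i)))"
        using comm by (intro sum.cong) (simp_all add: matrix_mul_assoc)
      then have "L ** Y j t + (\<Sum>i=1..m. D i ** (L ** Y j (t - int i)))
          = L ** (Y j t + (\<Sum>i=1..m. D i ** Y j (t - int i)))"
        by (simp add: matrix_add_ldistrib matrix_mult_sum)
      also have "\<dots> = 0" using Y j by (simp add: fundamental_system_def solves_diff_eq_def)
      finally show ?thesis .
    qed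
    then have "solves_diff_eq D m (\<lambda>t. L ** Y j t)" by (simp add: solves_diff_eq_def)
    then show ?thesis using Y unfolding fundamental_system_def by blast
  qed
  then obtain C where "\<And>j t. j \<in> {1..m} \<Longrightarrow> L ** Y j t = (\<Sum>s=1..m. Y s t ** C j s)" by metis
  then show ?thesis by (intro exI[of _ "\<lambda>s j. C j s"]) blast
qed

lemma to_mat_scalar: "to_mat (c *\<^sub>R (mat 1 :: real^'k::{finite,wellorder}^'k::_)) = c \<cdot>\<^sub>m 1\<^sub>m CARD('k)"
  by (simp add: to_mat_scaleR to_mat_one)

lemma kron_one_scalar: "kron (1\<^sub>m k) (c \<cdot>\<^sub>m 1\<^sub>m k) = c \<cdot>\<^sub>m 1\<^sub>m (k\<^sup>2)" "kron (c \<cdot>\<^sub>m 1\<^sub>m k) (1\<^sub>m k) = c \<cdot>\<^sub>m 1\<^sub>m (k\<^sup>2)"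
  by (simp_all add: kron_smult kron_one power2_eq_square)

lemma lower_H_scalar:
  fixes B :: "nat \<Rightarrow> real^'k::{finite,wellorder}^'k::_"
  assumes "\<And>u. green (ma_poly B q0) (int u) = h u *\<^sub>R mat 1"
  shows "\<exists>S\<in>carrier_mat m m. lower_H B q0 m = kron S (1\<^sub>m (CARD('k)\<^sup>2))"
proof -
  have "lower_H B q0 m = kron (Matrix.mat m m (\<lambda>(i, j). if j + 1 \<le> i + 1 then h (i + 1 - (j + 1)) else 0)) (1\<^sub>m (CARD('k)\<^sup>2))"
    unfolding lower_H_def
    by (rule block_mat_scalar) (auto simp: assms to_mat_scalar kron_one_scalar simp del: of_nat_diff)
  then show ?thesis by (intro bexI) auto
qed

lemma lower_B_scalar:
  fixes B :: "nat \<Rightarrow> real^'k::{finite,wellorder}^'k::_"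
  assumes "\<And>j. j \<in> {1..q0} \<Longrightarrow> B j = b j *\<^sub>R mat 1"
  shows "\<exists>S\<in>carrier_mat m m. lower_B B q0 m = kron S (1\<^sub>m (CARD('k)\<^sup>2))"
proof -
  define c where "c u = (if u = 0 then 1 else if u \<le> q0 then b u else 0)" for u
  have c: "to_mat (transpose (ma_coeff B q0 u)) = c u \<cdot>\<^sub>m 1\<^sub>m CARD('k)" for u
  proof -
    have "transpose (ma_coeff B q0 u) = c u *\<^sub>R mat 1"
      using assms[of u] by (auto simp: ma_coeff_def c_def transpose_scaleR) (simp add: Finite_Cartesian_Product.vec_eq_iff transpose_def)
    then show ?thesis by (simp add: to_mat_scalar)
  qed
  have "lower_B B q0 m = kron (Matrix.mat m m (\<lambda>(i, j). if j + 1 \<le> i + 1 then c (i + 1 - (j + 1)) else 0)) (1\<^sub>m (CARD('k)\<^sup>2))"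
    unfolding lower_B_def
    by (rule block_mat_scalar) (auto simp: c kron_one_scalar)
  then show ?thesis by (intro bexI) auto
qed

lemma psi_bar_commute:
  fixes L :: "real^'k::{finite,wellorder}^'k::_"
  assumes P: "P \<in> carrier_mat CARD('k) CARD('k)"
    and C: "\<And>j t. j \<in> {1..l} \<Longrightarrow> L ** Y j t = (\<Sum>s=1..l. Y s t ** C s j)"
  shows "\<exists>R\<in>carrier_mat (l * CARD('k) * CARD('k)) (l * CARD('k) * CARD('k)).
           kron (1\<^sub>m (m - r)) (kron (to_mat L) P) * psi_bar Y r l m = psi_bar Y r l m * R"
proof -
  let ?k = "CARD('k)"
  let ?Y = "block_mat ?k (m - r) l (\<lambda>i j. to_mat (Y j (int (r + i))))"
  let ?C = "block_mat ?k l l (\<lambda>i j. to_mat (C i j))"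
  have "kron (1\<^sub>m (m - r)) (to_mat L) * ?Y = ?Y * ?C"
    by (rule block_mat_mult[where F = "\<lambda>i j. Y j (int (r + i))"]) (simp add: C)
  then have "kron (1\<^sub>m (m - r)) (kron (to_mat L) P) * psi_bar Y r l m = kron (?Y * ?C) (1\<^sub>m ?k * P)"
    using P unfolding psi_bar_def kron_assoc[symmetric] by (subst kron_mult) auto
  also have "\<dots> = psi_bar Y r l m * kron ?C P"
    unfolding psi_bar_def using P by (intro kron_mult[symmetric]) auto
  finally show ?thesis using P
    by (intro bexI[of _ "kron ?C P"] carrier_matI) auto
qed

text \<open>The triangular factors of the matrix are Kronecker products with an identity on the right, so
  $I \otimes N$ passes through them; on the block of the fundamental solutions \<open>psi_bar_commute\<close> applies.\<close>
lemma Q_matrix_commute: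
  fixes B :: "nat \<Rightarrow> real^'k::{finite,wellorder}^'k::_"
  assumes h: "\<And>u. green (ma_poly B q0) (int u) = h u *\<^sub>R mat 1"
    and b: "\<And>j. j \<in> {1..q0} \<Longrightarrow> B j = b j *\<^sub>R mat 1"
    and Y: "fundamental_system D (p0 + q0) Y"
    and D: "\<And>i. i \<in> {1..p0+q0} \<Longrightarrow> L ** D i = D i ** L"
    and P: "P \<in> carrier_mat CARD('k) CARD('k)"
    and n: "n > excess_order p0 p1 q0 q1 + p0 + q0"
  shows "\<exists>e R. Q_matrix B p0 p1 q0 q1 Y n \<in> carrier_mat ((n - 1) * (CARD('k)\<^sup>2)) e \<and> R \<in> carrier_mat e e \<and>
           e = CARD('k)\<^sup>2 * (excess_order p0 p1 q0 q1 + p0 + q0) \<and>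
           kron (1\<^sub>m (n - 1)) (kron (to_mat L) P) * Q_matrix B p0 p1 q0 q1 Y n = Q_matrix B p0 p1 q0 q1 Y n * R"
proof -
  let ?k = "CARD('k)"
  define r where "r = excess_order p0 p1 q0 q1"
  define l where "l = p0 + q0"
  define d where "d = (n - 1) * ?k\<^sup>2"
  define N where "N = kron (to_mat L) P"
  define Psi where "Psi = psi_bar Y r l (n - 1)"
  define U where "U = diag_block_mat [1\<^sub>m (?k\<^sup>2 * r), Psi]"
  have N: "N \<in> carrier_mat (?k\<^sup>2) (?k\<^sup>2)"
    unfolding N_def power2_eq_square using kron_carrier[OF to_mat_carrier P] .
  have Psi: "Psi \<in> carrier_mat ((n - 1 - r) * ?k\<^sup>2) (l * ?k\<^sup>2)"
    unfolding Psi_def psi_bar_def by (intro carrier_matI) (simp_all add: power2_eq_square)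
  from fundamental_system_left_mult[OF Y D] obtain C where
    C: "\<And>j t. j \<in> {1..l} \<Longrightarrow> L ** Y j t = (\<Sum>s=1..l. Y s t ** C s j)" unfolding l_def by blast
  from psi_bar_commute[where r = r and m = "n - 1" and L = L and Y = Y and C = C, OF P C] obtain R1 where
    R1: "R1 \<in> carrier_mat (l * ?k\<^sup>2) (l * ?k\<^sup>2)" "kron (1\<^sub>m (n - 1 - r)) N * Psi = Psi * R1"
    unfolding Psi_def[symmetric] N_def[symmetric] by (auto simp: power2_eq_square mult.assoc)
  define R where "R = diag_block_mat [kron (1\<^sub>m r) N, R1]"
  have Nr: "kron (1\<^sub>m r) N \<in> carrier_mat (?k\<^sup>2 * r) (?k\<^sup>2 * r)"
    using kron_carrier[OF one_carrier_mat N, of r] by (simp add: mult.commute)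
  have Nm: "kron (1\<^sub>m (n - 1 - r)) N \<in> carrier_mat ((n - 1 - r) * ?k\<^sup>2) ((n - 1 - r) * ?k\<^sup>2)"
    using kron_carrier[OF one_carrier_mat N] .
  let ?e = "?k\<^sup>2 * r + l * ?k\<^sup>2"
  have nr: "r + (n - 1 - r) = n - 1" using n by (simp add: r_def)
  have dd: "?k\<^sup>2 * r + (n - 1 - r) * ?k\<^sup>2 = d"
    unfolding d_def using nr by (metis add_mult_distrib mult.commute)
  have R: "R \<in> carrier_mat ?e ?e"
    unfolding R_def diag_block_mat_two using four_block_carrier_mat[OF Nr R1(1)] .
  have U: "U \<in> carrier_mat d ?e"
    unfolding U_def diag_block_mat_two dd[symmetric] using four_block_carrier_mat[OF one_carrier_mat Psi] .
  have split: "kron (1\<^sub>m (n - 1)) N = diag_block_mat [kron (1\<^sub>m r) N, kron (1\<^sub>m (n - 1 - r)) N]"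
    using kron_one_split[OF N, of r "n - 1 - r"] unfolding nr .
  have "kron (1\<^sub>m (n - 1)) N * U = diag_block_mat [kron (1\<^sub>m r) N * 1\<^sub>m (?k\<^sup>2 * r), kron (1\<^sub>m (n - 1 - r)) N * Psi]"
    unfolding split U_def by (rule diag_block_mat_mult[OF Nr Nm one_carrier_mat Psi])
  also have "\<dots> = diag_block_mat [1\<^sub>m (?k\<^sup>2 * r) * kron (1\<^sub>m r) N, Psi * R1]"
    by (simp only: left_mult_one_mat[OF Nr] right_mult_one_mat[OF Nr] R1(2))
  also have "\<dots> = U * R"
    unfolding U_def R_def by (rule diag_block_mat_mult[symmetric, OF one_carrier_mat Psi Nr R1(1)])
  finally have NU: "kron (1\<^sub>m (n - 1)) N * U = U * R" .
  from lower_H_scalar[where m = "n - 1", OF h] obtain S1 where S1: "S1 \<in> carrier_mat (n - 1) (n - 1)"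
    "lower_H B q0 (n - 1) = kron S1 (1\<^sub>m (?k\<^sup>2))" by blast
  from lower_B_scalar[where m = "n - 1" and B = B and b = b and ?q0.0 = q0, OF b] obtain S2 where S2: "S2 \<in> carrier_mat (n - 1) (n - 1)"
    "lower_B B q0 (n - 1) = kron S2 (1\<^sub>m (?k\<^sup>2))" by blast
  have S: "kron S1 (1\<^sub>m (?k\<^sup>2)) * kron S2 (1\<^sub>m (?k\<^sup>2)) = kron (S1 * S2) (1\<^sub>m (?k\<^sup>2))"
    using S1(1) S2(1) by (subst kron_mult) auto
  define S where "S = kron (S1 * S2) (1\<^sub>m (?k\<^sup>2))"
  have Q: "Q_matrix B p0 p1 q0 q1 Y n = S * U"
    unfolding Q_matrix_def Let_def S1(2) S2(2) S S_def U_def Psi_def r_def l_def ..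
  have SS: "S1 * S2 \<in> carrier_mat (n - 1) (n - 1)" using S1 S2 by simp
  have Sc: "S \<in> carrier_mat d d" unfolding S_def d_def using kron_carrier[OF SS one_carrier_mat] .
  have Nc: "kron (1\<^sub>m (n - 1)) N \<in> carrier_mat d d" unfolding d_def using kron_carrier[OF one_carrier_mat N] .
  have "kron (1\<^sub>m (n - 1)) N * S = kron (1\<^sub>m (n - 1) * (S1 * S2)) (N * 1\<^sub>m (?k\<^sup>2))"
    unfolding S_def using SS N by (intro kron_mult) auto
  also have "\<dots> = kron ((S1 * S2) * 1\<^sub>m (n - 1)) (1\<^sub>m (?k\<^sup>2) * N)"
    by (simp only: left_mult_one_mat[OF SS] right_mult_one_mat[OF SS] left_mult_one_mat[OF N] right_mult_one_mat[OF N])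
  also have "\<dots> = S * kron (1\<^sub>m (n - 1)) N"
    unfolding S_def using SS N by (intro kron_mult[symmetric]) auto
  finally have NS: "kron (1\<^sub>m (n - 1)) N * S = S * kron (1\<^sub>m (n - 1)) N" .
  have "kron (1\<^sub>m (n - 1)) N * (S * U) = kron (1\<^sub>m (n - 1)) N * S * U"
    by (rule assoc_mult_mat[symmetric, OF Nc Sc U])
  also have "\<dots> = S * (kron (1\<^sub>m (n - 1)) N * U)" unfolding NS by (rule assoc_mult_mat[OF Sc Nc U])
  also have "\<dots> = S * U * R" unfolding NU by (rule assoc_mult_mat[symmetric, OF Sc U R])
  finally have "kron (1\<^sub>m (n - 1)) N * (S * U) = S * U * R" .
  moreover have "S * U \<in> carrier_mat d ?e" using Sc U by simp
  moreover have "?e = ?k\<^sup>2 * (excess_order p0 p1 q0 q1 + p0 + q0)" by (simp add: r_def l_def algebra_simps)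
  ultimately show ?thesis using R unfolding Q N_def d_def by blast
qed

lemma residual_linear_image:
  fixes M :: "real^'k^'k"
  assumes A: "\<And>i. i \<in> {1..p} \<Longrightarrow> A i = a i *\<^sub>R mat 1" and B: "\<And>j. j \<in> {1..q} \<Longrightarrow> B j = b j *\<^sub>R mat 1"
  shows "residual A B p q (\<lambda>t. M *v x t) t = M *v residual A B p q x t"
proof (induction t rule: less_induct)
  case (less t)
  have ar: "(\<Sum>i=1..p. A i *v lag (\<lambda>t. M *v x t) t i) = M *v (\<Sum>i=1..p. A i *v lag x t i)"
    unfolding vec.sum
    by (intro sum.cong refl) (simp add: A lag_def scalar_matrix_commutes)
  have ma: "(\<Sum>i=1..q. B i *v (if 0 < i \<and> i < t then residual A B p q (\<lambda>t. M *v x t) (t - i) else 0))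
      = M *v (\<Sum>i=1..q. B i *v (if 0 < i \<and> i < t then residual A B p q x (t - i) else 0))"
    unfolding vec.sum
    by (intro sum.cong refl) (auto simp: B less.IH scalar_matrix_commutes)
  show ?case
    by (subst (1 2) residual.simps) (simp only: ar ma matrix_vector_mult_diff_distrib)
qed

lemma vec_of_to_mat_dim: "dim_vec (vec_of (to_mat (X :: real^'k::{finite,wellorder}^'k::_))) = CARD('k)\<^sup>2"
  by (simp add: power2_eq_square)

text \<open>The matrices $M$ and $M^{-1}$ both satisfy the commutation relation of \<open>Q_matrix_commute\<close>; the second
  one supplies the right inverse $R_2$ needed in \<open>quadratic_form_reparam\<close>.\<close>
theorem Q_stat_affine_invariant:
  fixes A B :: "nat \<Rightarrow> real^'k::{finite,wellorder}^'k::_"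
  assumes A: "\<And>i. i \<in> {1..p0} \<Longrightarrow> A i = a i *\<^sub>R mat 1" and B: "\<And>j. j \<in> {1..q0} \<Longrightarrow> B j = b j *\<^sub>R mat 1"
    and asm: "assumption_A A B p0 q0" and D: "is_D_system A B p0 q0 D"
    and Y: "fundamental_system D (p0 + q0) Y"
  shows "affine_invariant_on (Q_stat_domain A B p0 p1 q0 q1 Y n) (Q_stat A B p0 p1 q0 q1 Y K1 K2 n)"
  unfolding affine_invariant_on_def
proof (intro allI impI ballI)
  fix M :: "real^'k::_^'k::_" and x
  assume M: "invertible M" and x: "x \<in> Q_stat_domain A B p0 p1 q0 q1 Y n"
  let ?k = "CARD('k)"
  let ?Mi = "matrix_inv M"
  define z where "z = residual A B p0 q0 x"
  define Q where "Q = Q_matrix B p0 p1 q0 q1 Y n"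
  have z': "residual A B p0 q0 (\<lambda>t. M *v x t) = (\<lambda>t. M *v z t)"
    unfolding z_def by (rule ext) (rule residual_linear_image[OF A B])
  have n: "n > ?k * (?k - 1)" "n > excess_order p0 p1 q0 q1 + p0 + q0"
    and ex1: "\<exists>!C. is_tyler n z C" and inv: "invertible_mat (J_matrix Q n z)"
    using x by (simp_all add: Q_stat_domain_def z_def Q_def)
  have h: "green (ma_poly B q0) (int u) = fps_nth (inverse (fps_of_poly (lag_poly b q0))) u *\<^sub>R mat 1" for u
  proof -
    have "ma_poly B q0 = mat (lag_poly b q0)" using B by (rule ma_poly_scalar)
    then show ?thesis by (simp add: green_scalar coeff_lag_poly)
  qed
  have comm: "\<exists>e R. Q \<in> carrier_mat ((n - 1) * (?k\<^sup>2)) e \<and> R \<in> carrier_mat e e \<and>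
           e = ?k\<^sup>2 * (excess_order p0 p1 q0 q1 + p0 + q0) \<and>
           kron (1\<^sub>m (n - 1)) (kron (to_mat L) (to_mat P)) * Q = Q * R" for L P :: "real^'k::_^'k::_"
    unfolding Q_def
    by (rule Q_matrix_commute[OF h B Y D_system_commutes[OF A B asm D] to_mat_carrier n(2)]) auto
  define d where "d = (n - 1) * ?k\<^sup>2"
  obtain e R where Q: "Q \<in> carrier_mat d e" and R: "R \<in> carrier_mat e e"
    and e: "e = ?k\<^sup>2 * (excess_order p0 p1 q0 q1 + p0 + q0)"
    and QR: "kron (1\<^sub>m (n - 1)) (kron (to_mat (transpose M)) (to_mat ?Mi)) * Q = Q * R"
    using comm[of "transpose M" ?Mi] unfolding d_def by blast
  obtain R2 where R2: "R2 \<in> carrier_mat e e"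
    and QR2: "kron (1\<^sub>m (n - 1)) (kron (to_mat (transpose ?Mi)) (to_mat M)) * Q = Q * R2"
    using comm[of "transpose ?Mi" M] unfolding e by blast
  define N where "N = kron (to_mat M) (to_mat (transpose ?Mi))"
  define W where "W = kron (1\<^sub>m (n - 1)) N"
  have N: "N \<in> carrier_mat (?k\<^sup>2) (?k\<^sup>2)"
    unfolding N_def power2_eq_square by (rule kron_carrier) simp_all
  have W: "W \<in> carrier_mat d d"
    unfolding W_def d_def by (rule kron_carrier[OF one_carrier_mat N])
  have Wt: "transpose_mat W = kron (1\<^sub>m (n - 1)) (kron (to_mat (transpose M)) (to_mat ?Mi))"
    by (simp add: W_def N_def transpose_kron to_mat_transpose)
  let ?W2 = "kron (1\<^sub>m (n - 1)) (kron (to_mat (transpose ?Mi)) (to_mat M))"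
  have W2: "?W2 \<in> carrier_mat d d"
    unfolding d_def power2_eq_square by (intro kron_carrier one_carrier_mat to_mat_carrier)
  have "transpose_mat W * ?W2 = kron (1\<^sub>m (n - 1)) (kron (to_mat (transpose M ** transpose ?Mi)) (to_mat (?Mi ** M)))"
    by (simp add: Wt kron_mult to_mat_mult)
  also have "transpose M ** transpose ?Mi = mat 1"
    by (simp add: matrix_transpose_mul[symmetric] matrix_inv_both[OF M])
  also have "?Mi ** M = mat 1" by (simp add: matrix_inv_both[OF M])
  finally have WW: "transpose_mat W * ?W2 = 1\<^sub>m d"
    by (simp add: to_mat_one kron_one d_def power2_eq_square)
  have Wtc: "transpose_mat W \<in> carrier_mat d d" using W by simp
  have "Q * (R * R2) = Q * R * R2" by (rule assoc_mult_mat[symmetric, OF Q R R2])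
  also have "\<dots> = transpose_mat W * (Q * R2)"
    unfolding QR[symmetric] Wt[symmetric] by (rule assoc_mult_mat[OF Wtc Q R2])
  also have "\<dots> = transpose_mat W * ?W2 * Q"
    unfolding QR2[symmetric] by (rule assoc_mult_mat[symmetric, OF Wtc W2 Q])
  also have "\<dots> = Q" unfolding WW using Q by simp
  finally have QRR: "Q * (R * R2) = Q" .
  let ?S = "shape_est n z"
  define V where "V = kron (1\<^sub>m (n - 1)) (kron (to_mat ?S) (to_mat (matrix_inv ?S)))"
  have V: "V \<in> carrier_mat d d"
    unfolding V_def d_def power2_eq_square by (intro kron_carrier one_carrier_mat to_mat_carrier)
  have J: "J_matrix Q n z = transpose_mat Q * V * Q" by (simp add: J_matrix_def V_def)
  have J': "J_matrix Q n (\<lambda>t. M *v z t) = transpose_mat Q * (W * V * transpose_mat W) * Q"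
  proof -
    obtain s where s: "s \<noteq> 0" "shape_est n (\<lambda>t. M *v z t) = s *\<^sub>R (M ** ?S ** transpose M)"
      "matrix_inv (shape_est n (\<lambda>t. M *v z t)) = inverse s *\<^sub>R (transpose ?Mi ** matrix_inv ?S ** ?Mi)"
      using rank_statistics_affine(2)[OF M ex1] by blast
    have "kron (to_mat (shape_est n (\<lambda>t. M *v z t))) (to_mat (matrix_inv (shape_est n (\<lambda>t. M *v z t))))
        = kron (to_mat (M ** ?S ** transpose M)) (to_mat (transpose ?Mi ** matrix_inv ?S ** ?Mi))"
      unfolding s(3) unfolding s(2) to_mat_scaleR kron_smult using s(1) by (intro eq_matI) simp_all
    then have "kron (1\<^sub>m (n - 1)) (kron (to_mat (shape_est n (\<lambda>t. M *v z t))) (to_mat (matrix_inv (shape_est n (\<lambda>t. M *v z t)))))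
        = W * V * transpose_mat W"
      unfolding W_def V_def N_def transpose_kron to_mat_transpose[symmetric]
      by (simp add: kron_mult to_mat_mult)
    then show ?thesis by (simp add: J_matrix_def)
  qed
  define s where "s = stacked_autocov K1 K2 n z"
  have s: "s \<in> carrier_vec d" by (simp add: s_def stacked_autocov_def block_vec_def d_def)
  have s': "stacked_autocov K1 K2 n (\<lambda>t. M *v z t) = W *\<^sub>v s"
  proof -
    have "vec_of (to_mat (rank_autocov K1 K2 n (\<lambda>t. M *v z t) i)) = N *\<^sub>v vec_of (to_mat (rank_autocov K1 K2 n z i))" for i
      unfolding rank_statistics_affine(1)[OF M ex1] to_mat_mult N_def
      by (subst vec_of_sandwich[of _ ?k]) (simp_all add: to_mat_transpose)
    then have "sqrt (real (n - i)) \<cdot>\<^sub>v vec_of (to_mat (rank_autocov K1 K2 n (\<lambda>t. M *v z t) i))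
        = N *\<^sub>v (sqrt (real (n - i)) \<cdot>\<^sub>v vec_of (to_mat (rank_autocov K1 K2 n z i)))" for i
      using mult_mat_vec[OF N carrier_vecI[OF vec_of_to_mat_dim], of _ "rank_autocov K1 K2 n z i"]
      by (simp only:)
    then show ?thesis
      unfolding s_def stacked_autocov_def W_def
      by (simp only:) (rule block_vec_kron[OF N], simp add: vec_of_to_mat_dim del: to_mat_dim vec_of_dim)
  qed
  note reparam = quadratic_form_reparam(1)[OF Q V W R R2 s QR[folded Wt] QRR inv[unfolded J]]
    quadratic_form_reparam(2)[OF Q V W R R2 s QR[folded Wt] QRR inv[unfolded J], of "1 / sqrt (real n)"]
  have "invertible_mat (J_matrix Q n (\<lambda>t. M *v z t))" unfolding J' by (rule reparam(1))
  then have "(\<lambda>t. M *v x t) \<in> Q_stat_domain A B p0 p1 q0 q1 Y n"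
    using n tyler_affine(1)[OF M ex1] by (simp add: Q_stat_domain_def z' Q_def)
  moreover have "Q_stat A B p0 p1 q0 q1 Y K1 K2 n (\<lambda>t. M *v x t) = Q_stat A B p0 p1 q0 q1 Y K1 K2 n x"
    unfolding Q_stat_def z' z_def[symmetric] Q_def[symmetric] quadratic_stat_def T_vector_def J J' s' s_def[symmetric]
    by (simp only: reparam(2))
  ultimately show "(\<lambda>t. M *v x t) \<in> Q_stat_domain A B p0 p1 q0 q1 Y n \<and>
      Q_stat A B p0 p1 q0 q1 Y K1 K2 n (\<lambda>t. M *v x t) = Q_stat A B p0 p1 q0 q1 Y K1 K2 n x" by blast
qed

section \<open>Moving-average weights and coprime factorizations\<close>

text \<open>The coefficients of the power series $A(z)^{-1} B(z)$, defined by the recursion obtained from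
  $A(z) \Psi(z) = B(z)$.\<close>
fun psi_weight :: "(nat \<Rightarrow> real^'k^'k) \<Rightarrow> (nat \<Rightarrow> real^'k^'k) \<Rightarrow> nat \<Rightarrow> nat \<Rightarrow> nat \<Rightarrow> real^'k^'k" where
  "psi_weight A B p q u = ma_coeff B q u
     + (\<Sum>i=1..p. if 0 < i \<and> i \<le> u then A i ** psi_weight A B p q (u - i) else 0)"

declare psi_weight.simps [simp del]

lemma coeff_mult_bounds:
  fixes p q :: "'a::comm_semiring_0 poly"
  assumes "degree p \<le> e" "degree q \<le> f"
  shows "coeff (p * q) (e + f) = coeff p e * coeff q f"
proof -
  have "coeff (p * q) (e + f) = (\<Sum>i\<le>e + f. coeff p i * coeff q (e + f - i))" by (rule coeff_mult)
  also have "\<dots> = (\<Sum>i\<in>{e}. coeff p i * coeff q (e + f - i))"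
  proof (intro sum.mono_neutral_right ballI)
    fix i assume "i \<in> {..e + f} - {e}"
    then have "degree p < i \<or> degree q < e + f - i" using assms by auto
    then show "coeff p i * coeff q (e + f - i) = 0" by (auto simp: coeff_eq_0)
  qed auto
  finally show ?thesis by simp
qed

text \<open>The product of the leading coefficient matrices is the coefficient of $T R$ at the sum of the
  degrees. It is nonzero since one factor is invertible, whereas $T R = I$ has no coefficient of positive
  degree.\<close>
lemma polynomial_matrix_regular_unit:
  fixes T R :: "real poly^'k^'k"
  assumes TR: "T ** R = mat 1" and deg: "\<And>r c. degree (T $ r $ c) \<le> e"
    and lead: "invertible (\<chi> r c. coeff (T $ r $ c) e)"
  shows "e = 0"
proof (rule ccontr)
  assume "e \<noteq> 0"
  define f where "f = Max (range (\<lambda>(r, c). degree (R $ r $ c)))"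
  have fin: "finite (range (\<lambda>(r, c). degree (R $ r $ c)))" by simp
  have degR: "degree (R $ r $ c) \<le> f" for r c
    unfolding f_def by (rule Max_ge[OF fin]) (auto intro: image_eqI[of _ _ "(r, c)"])
  have "f \<in> range (\<lambda>(r, c). degree (R $ r $ c))" unfolding f_def by (rule Max_in[OF fin]) auto
  then obtain r0 c0 where f: "f = degree (R $ r0 $ c0)" by auto
  let ?T = "\<chi> r c. coeff (T $ r $ c) e" and ?R = "\<chi> r c. coeff (R $ r $ c) f"
  have "(?T ** ?R) $ r $ c = coeff ((T ** R) $ r $ c) (e + f)" for r c
    by (simp add: matrix_matrix_mult_def coeff_sum coeff_mult_bounds[OF deg degR])
  also have "\<dots> r c = 0" for r c
    using \<open>e \<noteq> 0\<close> by (simp add: TR Finite_Cartesian_Product.mat_def coeff_1)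
  finally have "?T ** ?R = 0" by (simp add: Finite_Cartesian_Product.vec_eq_iff)
  then have "?R = 0" using matrix_inv_cancel_left(2)[OF lead, of ?R] by simp
  then have zero: "coeff (R $ r $ c) f = 0" for r c
    by (simp add: Finite_Cartesian_Product.vec_eq_iff)
  then have R0: "R $ r0 $ c0 = 0" using f by (metis leading_coeff_0_iff)
  then have "f = 0" using f by simp
  then have "R $ r $ c = 0" for r c using degR[of r c] zero[of r c] by (metis le_zero_eq leading_coeff_0_iff)
  then have "R = 0" by (simp add: Finite_Cartesian_Product.vec_eq_iff)
  then have "(mat 1 :: real poly^'k^'k) = 0" using TR by simp
  then have "(mat 1 :: real poly^'k^'k) $ r0 $ r0 = 0" by simp
  then show False by (simp add: Finite_Cartesian_Product.mat_def)
qed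

text \<open>The scalar series $S$ with $A S = B$ is a rational function $b/a$ in lowest terms, so $a$ divides
  every entry of $A$. The matrix $T = A/a = B/b$ is a common left divisor of $A$ and $B$, hence has a right
  inverse, and has invertible leading coefficient, hence is constant.\<close>
lemma scalar_psi_weights_imp_scalar_coefficients:
  fixes A B :: "nat \<Rightarrow> real^'k^'k"
  assumes asm: "assumption_A A B p q" and psi: "\<And>u. psi_weight A B p q u = s u *\<^sub>R mat 1"
  shows "\<exists>a b :: nat \<Rightarrow> real. (\<forall>i\<in>{1..p}. A i = a i *\<^sub>R mat 1) \<and> (\<forall>j\<in>{1..q}. B j = b j *\<^sub>R mat 1)"
proof -
  define S where "S = Abs_fps s"
  let ?P = "ar_poly A p" and ?Q = "ma_poly B q"
  have PS: "fps_of_poly (?P $ r $ c) * S = fps_of_poly (?Q $ r $ c)" for r c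
  proof (rule fps_ext)
    fix u
    have "coeff (?Q $ r $ c) u = ma_coeff B q u $ r $ c"
      by (auto simp: coeff_ma_poly ma_coeff_def Finite_Cartesian_Product.mat_def)
    also have "ma_coeff B q u = s u *\<^sub>R mat 1 - (\<Sum>i=1..p. if 0 < i \<and> i \<le> u then s (u - i) *\<^sub>R A i else 0)"
      using psi[of u] by (subst (asm) psi_weight.simps) (simp add: psi matrix_mult_scaleR algebra_simps cong: if_cong)
    also have "\<dots> $ r $ c = s u * of_bool (r = c) - (\<Sum>i=1..p. if i \<le> u then s (u - i) * A i $ r $ c else 0)"
    proof -
      have "(\<Sum>i=1..p. if 0 < i \<and> i \<le> u then s (u - i) *\<^sub>R A i else 0) $ r $ c = (\<Sum>i=1..p. if i \<le> u then s (u - i) * A i $ r $ c else 0)"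
        unfolding sum_nth2 by (intro sum.cong) auto
      then show ?thesis by (simp add: Finite_Cartesian_Product.mat_def)
    qed
    also have "(\<Sum>i=1..p. if i \<le> u then s (u - i) * A i $ r $ c else 0) = (\<Sum>i\<in>{1..u}. - (coeff (?P $ r $ c) i * s (u - i)))"
    proof -
      have "(\<Sum>i=1..p. if i \<le> u then s (u - i) * A i $ r $ c else 0) = (\<Sum>i\<in>{1..p} \<inter> {1..u}. s (u - i) * A i $ r $ c)"
        by (intro sum.mono_neutral_cong_right) auto
      also have "\<dots> = (\<Sum>i\<in>{1..u}. - (coeff (?P $ r $ c) i * s (u - i)))"
        by (intro sum.mono_neutral_cong_left) (auto simp: coeff_ar_poly)
      finally show ?thesis .
    qed
    also have "s u * of_bool (r = c) - (\<Sum>i\<in>{1..u}. - (coeff (?P $ r $ c) i * s (u - i))) = (\<Sum>i=0..u. coeff (?P $ r $ c) i * s (u - i))"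
      by (simp add: sum.atLeast_Suc_atMost[of 0 u] sum_negf coeff_ar_poly)
    finally show "fps_nth (fps_of_poly (?P $ r $ c) * S) u = fps_nth (fps_of_poly (?Q $ r $ c)) u"
      by (simp add: fps_mult_nth S_def)
  qed
  define o1 :: 'k where "o1 = undefined"
  define g where "g = gcd (?P $ o1 $ o1) (?Q $ o1 $ o1)"
  have c0: "coeff (?P $ o1 $ o1) 0 = 1" by (simp add: coeff_ar_poly)
  then have Pnz: "?P $ o1 $ o1 \<noteq> 0" by auto
  then have gnz: "g \<noteq> 0" by (simp add: g_def)
  obtain a b where ab: "?P $ o1 $ o1 = g * a" "?Q $ o1 $ o1 = g * b" "coprime a b"
    unfolding g_def using Pnz by (metis gcd_coprime_exists mult.commute gcd_eq_0_iff)
  have anz: "a \<noteq> 0" "coeff a 0 \<noteq> 0" using ab c0 by (auto simp: coeff_mult)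
  have "fps_of_poly g * (fps_of_poly a * S) = fps_of_poly g * fps_of_poly b"
    using PS[of o1 o1] by (simp add: ab fps_of_poly_mult mult.assoc)
  then have aS: "fps_of_poly a * S = fps_of_poly b" using gnz by simp
  \<comment> \<open>Cross multiplication in $P S = Q$ and $a S = b$.\<close>
  have cross: "?P $ r $ c * b = ?Q $ r $ c * a" for r c
  proof -
    have "fps_of_poly (?P $ r $ c * b) = fps_of_poly (?P $ r $ c) * S * fps_of_poly a"
      by (simp add: fps_of_poly_mult aS[symmetric] mult_ac)
    also have "\<dots> = fps_of_poly (?Q $ r $ c * a)" by (simp add: PS fps_of_poly_mult)
    finally show ?thesis by simp
  qed
  have "a dvd ?P $ r $ c" for r c
    using cross[of r c] ab(3) by (metis coprime_dvd_mult_left_iff dvd_triv_right)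
  then have Pdiv: "a * (?P $ r $ c div a) = ?P $ r $ c" for r c by simp
  define T where "T = (\<chi> r c. ?P $ r $ c div a)"
  have T: "?P $ r $ c = a * T $ r $ c" for r c by (simp add: T_def Pdiv)
  have T': "?Q $ r $ c = b * T $ r $ c" for r c
    using cross[of r c] anz by (simp add: T mult.commute mult.left_commute)
  have "left_divides T ?P" "left_divides T ?Q"
    unfolding left_divides_def
    by (intro exI[of _ "mat a"] exI[of _ "mat b"], simp add: Finite_Cartesian_Product.vec_eq_iff mult_mat_entry T T')+
  then have "left_divides T (mat 1)" using asm by (simp add: assumption_A_def is_gcld_def)
  then obtain R where TR: "T ** R = mat 1" unfolding left_divides_def by metis
  have degP: "degree (?P $ r $ c) \<le> p" for r c by (rule degree_le) (simp add: coeff_ar_poly)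
  have degT: "degree (T $ r $ c) = 0" for r c
  proof (cases "p = 0")
    case True
    then have "degree (a * T $ r $ c) = 0" using degP[of r c] by (simp add: T[symmetric])
    then show ?thesis using anz by (cases "T $ r $ c = 0") (auto simp: degree_mult_eq)
  next
    case False
    have iA: "invertible (A p)" using asm False by (simp add: assumption_A_def invertible_det_nz)
    have da: "degree a \<le> p"
    proof (rule ccontr)
      assume "\<not> degree a \<le> p"
      then have "?P $ r $ c = 0" for r c
        using degP[of r c] T[of r c] anz by (cases "T $ r $ c = 0") (auto simp: degree_mult_eq)
      then show False using Pnz by simp
    qed
    \<comment> \<open>The degree of \<open>T\<close> as a matrix polynomial; the coefficient there is proportional to the
      invertible matrix $A_p$.\<close>
    define e where "e = p - degree a"
    have le: "degree (T $ r $ c) \<le> e" for r c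
      using degP[of r c] anz unfolding T e_def by (cases "T $ r $ c = 0") (auto simp: degree_mult_eq)
    have "coeff (?P $ r $ c) p = lead_coeff a * coeff (T $ r $ c) e" for r c
      unfolding T using coeff_mult_bounds[OF order_refl le, of a r c] da by (simp add: e_def)
    then have "lead_coeff a * coeff (T $ r $ c) e = - A p $ r $ c" for r c
      using False by (simp add: coeff_ar_poly)
    then have "(\<chi> r c. coeff (T $ r $ c) e) = (- inverse (lead_coeff a)) *\<^sub>R A p"
      using anz by (simp add: Finite_Cartesian_Product.vec_eq_iff field_simps)
    moreover have "invertible ((- inverse (lead_coeff a)) *\<^sub>R A p)"
      using anz by (intro invertible_scaleR iA) simp
    ultimately have "e = 0" using polynomial_matrix_regular_unit[OF TR le] by simp
    then show ?thesis using le[of r c] by simp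
  qed
  have Tval: "T $ r $ c = [:of_bool (r = c) / coeff a 0:]" for r c
  proof -
    have "coeff (?P $ r $ c) 0 = coeff a 0 * coeff (T $ r $ c) 0" by (simp add: T coeff_mult)
    then have "coeff (T $ r $ c) 0 = of_bool (r = c) / coeff a 0"
      using anz by (simp add: coeff_ar_poly field_simps)
    then show ?thesis using degT[of r c] by (metis degree_0_id)
  qed
  show ?thesis
  proof (rule exI[of _ "\<lambda>i. - coeff a i / coeff a 0"], rule exI[of _ "\<lambda>j. coeff b j / coeff a 0"],
      intro conjI ballI)
    fix i assume i: "i \<in> {1..p}"
    have "- A i $ r $ c = coeff a i * of_bool (r = c) / coeff a 0" for r c
      using i coeff_ar_poly[of A p r c i] by (cases "r = c") (simp_all add: T Tval)
    then have "A i $ r $ c = - (coeff a i * of_bool (r = c) / coeff a 0)" for r c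
      by (metis minus_minus)
    then show "A i = (- coeff a i / coeff a 0) *\<^sub>R mat 1"
      by (simp add: Finite_Cartesian_Product.vec_eq_iff Finite_Cartesian_Product.mat_def)
  next
    fix j assume j: "j \<in> {1..q}"
    have "B j $ r $ c = coeff b j * of_bool (r = c) / coeff a 0" for r c
      using j coeff_ma_poly[of B q r c j] by (cases "r = c") (simp_all add: T' Tval)
    then show "B j = (coeff b j / coeff a 0) *\<^sub>R mat 1"
      by (simp add: Finite_Cartesian_Product.vec_eq_iff Finite_Cartesian_Product.mat_def)
  qed
qed

section \<open>Elliptical laws under linear maps\<close>

text \<open>Stated for $\sigma$-finite factors, so that it applies to error laws not yet known to have total mass one.\<close>
lemma distr_PiM_componentwise:
  assumes I: "finite I" and sf: "\<And>i. sigma_finite_measure (M i)"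
    and f: "\<And>i. f i \<in> M i \<rightarrow>\<^sub>M N i" and sf': "\<And>i. sigma_finite_measure (distr (M i) (N i) (f i))"
  shows "distr (PiM I M) (PiM I N) (\<lambda>x. \<lambda>i\<in>I. f i (x i)) = PiM I (\<lambda>i. distr (M i) (N i) (f i))"
proof -
  interpret P: product_sigma_finite M using sf by (simp add: product_sigma_finite_def)
  interpret D: product_sigma_finite "\<lambda>i. distr (M i) (N i) (f i)" using sf' by (simp add: product_sigma_finite_def)
  have meas: "(\<lambda>x. \<lambda>i\<in>I. f i (x i)) \<in> PiM I M \<rightarrow>\<^sub>M PiM I N"
    using f by (intro measurable_restrict measurable_compose[OF measurable_component_singleton]) auto
  show ?thesis
  proof (rule D.PiM_eqI[OF I])
    show "sets (distr (PiM I M) (PiM I N) (\<lambda>x. \<lambda>i\<in>I. f i (x i))) = sets (PiM I (\<lambda>i. distr (M i) (N i) (f i)))"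
      by (simp cong: sets_PiM_cong)
    fix A assume "\<And>i. i \<in> I \<Longrightarrow> A i \<in> sets (distr (M i) (N i) (f i))"
    then have A: "\<And>i. i \<in> I \<Longrightarrow> A i \<in> sets (N i)" by simp
    have "(\<lambda>x. \<lambda>i\<in>I. f i (x i)) -` Pi\<^sub>E I A \<inter> space (PiM I M) = Pi\<^sub>E I (\<lambda>i. f i -` A i \<inter> space (M i))"
      by (auto simp: space_PiM PiE_iff extensional_def)
    then have "emeasure (distr (PiM I M) (PiM I N) (\<lambda>x. \<lambda>i\<in>I. f i (x i))) (Pi\<^sub>E I A)
        = emeasure (PiM I M) (Pi\<^sub>E I (\<lambda>i. f i -` A i \<inter> space (M i)))"
      using A I by (subst emeasure_distr[OF meas]) (auto intro: sets_PiM_I_finite)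
    also have "\<dots> = (\<Prod>i\<in>I. emeasure (M i) (f i -` A i \<inter> space (M i)))"
      using A f I by (intro P.emeasure_PiM) (auto intro: measurable_sets)
    also have "\<dots> = (\<Prod>i\<in>I. emeasure (distr (M i) (N i) (f i)) (A i))"
      using A f by (intro prod.cong refl) (simp add: emeasure_distr)
    finally show "emeasure (distr (PiM I M) (PiM I N) (\<lambda>x. \<lambda>i\<in>I. f i (x i))) (Pi\<^sub>E I A)
        = (\<Prod>i\<in>I. emeasure (distr (M i) (N i) (f i)) (A i))" .
  qed
qed

lemma matrix_vector_borel_measurable[measurable]: "(\<lambda>x. (M :: real^'n^'m) *v x) \<in> borel_measurable borel"
  by (intro borel_measurable_continuous_onI matrix_vector_mult_linear_continuous_on)

text \<open>Both sides agree on boxes, where this is the formula for the Lebesgue measure of a linear image.\<close>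
lemma lborel_linear_image:
  fixes M :: "real^'n::{finite,wellorder}^'n::_"
  assumes M: "invertible M"
  shows "lborel = density (distr lborel borel (\<lambda>x. M *v x)) (\<lambda>_. ennreal \<bar>det M\<bar>)"
proof (rule lborel_eqI)
  let ?Mi = "matrix_inv M"
  fix l u :: "real^'n::_" assume lu: "\<And>b. b \<in> Basis \<Longrightarrow> l \<bullet> b \<le> u \<bullet> b"
  have lin: "linear (\<lambda>x. ?Mi *v x)" by simp
  have img: "(\<lambda>x. M *v x) -` box l u = (\<lambda>x. ?Mi *v x) ` box l u"
    using matrix_inv_cancel_vec[OF M] by (auto simp: image_iff) metis
  have lm: "(\<lambda>x. ?Mi *v x) ` box l u \<in> lmeasurable"
    by (rule measurable_linear_image[OF lin]) simp
  have borel: "(\<lambda>x. M *v x) -` box l u \<in> sets borel"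
    using measurable_sets[OF matrix_vector_borel_measurable[of M], of "box l u"] by simp
  have "emeasure lborel ((\<lambda>x. M *v x) -` box l u) = emeasure lebesgue ((\<lambda>x. ?Mi *v x) ` box l u)"
    using borel by (simp add: img)
  also have "\<dots> = ennreal (measure lebesgue ((\<lambda>x. ?Mi *v x) ` box l u))"
    using lm by (simp add: emeasure_eq_measure2)
  also have "measure lebesgue ((\<lambda>x. ?Mi *v x) ` box l u) = \<bar>det ?Mi\<bar> * measure lebesgue (box l u)"
    by (subst measure_linear_image[OF lin]) simp_all
  also have "measure lebesgue (box l u) = (\<Prod>b\<in>Basis. (u - l) \<bullet> b)"
    using lu by (simp add: measure_lborel_box_eq)
  finally have e: "emeasure lborel ((\<lambda>x. M *v x) -` box l u) = ennreal (\<bar>det ?Mi\<bar> * (\<Prod>b\<in>Basis. (u - l) \<bullet> b))" .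
  have "det M * det ?Mi = 1"
    using matrix_inv_both(1)[OF M] by (metis det_I det_mul)
  then have dd: "\<bar>det M\<bar> * \<bar>det ?Mi\<bar> = 1" by (simp add: abs_mult[symmetric])
  have "emeasure (density (distr lborel borel (\<lambda>x. M *v x)) (\<lambda>_. ennreal \<bar>det M\<bar>)) (box l u)
      = ennreal \<bar>det M\<bar> * emeasure lborel ((\<lambda>x. M *v x) -` box l u)"
    by (simp add: emeasure_density_const emeasure_distr)
  also have "\<dots> = ennreal (\<bar>det M\<bar> * (\<bar>det ?Mi\<bar> * (\<Prod>b\<in>Basis. (u - l) \<bullet> b)))"
    by (simp add: e ennreal_mult')
  also have "\<bar>det M\<bar> * (\<bar>det ?Mi\<bar> * (\<Prod>b\<in>Basis. (u - l) \<bullet> b)) = (\<Prod>b\<in>Basis. (u - l) \<bullet> b)"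
    using dd by (simp add: mult.assoc[symmetric])
  finally show "emeasure (density (distr lborel borel (\<lambda>x. M *v x)) (\<lambda>_. ennreal \<bar>det M\<bar>)) (box l u)
    = ennreal (\<Prod>b\<in>Basis. (u - l) \<bullet> b)" .
qed simp

lemma density_linear_image:
  fixes M :: "real^'n::{finite,wellorder}^'n::_"
  assumes M: "invertible M" and [measurable]: "g \<in> borel_measurable borel"
  shows "distr (density lborel (\<lambda>x. ennreal \<bar>det M\<bar> * g (M *v x))) borel (\<lambda>x. M *v x) = density lborel g"
proof -
  have "density lborel g = density (density (distr lborel borel (\<lambda>x. M *v x)) (\<lambda>_. ennreal \<bar>det M\<bar>)) g"
    using lborel_linear_image[OF M] by simp
  also have "\<dots> = density (distr lborel borel (\<lambda>x. M *v x)) (\<lambda>x. ennreal \<bar>det M\<bar> * g x)"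
    by (rule density_density_eq) auto
  also have "\<dots> = distr (density lborel (\<lambda>x. ennreal \<bar>det M\<bar> * g (M *v x))) borel (\<lambda>x. M *v x)"
    by (rule density_distr) auto
  finally show ?thesis ..
qed

lemma pos_def_invertible:
  assumes "pos_def S"
  shows "invertible S"
proof -
  have "x = 0" if "S *v x = 0" for x using assms that by (auto simp: pos_def_def)
  then show ?thesis using matrix_left_invertible_ker[of S] by (simp add: invertible_left_inverse)
qed

lemma pos_def_inverse_nonneg:
  assumes S: "pos_def S"
  shows "z \<bullet> (matrix_inv S *v z) \<ge> 0"
proof -
  let ?w = "matrix_inv S *v z"
  have "z = S *v ?w" by (simp add: matrix_inv_cancel_vec pos_def_invertible[OF S])
  then have "z \<bullet> ?w = ?w \<bullet> (S *v ?w)" by (metis inner_commute)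
  also have "\<dots> \<ge> 0" using S by (cases "?w = 0") (auto simp: pos_def_def intro: less_imp_le)
  finally show ?thesis .
qed

lemma pos_def_congruence:
  fixes M S :: "real^'n^'n"
  assumes M: "invertible M" and S: "pos_def S"
  shows "pos_def (M ** S ** transpose M)"
  unfolding pos_def_def
proof (intro conjI allI impI)
  show "transpose (M ** S ** transpose M) = M ** S ** transpose M"
    using S by (simp add: pos_def_def matrix_transpose_mul matrix_mul_assoc)
  fix v :: "real^'n" assume v: "v \<noteq> 0"
  have "transpose M *v v \<noteq> 0"
  proof
    assume "transpose M *v v = 0"
    then have "matrix_inv (transpose M) *v (transpose M *v v) = 0"
      by (simp del: transpose_matrix_vector)
    then show False using v matrix_inv_cancel_vec(2)[OF invertible_transpose[OF M], of v] by simp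
  qed
  then have "(transpose M *v v) \<bullet> (S *v (transpose M *v v)) > 0" using S by (simp add: pos_def_def)
  also have "(transpose M *v v) \<bullet> (S *v (transpose M *v v)) = v \<bullet> (M ** S ** transpose M *v v)"
    by (simp add: matrix_vector_mul_assoc[symmetric] dot_lmul_matrix[symmetric] transpose_matrix_vector)
  finally show "v \<bullet> (M ** S ** transpose M *v v) > 0" .
qed

text \<open>Integrability of $r^{k-1} f(r)$ makes $f$ measurable on the open half-line, and the argument of $f$
  is never negative.\<close>
lemma elliptical_density_measurable:
  fixes S :: "real^'k^'k"
  assumes S: "pos_def S" and f: "radial_density CARD('k) f"
  shows "elliptical_density S f \<in> borel_measurable borel"
proof -
  define F where "F r = indicator {0<..} r *\<^sub>R (r ^ (CARD('k) - 1) * f r)" for r :: real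
  have [measurable]: "F \<in> borel_measurable borel"
    using f unfolding radial_density_def set_integrable_def F_def by (auto dest: borel_measurable_integrable)
  \<comment> \<open>A measurable function that agrees with \<open>f\<close> on $[0,\infty)$.\<close>
  define h where "h r = (if r > 0 then F r / r ^ (CARD('k) - 1) else f 0)" for r :: real
  have [measurable]: "h \<in> borel_measurable borel" unfolding h_def by measurable
  have "f r = h r" if "r \<ge> 0" for r using that by (auto simp: h_def F_def)
  then have "elliptical_density S f = (\<lambda>z. 1 / (LINT y|(lborel :: (real^'k) measure). f (norm y))
       * (1 / sqrt (det S)) * h (sqrt (z \<bullet> (matrix_inv S *v z))))"
    using pos_def_inverse_nonneg[OF S] by (simp add: fun_eq_iff elliptical_density_def)
  also have "\<dots> \<in> borel_measurable borel" by measurable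
  finally show ?thesis .
qed

text \<open>The normalizing constant depends on $f$ only and so is the same on both sides.\<close>
lemma elliptical_density_congruence:
  fixes M S :: "real^'k^'k"
  assumes M: "invertible M" and S: "pos_def S"
  shows "\<bar>det M\<bar> * elliptical_density (M ** S ** transpose M) f (M *v z) = elliptical_density S f z"
proof -
  note iS = pos_def_invertible[OF S]
  have "matrix_inv (M ** S ** transpose M) = transpose (matrix_inv M) ** (matrix_inv S ** matrix_inv M)"
    by (simp add: matrix_inv_mult M iS invertible_mult invertible_transpose matrix_inv_transpose)
  then have q: "(M *v z) \<bullet> (matrix_inv (M ** S ** transpose M) *v (M *v z)) = z \<bullet> (matrix_inv S *v z)"
    by (simp add: matrix_vector_mul_assoc[symmetric] matrix_inv_cancel_vec[OF M] transpose_matrix_vector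
        dot_lmul_matrix[symmetric] inner_commute[of _ "_ v* _"] del: transpose_matrix_vector)
  have "det (M ** S ** transpose M) = (det M)\<^sup>2 * det S" by (simp add: det_mul power2_eq_square)
  then have "sqrt (det (M ** S ** transpose M)) = \<bar>det M\<bar> * sqrt (det S)" by (simp add: real_sqrt_mult)
  moreover have "det M \<noteq> 0" using M by (simp add: invertible_det_nz)
  ultimately show ?thesis by (simp add: elliptical_density_def q)
qed

abbreviation error_law :: "real^'k^'k \<Rightarrow> (real \<Rightarrow> real) \<Rightarrow> (real^'k) measure" where
  "error_law S f \<equiv> density lborel (\<lambda>z. ennreal (elliptical_density S f z))"

lemma sigma_finite_error_law:
  fixes S :: "real^'k^'k"
  assumes S: "pos_def S" and f: "radial_density CARD('k) f"
  shows "sigma_finite_measure (error_law S f)"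
  using elliptical_density_measurable[OF assms]
  by (subst sigma_finite_measure.sigma_finite_iff_density_finite[OF sigma_finite_lborel]) auto

lemma error_law_linear_image:
  fixes M S :: "real^'k::{finite,wellorder}^'k::_"
  assumes M: "invertible M" and S: "pos_def S" and f: "radial_density CARD('k) f"
  shows "distr (error_law S f) borel (\<lambda>x. M *v x) = error_law (M ** S ** transpose M) f"
proof -
  have [measurable]: "elliptical_density (M ** S ** transpose M) f \<in> borel_measurable borel"
    by (rule elliptical_density_measurable[OF pos_def_congruence[OF M S] f])
  show ?thesis
    using density_linear_image[OF M, of "\<lambda>z. ennreal (elliptical_density (M ** S ** transpose M) f z)"]
    by (simp add: ennreal_mult'[symmetric] elliptical_density_congruence[OF M S])
qed

lemma innovation_law_linear_image:
  fixes M S :: "real^'k::{finite,wellorder}^'k::_"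
  assumes M: "invertible M" and S: "pos_def S" and f: "radial_density CARD('k) f"
  shows "distr (innovation_law n S f) (PiM {1..n} (\<lambda>_. borel)) (\<lambda>x. \<lambda>t\<in>{1..n}. M *v x t)
     = innovation_law n (M ** S ** transpose M) f"
  unfolding innovation_law_def error_law_linear_image[OF assms, symmetric]
  by (rule distr_PiM_componentwise)
    (auto simp: error_law_linear_image[OF assms]
      intro!: sigma_finite_error_law assms pos_def_congruence)

lemma sets_innovation_law: "sets (innovation_law n S f) = sets (PiM {1..n} (\<lambda>_. borel))"
  unfolding innovation_law_def by (simp cong: sets_PiM_cong)

lemma space_innovation_law: "space (innovation_law n S f) = {1..n} \<rightarrow>\<^sub>E UNIV"
  unfolding innovation_law_def by (simp add: space_PiM)

section \<open>The null hypothesis under linear maps\<close>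

lemma varma_eq_iff_innovation: "varma_eq A B p q n x e \<longleftrightarrow> (\<forall>t\<in>{1..n}. e t = x t - (\<Sum>i=1..p. A i *v lag x t i) - (\<Sum>i=1..q. B i *v lag e t i))"
  unfolding varma_eq_def by (intro ball_cong refl) (auto simp: algebra_simps)

lemma varma_eq_cong:
  assumes "\<And>t. t \<in> {1..n} \<Longrightarrow> x t = x' t" "\<And>t. t \<in> {1..n} \<Longrightarrow> e t = e' t"
  shows "varma_eq A B p q n x e \<longleftrightarrow> varma_eq A B p q n x' e'"
proof -
  have "lag x t i = lag x' t i" "lag e t i = lag e' t i" if "t \<in> {1..n}" for t i
  proof -
    have "t - i \<in> {1..n}" if "i < t" using that \<open>t \<in> {1..n}\<close> by auto
    then show "lag x t i = lag x' t i" "lag e t i = lag e' t i"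
      using assms(1)[of "t - i"] assms(2)[of "t - i"] by (simp_all add: lag_def)
  qed
  then show ?thesis unfolding varma_eq_def using assms by (intro ball_cong refl) simp
qed

lemma varma_eq_residual:
  assumes "varma_eq A B p q n x e" and "t \<in> {1..n}"
  shows "e t = residual A B p q x t"
  using assms(2)
proof (induction t rule: less_induct)
  case (less t)
  have "lag e t i = (if 0 < i \<and> i < t then residual A B p q x (t - i) else 0)" if "i \<in> {1..q}" for i
  proof -
    have "t - i \<in> {1..n}" "t - i < t" if "i < t" using that less.prems \<open>i \<in> {1..q}\<close> by auto
    then show ?thesis using that less.IH[of "t - i"] by (simp add: lag_def)
  qed
  then have "(\<Sum>i=1..q. B i *v lag e t i)
     = (\<Sum>i=1..q. B i *v (if 0 < i \<and> i < t then residual A B p q x (t - i) else 0))"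
    by (intro sum.cong) auto
  then show ?case
    using assms(1) less.prems by (subst residual.simps) (simp add: varma_eq_iff_innovation)
qed

lemma residual_measurable:
  "t \<in> {1..n} \<Longrightarrow> (\<lambda>x. residual A B p q x t :: real^'k) \<in> borel_measurable (PiM {1..n} (\<lambda>_. borel))"
proof (induction t rule: less_induct)
  case (less t)
  have [measurable]: "(\<lambda>x :: nat \<Rightarrow> real^'k. x s) \<in> borel_measurable (PiM {1..n} (\<lambda>_. borel))" if "s \<in> {1..n}" for s
    using that by (rule measurable_component_singleton)
  have "(\<lambda>x. lag x t i :: real^'k) \<in> borel_measurable (PiM {1..n} (\<lambda>_. borel))" if "i \<in> {1..p}" for i
    using less.prems that by (cases "i < t") (auto simp: lag_def intro!: measurable_component_singleton)
  moreover have "(\<lambda>x. if 0 < i \<and> i < t then residual A B p q x (t - i) else 0 :: real^'k)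
      \<in> borel_measurable (PiM {1..n} (\<lambda>_. borel))" if "i \<in> {1..q}" for i
    using less that by (cases "i < t") auto
  moreover have "(\<lambda>x :: nat \<Rightarrow> real^'k. x t) \<in> borel_measurable (PiM {1..n} (\<lambda>_. borel))"
    using less.prems by (rule measurable_component_singleton)
  ultimately show ?case
    by (subst residual.simps)
       (intro borel_measurable_diff borel_measurable_sum measurable_compose[OF _ matrix_vector_borel_measurable])
qed

definition psi_series :: "(nat \<Rightarrow> real^'k^'k) \<Rightarrow> (nat \<Rightarrow> real^'k^'k) \<Rightarrow> nat \<Rightarrow> nat \<Rightarrow> (nat \<Rightarrow> real^'k) \<Rightarrow> nat \<Rightarrow> real^'k" where
  "psi_series A B p q e t = (\<Sum>u<t. psi_weight A B p q u *v e (t - u))"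

lemma matrix_sum_vector: "(\<Sum>i\<in>S. F i) *v (x :: real^'k) = (\<Sum>i\<in>S. F i *v x)"
  by (induction S rule: infinite_finite_induct) (auto simp: matrix_vector_mult_add_rdistrib)

text \<open>Inserting the recursion for the weights into the series reproduces the lagged values of the
  series itself (autoregressive part) and of the innovations (moving average part).\<close>
lemma varma_eq_psi_series: "varma_eq A B p q n (psi_series A B p q e) e"
  unfolding varma_eq_def
proof
  fix t assume t: "t \<in> {1..n}"
  let ?w = "psi_weight A B p q" and ?x = "psi_series A B p q e"
  have "?x t = (\<Sum>u<t. ma_coeff B q u *v e (t - u)) + (\<Sum>u<t. \<Sum>i=1..p. (if 0 < i \<and> i \<le> u then A i ** ?w (u - i) else 0) *v e (t - u))"
    unfolding psi_series_def by (subst psi_weight.simps) (simp only: matrix_vector_mult_add_rdistrib matrix_sum_vector sum.distrib)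
  also have "(\<Sum>u<t. \<Sum>i=1..p. (if 0 < i \<and> i \<le> u then A i ** ?w (u - i) else 0) *v e (t - u)) = (\<Sum>i=1..p. A i *v lag ?x t i)"
  proof (subst sum.swap, intro sum.cong refl)
    fix i assume i: "i \<in> {1..p}"
    have "(\<Sum>u<t. (if 0 < i \<and> i \<le> u then A i ** ?w (u - i) else 0) *v e (t - u)) = (\<Sum>u\<in>{i..<t}. A i *v (?w (u - i) *v e (t - u)))"
      using i by (intro sum.mono_neutral_cong_right) (auto simp: matrix_vector_mul_assoc)
    also have "\<dots> = (\<Sum>v<t - i. A i *v (?w v *v e (t - i - v)))"
      by (rule sum.reindex_bij_witness[of _ "\<lambda>v. v + i" "\<lambda>u. u - i"]) auto
    also have "\<dots> = A i *v lag ?x t i" by (simp add: lag_def psi_series_def vec.sum)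
    finally show "(\<Sum>u<t. (if 0 < i \<and> i \<le> u then A i ** ?w (u - i) else 0) *v e (t - u)) = A i *v lag ?x t i" .
  qed
  also have "(\<Sum>u<t. ma_coeff B q u *v e (t - u)) = e t + (\<Sum>i=1..q. B i *v lag e t i)"
  proof -
    have "{..<t} = insert 0 {1..<t}" using t by auto
    then have "(\<Sum>u<t. ma_coeff B q u *v e (t - u)) = e t + (\<Sum>u\<in>{1..<t}. ma_coeff B q u *v e (t - u))"
      by (simp add: ma_coeff_def)
    also have "(\<Sum>u\<in>{1..<t}. ma_coeff B q u *v e (t - u)) = (\<Sum>u\<in>{1..<t} \<inter> {1..q}. B u *v lag e t u)"
      by (intro sum.mono_neutral_cong_right) (auto simp: ma_coeff_def lag_def)
    also have "\<dots> = (\<Sum>i=1..q. B i *v lag e t i)"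
      by (intro sum.mono_neutral_left) (auto simp: lag_def)
    finally show ?thesis .
  qed
  finally show "?x t - (\<Sum>i=1..p. A i *v lag ?x t i) = e t + (\<Sum>i=1..q. B i *v lag e t i)" by simp
qed

lemma psi_series_measurable:
  "(\<lambda>e. \<lambda>t\<in>{1..n}. psi_series A B p q e t :: real^'k) \<in> PiM {1..n} (\<lambda>_. borel) \<rightarrow>\<^sub>M PiM {1..n} (\<lambda>_. borel)"
proof (rule measurable_restrict)
  fix t assume "t \<in> {1..n}"
  then show "(\<lambda>e. psi_series A B p q e t :: real^'k) \<in> borel_measurable (PiM {1..n} (\<lambda>_. borel))"
    unfolding psi_series_def
    by (intro borel_measurable_sum measurable_compose[OF _ matrix_vector_borel_measurable] measurable_component_singleton) auto
qed

lemma scalar_varma_eq_linear: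
  assumes A: "\<And>i. i \<in> {1..p} \<Longrightarrow> A i = a i *\<^sub>R mat 1" and B: "\<And>j. j \<in> {1..q} \<Longrightarrow> B j = b j *\<^sub>R mat 1"
    and eq: "varma_eq A B p q n x e"
  shows "varma_eq A B p q n (\<lambda>t. M *v x t) (\<lambda>t. (M :: real^'k^'k) *v e t)"
proof -
  have ar: "(\<Sum>i=1..p. A i *v lag (\<lambda>t. M *v x t) t i) = M *v (\<Sum>i=1..p. A i *v lag x t i)" for t
    unfolding vec.sum by (intro sum.cong refl) (simp add: A lag_def scalar_matrix_commutes)
  have ma: "(\<Sum>i=1..q. B i *v lag (\<lambda>t. M *v e t) t i) = M *v (\<Sum>i=1..q. B i *v lag e t i)" for t
    unfolding vec.sum by (intro sum.cong refl) (simp add: B lag_def scalar_matrix_commutes)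
  show ?thesis
    using eq unfolding varma_eq_def ar ma
    by (simp add: matrix_vector_mult_diff_distrib[symmetric] matrix_vector_right_distrib[symmetric])
qed

abbreviation apply_each :: "nat \<Rightarrow> real^'k^'k \<Rightarrow> (nat \<Rightarrow> real^'k) \<Rightarrow> nat \<Rightarrow> real^'k" where
  "apply_each n M \<equiv> \<lambda>x. \<lambda>t\<in>{1..n}. M *v x t"

lemma apply_each_measurable: "apply_each n M \<in> PiM {1..n} (\<lambda>_. borel) \<rightarrow>\<^sub>M PiM {1..n} (\<lambda>_. borel)"
proof (rule measurable_restrict)
  fix t assume "t \<in> {1..n}"
  then show "(\<lambda>x. M *v x t) \<in> borel_measurable (PiM {1..n} (\<lambda>_. borel))"
    by (intro measurable_compose[OF _ matrix_vector_borel_measurable] measurable_component_singleton)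
qed

text \<open>A series $X$ driven by $e$ yields the series $M X(M^{-1} e')$ driven by $e' = M e$, whose law is
  elliptical with shape $M S M'$.\<close>
lemma null_hyp_linear_image_mem:
  fixes A B :: "nat \<Rightarrow> real^'k::{finite,wellorder}^'k::_"
  assumes A: "\<And>i. i \<in> {1..p} \<Longrightarrow> A i = a i *\<^sub>R mat 1" and B: "\<And>j. j \<in> {1..q} \<Longrightarrow> B j = b j *\<^sub>R mat 1"
    and M: "invertible M" and L: "L \<in> null_hyp A B p q n"
  shows "distr L (PiM {1..n} (\<lambda>_. borel)) (apply_each n M) \<in> null_hyp A B p q n"
proof -
  let ?Pi = "PiM {1..n} (\<lambda>_. borel :: (real^'k::_) measure)" and ?Mi = "matrix_inv M"
  from L obtain S f X where S: "pos_def S" and f: "radial_density CARD('k) f"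
    and X: "X \<in> innovation_law n S f \<rightarrow>\<^sub>M ?Pi"
    and eq: "\<And>e. e \<in> space (innovation_law n S f) \<Longrightarrow> varma_eq A B p q n (X e) e"
    and L_def: "L = distr (innovation_law n S f) ?Pi X"
    by (auto simp: null_hyp_def null_hyp_at_def)
  let ?S' = "M ** S ** transpose M"
  note S' = pos_def_congruence[OF M S]
  define X' where "X' e = apply_each n M (X (apply_each n ?Mi e))" for e
  have X1: "X \<in> ?Pi \<rightarrow>\<^sub>M ?Pi" using X by (simp add: measurable_cong_sets[OF sets_innovation_law refl])
  have X'm: "X' \<in> ?Pi \<rightarrow>\<^sub>M ?Pi"
    unfolding X'_def by (intro measurable_compose[OF apply_each_measurable] measurable_compose[OF X1] apply_each_measurable)
  have X'eq: "varma_eq A B p q n (X' e) e" if "e \<in> space (innovation_law n ?S' f)" for e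
  proof -
    have "apply_each n ?Mi e \<in> space (innovation_law n S f)" by (auto simp: space_innovation_law)
    from scalar_varma_eq_linear[OF A B eq[OF this]]
    have "varma_eq A B p q n (\<lambda>t. M *v X (apply_each n ?Mi e) t) (\<lambda>t. M *v apply_each n ?Mi e t)" .
    then show ?thesis
      by (subst (asm) varma_eq_cong[where x' = "X' e" and e' = e]) (auto simp: X'_def matrix_inv_cancel_vec[OF M])
  qed
  have "distr L ?Pi (apply_each n M) = distr (innovation_law n S f) ?Pi (apply_each n M \<circ> X)"
    unfolding L_def by (rule distr_distr[OF apply_each_measurable X])
  also have "\<dots> = distr (innovation_law n S f) ?Pi (X' \<circ> apply_each n M)"
  proof (rule distr_cong[OF refl refl])
    fix e assume "e \<in> space (innovation_law n S f)"
    then have "apply_each n ?Mi (apply_each n M e) = e"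
      by (auto simp: space_innovation_law fun_eq_iff matrix_inv_cancel_vec[OF M] PiE_iff extensional_def)
    then show "(apply_each n M \<circ> X) e = (X' \<circ> apply_each n M) e" by (simp add: X'_def)
  qed
  also have "\<dots> = distr (distr (innovation_law n S f) ?Pi (apply_each n M)) ?Pi X'"
    by (rule distr_distr[symmetric, OF X'm]) (simp add: measurable_cong_sets[OF sets_innovation_law refl] apply_each_measurable)
  also have "distr (innovation_law n S f) ?Pi (apply_each n M) = innovation_law n ?S' f"
    by (rule innovation_law_linear_image[OF M S f])
  finally have "distr L ?Pi (apply_each n M) \<in> null_hyp_at A B p q n ?S' f"
    unfolding null_hyp_at_def mem_Collect_eq
  proof (intro exI[of _ X'] conjI ballI)
    show "X' \<in> innovation_law n ?S' f \<rightarrow>\<^sub>M ?Pi"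
      using X'm by (simp only: measurable_cong_sets[OF sets_innovation_law refl])
  qed (assumption | erule X'eq)+
  then show ?thesis using S' f unfolding null_hyp_def by blast
qed

text \<open>One inclusion for $M$ and for $M^{-1}$ gives equality.\<close>
lemma scalar_imp_null_hyp_affine_invariant:
  fixes A B :: "nat \<Rightarrow> real^'k::{finite,wellorder}^'k::_"
  assumes A: "\<And>i. i \<in> {1..p} \<Longrightarrow> A i = a i *\<^sub>R mat 1" and B: "\<And>j. j \<in> {1..q} \<Longrightarrow> B j = b j *\<^sub>R mat 1"
  shows "null_hyp_affine_invariant A B p q"
  unfolding null_hyp_affine_invariant_def
proof (intro allI impI)
  fix M :: "real^'k::_^'k::_" and n :: nat assume M: "invertible M"
  let ?Pi = "PiM {1..n} (\<lambda>_. borel :: (real^'k::_) measure)" and ?Mi = "matrix_inv M"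
  let ?T = "\<lambda>P. distr P ?Pi (apply_each n M)"
  have mem: "distr L ?Pi (apply_each n M) \<in> null_hyp A B p q n"
    if "invertible M" "L \<in> null_hyp A B p q n" for L and M :: "real^'k::_^'k::_"
    using A B that by (rule null_hyp_linear_image_mem)
  show "?T ` null_hyp A B p q n = null_hyp A B p q n"
  proof (intro equalityI subsetI)
    fix L assume "L \<in> ?T ` null_hyp A B p q n"
    then show "L \<in> null_hyp A B p q n" using mem[OF M] by blast
  next
    fix L assume L: "L \<in> null_hyp A B p q n"
    then have sets: "sets L = sets ?Pi" and space: "space L = space ?Pi"
      by (auto simp: null_hyp_def null_hyp_at_def)
    have "?T (distr L ?Pi (apply_each n ?Mi)) = distr L ?Pi (apply_each n M \<circ> apply_each n ?Mi)"
      by (rule distr_distr[OF apply_each_measurable]) (simp add: measurable_cong_sets[OF sets refl] apply_each_measurable)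
    also have "\<dots> = distr L L id"
    proof (rule distr_cong[OF refl])
      show "sets ?Pi = sets L" using sets by simp
      fix x assume "x \<in> space L"
      then show "(apply_each n M \<circ> apply_each n ?Mi) x = id x"
        by (auto simp: space space_PiM fun_eq_iff matrix_inv_cancel_vec[OF M] PiE_iff extensional_def)
    qed
    also have "\<dots> = L" by (simp add: id_def)
    finally have "L = ?T (distr L ?Pi (apply_each n ?Mi))" by simp
    moreover have "distr L ?Pi (apply_each n ?Mi) \<in> null_hyp A B p q n"
      by (rule mem[OF invertible_matrix_inv[OF M] L])
    ultimately show "L \<in> ?T ` null_hyp A B p q n" by blast
  qed
qed

section \<open>Gaussian innovations\<close>

text \<open>The radial function of the standard normal law on $R^k$, for every $k$.\<close>
definition gauss :: "real \<Rightarrow> real" where "gauss r = exp (- r\<^sup>2 / 2)"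

lemma gauss_radial: "radial_density k gauss"
  unfolding radial_density_def set_integrable_def
proof (intro conjI allI impI)
  have "integrable lborel (\<lambda>r::real. sqrt (2 * pi) * (std_normal_density r * r ^ (k - 1)))"
    by (intro integrable_mult_right integrable_std_normal_moment)
  moreover have "(\<lambda>r::real. sqrt (2 * pi) * (std_normal_density r * r ^ (k - 1))) = (\<lambda>r. r ^ (k - 1) * gauss r)"
    by (simp add: fun_eq_iff std_normal_density_def gauss_def)
  ultimately have "integrable lborel (\<lambda>r::real. r ^ (k - 1) * gauss r)" by (simp only:)
  then have "integrable lborel (\<lambda>r::real. indicator {0<..} r *\<^sub>R (r ^ (k - 1) * gauss r))"
    by (intro integrable_mult_indicator) auto
  then show "integrable lborel (\<lambda>r::real. indicator {0<..} r *\<^sub>R (r ^ (k - 1) * gauss r))" .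
qed (simp_all add: gauss_def)

lemma gauss_product:
  fixes z :: "'a::euclidean_space"
  shows "gauss (norm z) = sqrt (2 * pi) ^ DIM('a) * (\<Prod>b\<in>Basis. std_normal_density (z \<bullet> b))"
proof -
  have "(norm z)\<^sup>2 = (\<Sum>b\<in>Basis. (z \<bullet> b)\<^sup>2)"
    unfolding power2_norm_eq_inner using euclidean_inner[of z z] by (simp add: power2_eq_square)
  then have "gauss (norm z) = (\<Prod>b\<in>Basis. gauss (z \<bullet> b))"
    by (simp add: gauss_def exp_sum[symmetric] sum_negf sum_divide_distrib)
  also have "\<dots> = (\<Prod>b\<in>(Basis::'a set). sqrt (2 * pi) * std_normal_density (z \<bullet> b))"
    by (simp add: std_normal_density_def gauss_def)
  also have "\<dots> = sqrt (2 * pi) ^ DIM('a) * (\<Prod>b\<in>Basis. std_normal_density (z \<bullet> b))"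
    by (simp only: prod.distrib prod_constant)
  finally show ?thesis .
qed

lemma nn_integral_normal_product:
  "(\<integral>\<^sup>+z. ennreal (\<Prod>b\<in>Basis. std_normal_density (z \<bullet> b)) \<partial>(lborel :: 'a::euclidean_space measure)) = 1"
proof -
  have 1: "(\<integral>\<^sup>+x. ennreal (std_normal_density x) \<partial>lborel) = 1"
    using prob_space.emeasure_space_1[OF prob_space_normal_density[of 1 0]]
    by (simp add: emeasure_density)
  have "(\<integral>\<^sup>+z. ennreal (\<Prod>b\<in>Basis. std_normal_density (z \<bullet> b)) \<partial>(lborel :: 'a measure))
     = (\<integral>\<^sup>+z. (\<Prod>b\<in>Basis. ennreal (std_normal_density (z \<bullet> b))) \<partial>(lborel :: 'a measure))"
    by (simp add: prod_ennreal)
  also have "\<dots> = 1" by (subst nn_integral_lborel_prod) (simp_all add: 1)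
  finally show ?thesis .
qed

text \<open>The Gaussian factorizes over the coordinates, so its normalizing constant and moments are
  products of one-dimensional integrals.\<close>
lemma gauss_density:
  fixes z :: "real^'k"
  shows "elliptical_density (mat 1) gauss z = (\<Prod>b\<in>Basis. std_normal_density (z \<bullet> b))"
proof -
  let ?c = "sqrt (2 * pi) ^ DIM(real^'k)"
  have "integral\<^sup>L lborel (\<lambda>z :: real^'k. \<Prod>b\<in>Basis. std_normal_density (z \<bullet> b)) = 1"
    by (subst integral_eq_nn_integral) (auto simp: nn_integral_normal_product intro!: prod_nonneg borel_measurable_prod)
  then have "(LINT y|(lborel :: (real^'k) measure). gauss (norm y)) = ?c"
    unfolding gauss_product by simp
  moreover have "matrix_inv (mat 1 :: real^'k^'k) = mat 1" by (rule matrix_inv_eqI) simp_all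
  moreover have "sqrt (z \<bullet> z) = norm z" by (simp add: norm_eq_sqrt_inner)
  ultimately show ?thesis
    unfolding elliptical_density_def using gauss_product[of z] by simp
qed

lemma pos_def_one: "pos_def (mat 1 :: real^'k^'k)"
  by (simp add: pos_def_def)

lemma gauss_prob_space: "prob_space (error_law (mat 1 :: real^'k^'k) gauss)"
  by (rule prob_spaceI) (simp add: gauss_density emeasure_density nn_integral_normal_product borel_measurable_prod)

lemma gauss_second_moment:
  fixes M :: "real^'k^'k"
  shows "(\<integral>\<^sup>+y. ennreal ((norm (M *v y))\<^sup>2) \<partial>(error_law (mat 1 :: real^'k^'k) gauss)) < \<infinity>"
proof -
  let ?\<mu> = "error_law (mat 1 :: real^'k^'k) gauss"
  let ?g = "\<lambda>z::real^'k. \<Prod>b\<in>Basis. std_normal_density (z \<bullet> b)"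
  obtain K where K: "\<And>y. norm (M *v y) \<le> norm y * K"
    using bounded_linear.bounded[OF matrix_vector_mul_bounded_linear[of M]] by blast
  have coord: "(\<integral>\<^sup>+y. ennreal ((y \<bullet> c)\<^sup>2) \<partial>?\<mu>) < \<infinity>" if c: "c \<in> Basis" for c
  proof -
    \<comment> \<open>The square is attached to the factor of its own coordinate, which keeps the product form.\<close>
    let ?f = "\<lambda>b x. ennreal (std_normal_density x * (if b = c then x\<^sup>2 else 1))"
    have "(\<integral>\<^sup>+y. ennreal ((y \<bullet> c)\<^sup>2) \<partial>?\<mu>) = (\<integral>\<^sup>+y. ennreal (?g y) * ennreal ((y \<bullet> c)\<^sup>2) \<partial>lborel)"
      by (subst nn_integral_density) (auto simp: gauss_density intro!: borel_measurable_prod)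
    also have "\<dots> = (\<integral>\<^sup>+y. (\<Prod>b\<in>Basis. ?f b (y \<bullet> b)) \<partial>(lborel :: (real^'k) measure))"
    proof (intro nn_integral_cong)
      fix y :: "real^'k"
      have "(\<Prod>b\<in>Basis. std_normal_density (y \<bullet> b) * (if b = c then (y \<bullet> b)\<^sup>2 else 1)) = ?g y * (y \<bullet> c)\<^sup>2"
        using c by (simp add: prod.distrib)
      then show "ennreal (?g y) * ennreal ((y \<bullet> c)\<^sup>2) = (\<Prod>b\<in>Basis. ?f b (y \<bullet> b))"
        by (simp add: prod_ennreal ennreal_mult'[symmetric] ennreal_mult''[symmetric])
    qed
    also have "\<dots> = (\<Prod>b\<in>Basis. \<integral>\<^sup>+x. ?f b x \<partial>lborel)"
      by (rule nn_integral_lborel_prod) auto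
    also have "\<dots> < \<infinity>"
    proof -
      have "(\<integral>\<^sup>+x. ?f b x \<partial>lborel) \<noteq> \<infinity>" for b
      proof -
        have "integrable lborel (\<lambda>x. std_normal_density x * (if b = c then x\<^sup>2 else 1))"
          using integrable_std_normal_moment[of 2] integrable_std_normal_moment[of 0] by (cases "b = c") auto
        then show ?thesis by (subst nn_integral_eq_integral) auto
      qed
      then show ?thesis by (auto simp: less_top[symmetric] ennreal_prod_eq_top)
    qed
    finally show ?thesis .
  qed
  have "(\<integral>\<^sup>+y. ennreal ((norm (M *v y))\<^sup>2) \<partial>?\<mu>) \<le> (\<integral>\<^sup>+y. ennreal (K\<^sup>2) * (\<Sum>c\<in>Basis. ennreal ((y \<bullet> c)\<^sup>2)) \<partial>?\<mu>)"
  proof (rule nn_integral_mono)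
    fix y :: "real^'k"
    have "(norm (M *v y))\<^sup>2 \<le> (norm y * K)\<^sup>2" using K[of y] by (intro power_mono) auto
    also have "\<dots> = K\<^sup>2 * (\<Sum>c\<in>Basis. (y \<bullet> c)\<^sup>2)"
      unfolding power_mult_distrib power2_norm_eq_inner
      using euclidean_inner[of y y] by (simp add: power2_eq_square)
    finally show "ennreal ((norm (M *v y))\<^sup>2) \<le> ennreal (K\<^sup>2) * (\<Sum>c\<in>Basis. ennreal ((y \<bullet> c)\<^sup>2))"
      by (simp add: sum_nonneg ennreal_mult'[symmetric] ennreal_leI)
  qed
  also have "\<dots> = ennreal (K\<^sup>2) * (\<Sum>c\<in>Basis. \<integral>\<^sup>+y. ennreal ((y \<bullet> c)\<^sup>2) \<partial>?\<mu>)"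
    by (simp add: nn_integral_cmult nn_integral_sum del: sum_ennreal)
  also have "\<dots> < \<infinity>" using coord by (auto simp: ennreal_mult_less_top)
  finally show ?thesis .
qed

text \<open>The Gaussian density is positive, so $N y = 0$ almost everywhere; the exceptional set is open and
  null, hence empty.\<close>
lemma gauss_null_imp_zero:
  fixes N :: "real^'k^'k"
  assumes "(\<integral>\<^sup>+y. ennreal ((norm (N *v y))\<^sup>2) \<partial>(error_law (mat 1 :: real^'k^'k) gauss)) = 0"
  shows "N = 0"
proof -
  have pos: "elliptical_density (mat 1 :: real^'k^'k) gauss y > 0" for y
    unfolding gauss_density by (intro prod_pos ballI normal_density_pos) simp
  have "AE y in error_law (mat 1 :: real^'k^'k) gauss. ennreal ((norm (N *v y))\<^sup>2) = 0"
    using assms by (subst (asm) nn_integral_0_iff_AE) auto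
  then have "AE y in (lborel :: (real^'k) measure). N *v y = 0"
    using pos by (subst (asm) AE_density) (auto simp: gauss_density intro!: borel_measurable_prod)
  then have "{y. N *v y \<noteq> 0} \<in> null_sets lborel"
    by (subst (asm) AE_iff_null) auto
  then have "negligible {y. N *v y \<noteq> 0}"
    using negligible_iff_null_sets null_sets_completionI by blast
  moreover have "open {y. N *v y \<noteq> 0}"
    by (intro open_Collect_neq matrix_vector_mult_linear_continuous_on continuous_intros)
  ultimately have "{y. N *v y \<noteq> 0} = {}" using open_not_negligible by blast
  then show ?thesis by (intro matrix_eq[THEN iffD2]) auto
qed

lemma gauss_symmetric:
  "distr (error_law (mat 1 :: real^'k::{finite,wellorder}^'k::_) gauss) borel uminus = error_law (mat 1) gauss"
proof -
  have "invertible ((- 1) *\<^sub>R mat 1 :: real^'k::_^'k::_)" by (intro invertible_scaleR) (auto simp: invertible_def)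
  from error_law_linear_image[OF this pos_def_one gauss_radial]
  have "distr (error_law (mat 1 :: real^'k::_^'k::_) gauss) borel (\<lambda>x. ((- 1) *\<^sub>R mat 1) *v x)
      = error_law (((- 1) *\<^sub>R mat 1) ** mat 1 ** transpose ((- 1) *\<^sub>R mat 1)) gauss" .
  moreover have "(((- 1) *\<^sub>R mat 1) ** mat 1 ** transpose ((- 1) *\<^sub>R mat 1)) = (mat 1 :: real^'k::_^'k::_)"
    by (simp only: transpose_scaleR matrix_mult_scaleR) simp
  moreover have "(\<lambda>x. ((- 1) *\<^sub>R mat 1 :: real^'k::_^'k::_) *v x) = uminus"
    by (simp only: scaleR_matrix_vector_assoc[symmetric]) (simp add: fun_eq_iff)
  ultimately show ?thesis by simp
qed

text \<open>An independent symmetric summand $G e_s$ cannot leave the law of $F e_t$ unchanged unless it is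
  zero. By symmetry $F e_t + G e_s$ and $F e_t - G e_s$ have the same second moment, and the parallelogram
  identity adds the second moment of $G e_s$ to that of $F e_t$.\<close>
lemma gauss_perturbation_zero:
  fixes F G :: "real^'k::{finite,wellorder}^'k::_" and n s t :: nat
  defines "P \<equiv> innovation_law n (mat 1 :: real^'k::_^'k::_) gauss"
  assumes st: "s \<in> {1..n}" "t \<in> {1..n}" "s \<noteq> t"
    and law: "distr P borel (\<lambda>e. F *v e s) = distr P borel (\<lambda>e. F *v e t + G *v e s)"
  shows "G = 0"
proof -
  let ?\<mu> = "error_law (mat 1 :: real^'k::_^'k::_) gauss"
  let ?Pi = "PiM {1..n} (\<lambda>_. borel :: (real^'k::_) measure)"
  have P: "P = PiM {1..n} (\<lambda>_. ?\<mu>)" by (simp add: P_def innovation_law_def)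
  have setsP: "sets P = sets ?Pi" unfolding P_def by (rule sets_innovation_law)
  have proj: "(\<lambda>e. e i) \<in> P \<rightarrow>\<^sub>M borel" if "i \<in> {1..n}" for i
    unfolding measurable_cong_sets[OF setsP refl] using that by (rule measurable_component_singleton)
  have m1: "(\<lambda>e. H *v e i) \<in> borel_measurable P" if "i \<in> {1..n}" for i and H :: "real^'k::_^'k::_"
    by (rule measurable_compose[OF proj[OF that] matrix_vector_borel_measurable])
  note [measurable] = m1[OF st(1)] m1[OF st(2)]
  have marg: "distr P borel (\<lambda>e. e i) = ?\<mu>" if "i \<in> {1..n}" for i
  proof -
    have "distr P borel (\<lambda>e. e i) = distr P ?\<mu> (\<lambda>e. e i)" by (intro distr_cong) simp_all
    also have "\<dots> = ?\<mu>" unfolding P using gauss_prob_space that by (intro distr_PiM_component) auto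
    finally show ?thesis .
  qed
  define q where "q H = (\<integral>\<^sup>+y. ennreal ((norm (H *v y))\<^sup>2) \<partial>?\<mu>)" for H :: "real^'k::_^'k::_"
  have q: "(\<integral>\<^sup>+e. ennreal ((norm (H *v e i))\<^sup>2) \<partial>P) = q H" if "i \<in> {1..n}" for i H
    unfolding q_def marg[OF that, symmetric]
    by (simp add: nn_integral_distr[OF proj[OF that]])
  have plus: "(\<integral>\<^sup>+e. ennreal ((norm (F *v e t + G *v e s))\<^sup>2) \<partial>P) = q F"
  proof -
    have "(\<integral>\<^sup>+e. ennreal ((norm (F *v e t + G *v e s))\<^sup>2) \<partial>P)
       = (\<integral>\<^sup>+y. ennreal ((norm y)\<^sup>2) \<partial>distr P borel (\<lambda>e. F *v e t + G *v e s))"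
      by (subst nn_integral_distr) auto
    also have "\<dots> = (\<integral>\<^sup>+e. ennreal ((norm (F *v e s))\<^sup>2) \<partial>P)"
      unfolding law[symmetric] by (subst nn_integral_distr) auto
    finally show ?thesis using q[OF st(1)] by simp
  qed
  have minus: "(\<integral>\<^sup>+e. ennreal ((norm (F *v e t - G *v e s))\<^sup>2) \<partial>P) = q F"
  proof -
    \<comment> \<open>Changing the sign of coordinate \<open>s\<close> alone preserves the product law.\<close>
    define r where "r e = (\<lambda>i\<in>{1..n}. (if i = s then uminus else id) (e i))" for e :: "nat \<Rightarrow> real^'k::_"
    have rm: "r \<in> P \<rightarrow>\<^sub>M ?Pi"
      unfolding measurable_cong_sets[OF setsP refl] r_def
    proof (rule measurable_restrict)
      fix i assume "i \<in> {1..n}"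
      then show "(\<lambda>e. (if i = s then uminus else id) (e i)) \<in> borel_measurable ?Pi"
        by (auto intro!: borel_measurable_uminus measurable_component_singleton)
    qed
    have id: "distr ?\<mu> borel id = ?\<mu>" by (simp add: id_def) (rule distr_id2, simp)
    have "distr P ?Pi r = PiM {1..n} (\<lambda>i. distr ?\<mu> borel (if i = s then uminus else id))"
      unfolding P r_def
      by (rule distr_PiM_componentwise)
         (auto simp: gauss_symmetric id sigma_finite_error_law pos_def_one gauss_radial)
    also have "\<dots> = P" unfolding P by (intro PiM_cong refl) (simp add: gauss_symmetric id)
    finally have rP: "distr P ?Pi r = P" .
    have "(\<integral>\<^sup>+e. ennreal ((norm (F *v e t + G *v e s))\<^sup>2) \<partial>P) = (\<integral>\<^sup>+e. ennreal ((norm (F *v e t + G *v e s))\<^sup>2) \<partial>distr P ?Pi r)"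
      unfolding rP ..
    also have "\<dots> = (\<integral>\<^sup>+e. ennreal ((norm (F *v r e t + G *v r e s))\<^sup>2) \<partial>P)"
    proof (rule nn_integral_distr[OF rm])
      have "(\<lambda>e. ennreal ((norm (F *v e t + G *v e s))\<^sup>2)) \<in> borel_measurable P" by measurable
      then show "(\<lambda>e. ennreal ((norm (F *v e t + G *v e s))\<^sup>2)) \<in> borel_measurable (distr P ?Pi r)"
        unfolding rP .
    qed
    also have "\<dots> = (\<integral>\<^sup>+e. ennreal ((norm (F *v e t - G *v e s))\<^sup>2) \<partial>P)"
      using st by (intro nn_integral_cong) (simp add: r_def linear_neg[OF matrix_vector_mul_linear])
    finally show ?thesis using plus by simp
  qed
  have par: "(norm (a + b))\<^sup>2 + (norm (a - b))\<^sup>2 = 2 * (norm a)\<^sup>2 + 2 * (norm b)\<^sup>2" for a b :: "real^'k::_"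
    by (simp add: power2_norm_eq_inner algebra_simps inner_commute)
  have "q F + q F = (\<integral>\<^sup>+e. ennreal ((norm (F *v e t + G *v e s))\<^sup>2) + ennreal ((norm (F *v e t - G *v e s))\<^sup>2) \<partial>P)"
    by (subst nn_integral_add) (simp_all add: plus minus)
  also have "\<dots> = (\<integral>\<^sup>+e. 2 * ennreal ((norm (F *v e t))\<^sup>2) + 2 * ennreal ((norm (G *v e s))\<^sup>2) \<partial>P)"
  proof (intro nn_integral_cong)
    fix e :: "nat \<Rightarrow> real^'k::_"
    have "ennreal ((norm (F *v e t + G *v e s))\<^sup>2) + ennreal ((norm (F *v e t - G *v e s))\<^sup>2)
        = ennreal (2 * (norm (F *v e t))\<^sup>2 + 2 * (norm (G *v e s))\<^sup>2)"
      by (simp add: ennreal_plus[symmetric] par del: ennreal_plus)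
    then show "ennreal ((norm (F *v e t + G *v e s))\<^sup>2) + ennreal ((norm (F *v e t - G *v e s))\<^sup>2)
        = 2 * ennreal ((norm (F *v e t))\<^sup>2) + 2 * ennreal ((norm (G *v e s))\<^sup>2)"
      by (simp add: ennreal_mult)
  qed
  also have "\<dots> = 2 * q F + 2 * q G"
    using q[OF st(1), of G] q[OF st(2), of F] by (simp add: nn_integral_add nn_integral_cmult)
  finally have "q F + q F = (q F + q F) + 2 * q G" by (simp add: mult_2)
  moreover have "q F < \<infinity>" unfolding q_def by (rule gauss_second_moment)
  ultimately have "2 * q G = 0"
    by (metis add.right_neutral ennreal_add_left_cancel ennreal_add_eq_top infinity_ennreal_def less_irrefl)
  then have "q G = 0" by simp
  then show ?thesis unfolding q_def by (rule gauss_null_imp_zero)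
qed

section \<open>Invariance forces scalar coefficients\<close>

lemma psi_weight_0: "psi_weight A B p q 0 = (mat 1 :: real^'k^'k)"
  by (subst psi_weight.simps) (simp add: ma_coeff_def)

text \<open>The residuals of $(M X_t)$ are the only candidates $e'$ with $\sum_u \Psi_u e'_{t-u} = M X_t$. Moving $M$ past
  $\Psi_u$ is allowed for $u < m$, so the first discrepancy appears in the summand $u = m$, at time
  $m + 1$.\<close>
lemma residual_of_image:
  fixes M :: "real^'k^'k" and A B :: "nat \<Rightarrow> real^'k^'k" and p q m s :: nat
  defines "\<psi> \<equiv> psi_weight A B p q"
  assumes comm: "\<And>u. u < m \<Longrightarrow> M ** \<psi> u = \<psi> u ** M" and m: "m > 0" and s: "s \<in> {1..Suc m}"
    and x: "\<And>t. t \<in> {1..Suc m} \<Longrightarrow> x t = M *v psi_series A B p q e t"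
  shows "residual A B p q x s = M *v e s + (if s = Suc m then (M ** \<psi> m - \<psi> m ** M) *v e 1 else 0)"
proof -
  let ?N = "M ** \<psi> m - \<psi> m ** M"
  \<comment> \<open>By uniqueness of the innovations it is enough to check that this guess generates \<open>x\<close>.\<close>
  define e' where "e' t = M *v e t + (if t = Suc m then ?N *v e 1 else 0)" for t
  have "psi_series A B p q e' t = x t" if t: "t \<in> {1..Suc m}" for t
  proof (cases "t = Suc m")
    case False
    have "psi_series A B p q e' t = (\<Sum>u<t. M *v (\<psi> u *v e (t - u)))"
      unfolding psi_series_def \<psi>_def[symmetric]
      using t False by (intro sum.cong) (auto simp: e'_def matrix_vector_mul_assoc comm)
    then show ?thesis using x[OF t] by (simp add: psi_series_def \<psi>_def vec.sum)
  next
    case True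
    have idx: "{..<t} = insert 0 (insert m {1..<m})" using True m by auto
    have split: "(\<Sum>u<t. g u) = g 0 + (g m + (\<Sum>u\<in>{1..<m}. g u))" for g :: "nat \<Rightarrow> real^'k"
      unfolding idx using m by simp
    have mid: "(\<Sum>u\<in>{1..<m}. \<psi> u *v e' (t - u)) = (\<Sum>u\<in>{1..<m}. M *v (\<psi> u *v e (t - u)))"
      using True by (intro sum.cong) (auto simp: e'_def matrix_vector_mul_assoc comm)
    have "psi_series A B p q e' t = (M *v e (Suc m) + ?N *v e 1) + (\<psi> m *v (M *v e 1) + (\<Sum>u\<in>{1..<m}. M *v (\<psi> u *v e (t - u))))"
      unfolding psi_series_def \<psi>_def[symmetric] split mid
      using True m by (simp add: e'_def psi_weight_0 \<psi>_def)
    also have "\<dots> = M *v e (Suc m) + (M *v (\<psi> m *v e 1) + (\<Sum>u\<in>{1..<m}. M *v (\<psi> u *v e (t - u))))"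
      by (simp add: matrix_vector_mult_diff_rdistrib matrix_vector_mul_assoc)
    also have "\<dots> = M *v psi_series A B p q e t"
      unfolding psi_series_def \<psi>_def[symmetric] split
      using True by (simp add: psi_weight_0 \<psi>_def vec.sum matrix_vector_right_distrib)
    finally show ?thesis using x[OF t] by simp
  qed
  then have "varma_eq A B p q (Suc m) x e'"
    using varma_eq_psi_series[of A B p q "Suc m" e'] by (subst (asm) varma_eq_cong[where x' = x and e' = e']) auto
  from varma_eq_residual[OF this s] show ?thesis by (simp add: e'_def)
qed

lemma ennreal_power_eq_one:
  fixes x :: ennreal
  assumes "x ^ n = 1" "n > 0"
  shows "x = 1"
proof (cases x)
  case (real r)
  then have "r ^ n = 1" using assms(1) by (simp add: ennreal_power)
  then have "r = 1" using real(1) assms(2) by (intro power_eq_imp_eq_base[of r n 1]) simp_all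
  then show ?thesis using real by simp
qed (use assms in \<open>auto simp: top_power_ennreal\<close>)

text \<open>The total mass of a product of $n$ copies is an $n$-th power.\<close>
lemma error_law_prob_space:
  fixes S :: "real^'k^'k"
  assumes S: "pos_def S" and f: "radial_density CARD('k) f" and "n > 0"
    and P: "emeasure (innovation_law n S f) (space (innovation_law n S f)) = 1"
  shows "prob_space (error_law S f)"
proof (rule prob_spaceI)
  interpret product_sigma_finite "\<lambda>_::nat. error_law S f"
    using sigma_finite_error_law[OF S f] by (simp add: product_sigma_finite_def)
  have "emeasure (innovation_law n S f) (space (innovation_law n S f)) = (\<Prod>i\<in>{1..n}. emeasure (error_law S f) (space (error_law S f)))"
    unfolding innovation_law_def space_PiM by (rule emeasure_PiM) simp_all
  then have "emeasure (error_law S f) (space (error_law S f)) ^ n = 1" using P by simp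
  then show "emeasure (error_law S f) (space (error_law S f)) = 1" using \<open>n > 0\<close> by (rule ennreal_power_eq_one)
qed

text \<open>Whatever the shape and the radial density, the residuals recover the innovations, which are
  identically distributed. That $L$ is a probability measure is what makes each marginal of the product
  the common factor.\<close>
lemma null_hyp_residual_identically_distributed:
  fixes A B :: "nat \<Rightarrow> real^'k::{finite,wellorder}^'k::_"
  assumes L: "L \<in> null_hyp A B p q n" "prob_space L" and s: "s \<in> {1..n}" and t: "t \<in> {1..n}"
  shows "distr L borel (\<lambda>x. residual A B p q x s) = distr L borel (\<lambda>x. residual A B p q x t)"
proof -
  let ?Pi = "PiM {1..n} (\<lambda>_. borel :: (real^'k::_) measure)"
  from L obtain S f X where S: "pos_def S" and f: "radial_density CARD('k) f"
    and X: "X \<in> innovation_law n S f \<rightarrow>\<^sub>M ?Pi"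
    and eq: "\<And>e. e \<in> space (innovation_law n S f) \<Longrightarrow> varma_eq A B p q n (X e) e"
    and L_def: "L = distr (innovation_law n S f) ?Pi X"
    by (auto simp: null_hyp_def null_hyp_at_def)
  let ?P = "innovation_law n S f"
  have "emeasure L (space L) = emeasure ?P (X -` space ?Pi \<inter> space ?P)"
    unfolding L_def space_distr by (rule emeasure_distr[OF X]) simp
  also have "X -` space ?Pi \<inter> space ?P = space ?P" using measurable_space[OF X] by auto
  finally have "emeasure ?P (space ?P) = emeasure L (space L)" ..
  then have "emeasure ?P (space ?P) = 1" using prob_space.emeasure_space_1[OF L(2)] by simp
  then have prob: "prob_space (error_law S f)" using s by (intro error_law_prob_space[OF S f, of n]) auto
  have "distr L borel (\<lambda>x. residual A B p q x r) = error_law S f" if r: "r \<in> {1..n}" for r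
  proof -
    have "distr L borel (\<lambda>x. residual A B p q x r) = distr ?P borel ((\<lambda>x. residual A B p q x r) \<circ> X)"
      unfolding L_def by (rule distr_distr[OF residual_measurable[OF r] X])
    also have "\<dots> = distr ?P (error_law S f) (\<lambda>e. e r)"
      using varma_eq_residual[OF eq r] by (intro distr_cong) auto
    also have "\<dots> = error_law S f"
      unfolding innovation_law_def using prob r by (intro distr_PiM_component) auto
    finally show ?thesis .
  qed
  then show ?thesis using s t by simp
qed

text \<open>By induction all earlier weights commute with $M$. Under Gaussian innovations the law of $(M X_t)$
  belongs to the null hypothesis, so its residuals at times $1$ and $m + 1$ have the same law.\<close>
lemma affine_invariant_imp_psi_weights_commute:
  fixes A B :: "nat \<Rightarrow> real^'k::{finite,wellorder}^'k::_"
  assumes inv: "null_hyp_affine_invariant A B p q" and M: "invertible M"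
  shows "M ** psi_weight A B p q m = psi_weight A B p q m ** M"
proof (induction m rule: less_induct)
  case (less m)
  show ?case
  proof (cases "m = 0")
    case True
    then show ?thesis by (simp add: psi_weight_0)
  next
    case False
    let ?n = "Suc m" and ?\<psi> = "psi_weight A B p q"
    let ?N = "M ** ?\<psi> m - ?\<psi> m ** M"
    let ?Pi = "PiM {1..?n} (\<lambda>_. borel :: (real^'k::_) measure)"
    let ?P = "innovation_law ?n (mat 1 :: real^'k::_^'k::_) gauss"
    define X where "X e = (\<lambda>t\<in>{1..?n}. psi_series A B p q e t)" for e
    define L where "L = distr ?P ?Pi X"
    define L' where "L' = distr L ?Pi (apply_each ?n M)"
    have Xm: "X \<in> ?P \<rightarrow>\<^sub>M ?Pi"
      unfolding X_def measurable_cong_sets[OF sets_innovation_law refl] by (rule psi_series_measurable)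
    have "varma_eq A B p q ?n (X e) e" for e
      using varma_eq_psi_series[of A B p q ?n e] by (subst (asm) varma_eq_cong[where x' = "X e" and e' = e]) (auto simp: X_def)
    then have "L \<in> null_hyp_at A B p q ?n (mat 1) gauss"
      unfolding null_hyp_at_def L_def using Xm by blast
    then have "L \<in> null_hyp A B p q ?n"
      unfolding null_hyp_def using pos_def_one gauss_radial by blast
    then have L': "L' \<in> null_hyp A B p q ?n"
      unfolding L'_def using inv M unfolding null_hyp_affine_invariant_def by blast
    have "prob_space ?P"
      unfolding innovation_law_def by (intro prob_space_PiM gauss_prob_space)
    then have "prob_space L" unfolding L_def by (rule prob_space.prob_space_distr[OF _ Xm])
    moreover have Tm: "apply_each ?n M \<in> L \<rightarrow>\<^sub>M ?Pi" by (simp add: L_def apply_each_measurable)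
    ultimately have "prob_space L'" unfolding L'_def by (rule prob_space.prob_space_distr)
    have res: "distr L' borel (\<lambda>x. residual A B p q x s)
        = distr ?P borel (\<lambda>e. M *v e s + (if s = ?n then ?N *v e 1 else 0))" if s: "s \<in> {1..?n}" for s
    proof -
      have "distr L' borel (\<lambda>x. residual A B p q x s)
          = distr ?P borel ((\<lambda>x. residual A B p q x s) \<circ> (apply_each ?n M \<circ> X))"
        unfolding L'_def L_def
        by (subst distr_distr[OF apply_each_measurable Xm], rule distr_distr[OF residual_measurable[OF s]])
           (rule measurable_comp[OF Xm apply_each_measurable])
      also have "\<dots> = distr ?P borel (\<lambda>e. M *v e s + (if s = ?n then ?N *v e 1 else 0))"
      proof (rule distr_cong[OF refl refl])
        fix e
        show "((\<lambda>x. residual A B p q x s) \<circ> (apply_each ?n M \<circ> X)) e = M *v e s + (if s = ?n then ?N *v e 1 else 0)"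
          unfolding o_def using less.IH False s by (intro residual_of_image) (auto simp: X_def)
      qed
      finally show ?thesis .
    qed
    have "distr L' borel (\<lambda>x. residual A B p q x 1) = distr L' borel (\<lambda>x. residual A B p q x ?n)"
      by (rule null_hyp_residual_identically_distributed[OF L' \<open>prob_space L'\<close>]) simp_all
    then have "distr ?P borel (\<lambda>e. M *v e 1) = distr ?P borel (\<lambda>e. M *v e ?n + ?N *v e 1)"
      using res[of 1] res[of ?n] False by simp
    then have "?N = 0"
      using False by (intro gauss_perturbation_zero[of 1 ?n ?n M]) auto
    then show ?thesis by simp
  qed
qed

text \<open>The coefficients beyond $p_0$ and $q_0$ vanish, so the two model equations coincide.\<close>
lemma null_hyp_order_reduction:
  assumes "p0 \<le> p1" "q0 \<le> q1" and A: "\<forall>i\<in>{p0<..p1}. A i = 0" and B: "\<forall>j\<in>{q0<..q1}. B j = 0"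
  shows "null_hyp_affine_invariant A B p1 q1 \<longleftrightarrow> null_hyp_affine_invariant A B p0 q0"
proof -
  have "(\<Sum>i=1..p1. A i *v lag x t i) = (\<Sum>i=1..p0. A i *v lag x t i)" for x t
    using assms by (intro sum.mono_neutral_right) auto
  moreover have "(\<Sum>i=1..q1. B i *v lag x t i) = (\<Sum>i=1..q0. B i *v lag x t i)" for x t
    using assms by (intro sum.mono_neutral_right) auto
  ultimately have "varma_eq A B p1 q1 = varma_eq A B p0 q0"
    by (simp add: fun_eq_iff varma_eq_def)
  then show ?thesis by (simp add: null_hyp_affine_invariant_def null_hyp_def null_hyp_at_def)
qed

theorem proposition5:
  fixes A B :: "nat \<Rightarrow> real^'k::{finite,wellorder}^'k::_"
    and p0 p1 q0 q1 :: nat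
    and K1 K2 :: "real \<Rightarrow> real"
  assumes "p0 \<le> p1" and "q0 \<le> q1"
    and "\<forall>i\<in>{p0<..p1}. A i = 0" and "\<forall>j\<in>{q0<..q1}. B j = 0"
    and "assumption_A A B p0 q0"
    and "score_function K1" and "score_function K2"
  shows "(null_hyp_affine_invariant A B p1 q1 \<longleftrightarrow>
            (\<exists>a b :: nat \<Rightarrow> real.
               (\<forall>i\<in>{1..p0}. A i = a i *\<^sub>R mat 1) \<and> (\<forall>j\<in>{1..q0}. B j = b j *\<^sub>R mat 1)))
       \<and> (null_hyp_affine_invariant A B p1 q1 \<longrightarrow>
            (\<forall>D Y n. is_D_system A B p0 q0 D \<and> fundamental_system D (p0 + q0) Y \<longrightarrow>
               affine_invariant_on (Q_stat_domain A B p0 p1 q0 q1 Y n)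
                 (Q_stat A B p0 p1 q0 q1 Y K1 K2 n)))"
proof -
  note red = null_hyp_order_reduction[OF assms(1-4)]
  have scalar: "\<exists>a b :: nat \<Rightarrow> real.
       (\<forall>i\<in>{1..p0}. A i = a i *\<^sub>R mat 1) \<and> (\<forall>j\<in>{1..q0}. B j = b j *\<^sub>R mat 1)"
    if inv: "null_hyp_affine_invariant A B p0 q0"
  proof -
    have "\<exists>c. psi_weight A B p0 q0 u = c *\<^sub>R mat 1" for u
      using affine_invariant_imp_psi_weights_commute[OF inv] by (rule commutes_with_all_imp_scalar)
    then obtain s where "\<And>u. psi_weight A B p0 q0 u = s u *\<^sub>R mat 1" by metis
    then show ?thesis by (rule scalar_psi_weights_imp_scalar_coefficients[OF assms(5)])
  qed
  show ?thesis
    unfolding red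
  proof (intro conjI iffI impI allI; (elim exE conjE)?)
    assume "null_hyp_affine_invariant A B p0 q0"
    then show "\<exists>a b :: nat \<Rightarrow> real.
       (\<forall>i\<in>{1..p0}. A i = a i *\<^sub>R mat 1) \<and> (\<forall>j\<in>{1..q0}. B j = b j *\<^sub>R mat 1)" by (rule scalar)
  next
    fix a b :: "nat \<Rightarrow> real"
    assume "\<forall>i\<in>{1..p0}. A i = a i *\<^sub>R mat 1" "\<forall>j\<in>{1..q0}. B j = b j *\<^sub>R mat 1"
    then show "null_hyp_affine_invariant A B p0 q0"
      by (intro scalar_imp_null_hyp_affine_invariant[where a = a and b = b]) auto
  next
    fix D Y n
    assume "null_hyp_affine_invariant A B p0 q0"
      and D: "is_D_system A B p0 q0 D" and Y: "fundamental_system D (p0 + q0) Y"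
    then obtain a b :: "nat \<Rightarrow> real" where
      "\<forall>i\<in>{1..p0}. A i = a i *\<^sub>R mat 1" "\<forall>j\<in>{1..q0}. B j = b j *\<^sub>R mat 1"
      using scalar by blast
    then show "affine_invariant_on (Q_stat_domain A B p0 p1 q0 q1 Y n) (Q_stat A B p0 p1 q0 q1 Y K1 K2 n)"
      using assms(5) D Y by (intro Q_stat_affine_invariant[where a = a and b = b]) auto
  qed
qed

end
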